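(* Let $p$ be a prime and let $G$ be a non-abelian $p\mathcal{E}$-group that can be generated by three elements. Write $\exp(G/G')=p^r$ and $\exp(G')=p^t$, and assume that either $p>2$, or $p=2$ and $\exp(G')\neq 2^r$ (i.e. $t\neq r$). Then $1\le t\le r$, $|G|=p^{3(r+t)}$, and there is a matrix $[t_{ij}]\in GL(3,\mathbb{Z}_{p^t})$ such that $G$ has the presentation with generators $x,y,z$ and relations $$x^{p^{r+t}}=y^{p^{r+t}}=z^{p^{r+t}}=1,$$ $$[x^{p^t},y]=[x^{p^t},z]=[y^{p^t},x]=[y^{p^t},z]=[z^{p^t},x]=[z^{p^t},y]=1,$$ $$[x,y]=x^{p^rt_{11}}y^{p^rt_{12}}z^{p^rt_{13}},\quad [x,z]=x^{p^rt_{21}}y^{p^rt_{22}}z^{p^rt_{23}},\quad [y,z]=x^{p^rt_{31}}y^{p^rt_{32}}z^{p^rt_{33}}.$$ Moreover, for every prime $p$, all integers $1\le t\le r$ such that $p>2$ or ($p=2$ and $t\neq r$), and every $[t_{ij}]\in GL(3,\mathbb{Z}_{p^t})$, the group given by this presentation is a $p\mathcal{E}$-group.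
   Context: Commutators are $[g,h]=g^{-1}h^{-1}gh$; $G'$ is the derived subgroup, $Z(G)$ the center and $\exp$ denotes the exponent. A group is 2-Engel if $[[g,h],h]=1$ for all $g,h$. For a $p$-group $G$, $\Omega_r(G)=\langle g\in G : g^{p^r}=1\rangle$. A finite $p$-group $G$ is called a $p\mathcal{E}$-group if $G$ is 2-Engel and there is a non-negative integer $r$ such that $\exp(G/G')=p^r$ and $\Omega_r(G)\le Z(G)$. $\mathbb{Z}_{p^t}$ is the ring of integers modulo $p^t$; in the relations the entries $t_{ij}$ are replaced by arbitrary integer representatives (the choice is irrelevant because of the relations $x^{p^{r+t}}=y^{p^{r+t}}=z^{p^{r+t}}=1$). *)

theory Defs
  imports "HOL-Analysis.Finite_Cartesian_Product" "HOL-Algebra.Algebra" "HOL-Number_Theory.Residues"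
begin

text \<open>Words over an alphabet: the letter \<open>(a, True)\<close> stands for the generator \<open>a\<close> and
  \<open>(a, False)\<close> for its formal inverse.\<close>

type_synonym 'a word = "('a \<times> bool) list"

inductive word_eq :: "'a word \<Rightarrow> 'a word \<Rightarrow> bool" where
  cancel: "word_eq (u @ (a, b) # (a, \<not> b) # v) (u @ v)"
| refl: "word_eq u u"
| sym: "word_eq u v \<Longrightarrow> word_eq v u"
| trans: "word_eq u v \<Longrightarrow> word_eq v w \<Longrightarrow> word_eq u w"

definition word_class :: "'a word \<Rightarrow> 'a word set" where
  "word_class u = {v. word_eq u v}"

text \<open>The free group on the whole type \<open>'a\<close>.\<close>

definition free_group :: "'a word set monoid" where
  "free_group =
    \<lparr>carrier = range word_class,
     monoid.mult = (\<lambda>A B. \<Union>u\<in>A. \<Union>v\<in>B. word_class (u @ v)),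
     one = word_class []\<rparr>"

definition free_gen :: "'a \<Rightarrow> 'a word set" where
  "free_gen a = word_class [(a, True)]"

definition normal_closure :: "('a, 'b) monoid_scheme \<Rightarrow> 'a set \<Rightarrow> 'a set" where
  "normal_closure G S = generate G {g \<otimes>\<^bsub>G\<^esub> s \<otimes>\<^bsub>G\<^esub> inv\<^bsub>G\<^esub> g | g s. g \<in> carrier G \<and> s \<in> S}"

text \<open>A pair \<open>(u, v)\<close> in \<open>R\<close> is the relation \<open>u = v\<close>, i.e. it contributes the relator
  \<open>u v\<^sup>-\<^sup>1\<close>.\<close>

definition presented_group :: "('a word set \<times> 'a word set) set \<Rightarrow> 'a word set set monoid" where
  "presented_group R =
    free_group Mod
      normal_closure free_group {u \<otimes>\<^bsub>free_group\<^esub> inv\<^bsub>free_group\<^esub> v | u v. (u, v) \<in> R}"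

lemma word_eq_append_left: "word_eq u v \<Longrightarrow> word_eq (w @ u) (w @ v)"
proof (induction rule: word_eq.induct)
  case (cancel u a b v)
  then show ?case using word_eq.cancel[of "w @ u" a b v] by simp
qed (fact word_eq.refl, erule word_eq.sym, erule (1) word_eq.trans)

lemma word_eq_append_right: "word_eq u v \<Longrightarrow> word_eq (u @ w) (v @ w)"
proof (induction rule: word_eq.induct)
  case (cancel u a b v)
  then show ?case using word_eq.cancel[of u a b "v @ w"] by simp
qed (fact word_eq.refl, erule word_eq.sym, erule (1) word_eq.trans)

lemma word_class_eq_iff: "word_class u = word_class v \<longleftrightarrow> word_eq u v"
proof
  assume "word_class u = word_class v"
  moreover have "v \<in> word_class v" by (simp add: word_class_def word_eq.refl)
  ultimately show "word_eq u v" by (simp add: word_class_def set_eq_iff word_eq.refl)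
next
  assume uv: "word_eq u v"
  have "word_eq u w \<longleftrightarrow> word_eq v w" for w
    using word_eq.trans[OF uv] word_eq.trans[OF word_eq.sym[OF uv]] by metis
  then show "word_class u = word_class v" by (simp add: word_class_def)
qed

lemma free_group_mult:
  "word_class u \<otimes>\<^bsub>free_group\<^esub> word_class v = word_class (u @ v)"
proof -
  have "word_class (u' @ v') = word_class (u @ v)"
    if "u' \<in> word_class u" "v' \<in> word_class v" for u' v'
  proof -
    have "word_eq (u @ v) (u' @ v)" "word_eq (u' @ v) (u' @ v')"
      using that by (simp_all add: word_class_def word_eq_append_left word_eq_append_right)
    then show ?thesis
      unfolding word_class_eq_iff by (rule word_eq.sym[OF word_eq.trans])
  qed
  moreover have "u \<in> word_class u" "v \<in> word_class v"
    by (auto simp: word_class_def intro: word_eq.refl)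
  ultimately have "(\<Union>u'\<in>word_class u. \<Union>v'\<in>word_class v. word_class (u' @ v')) = word_class (u @ v)"
    by blast
  then show ?thesis by (simp add: free_group_def)
qed

lemma word_eq_inverse: "word_eq (map (\<lambda>(a, b). (a, \<not> b)) (rev w) @ w) []"
proof (induction w)
  case Nil
  then show ?case by (simp add: word_eq.refl)
next
  case (Cons x w)
  obtain a b where x: "x = (a, b)" by force
  let ?i = "map (\<lambda>(a, b). (a, \<not> b)) (rev w)"
  have "word_eq (?i @ (a, \<not> b) # (a, b) # w) (?i @ w)"
    using word_eq.cancel[of ?i a "\<not> b" w] by simp
  from word_eq.trans[OF this Cons] show ?case by (simp add: x)
qed

lemma group_free_group: "group (free_group :: 'a word set monoid)"
proof (rule groupI)
  fix A :: "'a word set" assume "A \<in> carrier free_group"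
  then obtain w where w: "A = word_class w" by (auto simp: free_group_def)
  have "word_class (map (\<lambda>(a, b). (a, \<not> b)) (rev w)) \<otimes>\<^bsub>free_group\<^esub> A = \<one>\<^bsub>free_group\<^esub>"
    unfolding w free_group_mult by (simp add: free_group_def word_class_eq_iff word_eq_inverse)
  then show "\<exists>B\<in>carrier free_group. B \<otimes>\<^bsub>free_group\<^esub> A = \<one>\<^bsub>free_group\<^esub>"
    by (force simp: free_group_def)
next
  fix A B :: "'a word set" assume "A \<in> carrier free_group" "B \<in> carrier free_group"
  then obtain u v where "A = word_class u" "B = word_class v" by (auto simp: free_group_def)
  then have "A \<otimes>\<^bsub>free_group\<^esub> B = word_class (u @ v)" by (simp add: free_group_mult)
  then show "A \<otimes>\<^bsub>free_group\<^esub> B \<in> carrier free_group" by (simp add: free_group_def)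
next
  show "\<one>\<^bsub>free_group\<^esub> \<in> carrier (free_group :: 'a word set monoid)"
    by (simp add: free_group_def)
next
  fix A B C :: "'a word set"
  assume "A \<in> carrier free_group" "B \<in> carrier free_group" "C \<in> carrier free_group"
  then obtain u v w where "A = word_class u" "B = word_class v" "C = word_class w"
    by (auto simp: free_group_def)
  then show "A \<otimes>\<^bsub>free_group\<^esub> B \<otimes>\<^bsub>free_group\<^esub> C = A \<otimes>\<^bsub>free_group\<^esub> (B \<otimes>\<^bsub>free_group\<^esub> C)"
    by (simp add: free_group_mult)
next
  fix A :: "'a word set" assume "A \<in> carrier free_group"
  then obtain w where w: "A = word_class w" by (auto simp: free_group_def)
  have "\<one>\<^bsub>free_group\<^esub> = word_class ([] :: 'a word)" by (simp add: free_group_def)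
  then show "\<one>\<^bsub>free_group\<^esub> \<otimes>\<^bsub>free_group\<^esub> A = A"
    by (simp add: w free_group_mult)
qed

definition finite_p_group :: "nat \<Rightarrow> ('a, 'b) monoid_scheme \<Rightarrow> bool" where
  "finite_p_group p G \<longleftrightarrow> group G \<and> finite (carrier G) \<and> (\<exists>n. order G = p ^ n)"

text \<open>Only meaningful for groups of finite exponent; it is applied to finite groups only.\<close>

definition group_exponent :: "('a, 'b) monoid_scheme \<Rightarrow> nat" where
  "group_exponent G = (LEAST n. n > 0 \<and> (\<forall>g\<in>carrier G. g [^]\<^bsub>G\<^esub> n = \<one>\<^bsub>G\<^esub>))"

definition commutator :: "('a, 'b) monoid_scheme \<Rightarrow> 'a \<Rightarrow> 'a \<Rightarrow> 'a" where
  "commutator G g h = inv\<^bsub>G\<^esub> g \<otimes>\<^bsub>G\<^esub> inv\<^bsub>G\<^esub> h \<otimes>\<^bsub>G\<^esub> g \<otimes>\<^bsub>G\<^esub> h"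

definition group_center :: "('a, 'b) monoid_scheme \<Rightarrow> 'a set" where
  "group_center G = {z \<in> carrier G. \<forall>g\<in>carrier G. z \<otimes>\<^bsub>G\<^esub> g = g \<otimes>\<^bsub>G\<^esub> z}"

text \<open>The library's \<open>derived\<close> is generated by the elements \<open>g h g\<^sup>-\<^sup>1 h\<^sup>-\<^sup>1\<close>; this is
  the set of all \<open>commutator G (inv g) (inv h)\<close>, so both conventions give the same subgroup.\<close>

abbreviation derived_subgroup :: "('a, 'b) monoid_scheme \<Rightarrow> 'a set" where
  "derived_subgroup G \<equiv> derived G (carrier G)"

definition two_Engel :: "('a, 'b) monoid_scheme \<Rightarrow> bool" where
  "two_Engel G \<longleftrightarrow>
    (\<forall>g\<in>carrier G. \<forall>h\<in>carrier G. commutator G (commutator G g h) h = \<one>\<^bsub>G\<^esub>)"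

definition Omega :: "nat \<Rightarrow> nat \<Rightarrow> ('a, 'b) monoid_scheme \<Rightarrow> 'a set" where
  "Omega p r G = generate G {g \<in> carrier G. g [^]\<^bsub>G\<^esub> (p ^ r) = \<one>\<^bsub>G\<^esub>}"

definition pE_group :: "nat \<Rightarrow> ('a, 'b) monoid_scheme \<Rightarrow> bool" where
  "pE_group p G \<longleftrightarrow>
    finite_p_group p G \<and> two_Engel G \<and>
    (\<exists>r. group_exponent (G Mod derived_subgroup G) = p ^ r \<and> Omega p r G \<subseteq> group_center G)"

definition matrix_monoid :: "('a, 'b) ring_scheme \<Rightarrow> ('a ^ 'n ^ 'n) monoid" where
  "matrix_monoid R =
    \<lparr>carrier = {A. \<forall>i j. A $ i $ j \<in> carrier R},
     monoid.mult = (\<lambda>A B. \<chi> i j. \<Oplus>\<^bsub>R\<^esub>k\<in>UNIV. A $ i $ k \<otimes>\<^bsub>R\<^esub> B $ k $ j),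
     one = (\<chi> i j. if i = j then \<one>\<^bsub>R\<^esub> else \<zero>\<^bsub>R\<^esub>)\<rparr>"

definition GL :: "('a, 'b) ring_scheme \<Rightarrow> ('a ^ 'n ^ 'n) set" where
  "GL R = Units (matrix_monoid R)"

datatype gen3 = Gx | Gy | Gz

text \<open>The entries of \<open>T\<close> are integers, to be read as representatives of residues modulo
  \<open>p ^ t\<close>.\<close>

definition pE_relations ::
    "nat \<Rightarrow> nat \<Rightarrow> nat \<Rightarrow> int ^ 3 ^ 3 \<Rightarrow> (gen3 word set \<times> gen3 word set) set" where
  "pE_relations p r t T =
    (let F = free_group; e = \<one>\<^bsub>F\<^esub>;
         x = free_gen Gx; y = free_gen Gy; z = free_gen Gz;
         rhs = (\<lambda>i. x [^]\<^bsub>F\<^esub> (int (p ^ r) * T $ i $ 1) \<otimes>\<^bsub>F\<^esub>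
                     y [^]\<^bsub>F\<^esub> (int (p ^ r) * T $ i $ 2) \<otimes>\<^bsub>F\<^esub>
                     z [^]\<^bsub>F\<^esub> (int (p ^ r) * T $ i $ 3))
     in {(x [^]\<^bsub>F\<^esub> (p ^ (r + t)), e), (y [^]\<^bsub>F\<^esub> (p ^ (r + t)), e), (z [^]\<^bsub>F\<^esub> (p ^ (r + t)), e),
         (commutator F (x [^]\<^bsub>F\<^esub> (p ^ t)) y, e), (commutator F (x [^]\<^bsub>F\<^esub> (p ^ t)) z, e),
         (commutator F (y [^]\<^bsub>F\<^esub> (p ^ t)) x, e), (commutator F (y [^]\<^bsub>F\<^esub> (p ^ t)) z, e),
         (commutator F (z [^]\<^bsub>F\<^esub> (p ^ t)) x, e), (commutator F (z [^]\<^bsub>F\<^esub> (p ^ t)) y, e),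
         (commutator F x y, rhs 1), (commutator F x z, rhs 2), (commutator F y z, rhs 3)})"

definition represents :: "int ^ 'n ^ 'n \<Rightarrow> nat \<Rightarrow> int ^ 'n ^ 'n \<Rightarrow> bool" where
  "represents T m M \<longleftrightarrow> (\<forall>i j. [T $ i $ j = M $ i $ j] (mod int m))"

end

(* A 2-Engel group has class at most 3 (Levi), and for a three-generated pE-group the condition on
   Omega_r(G) forces class at most 2. Then x |-> x^(p^r) is a homomorphism from G to G' with central
   kernel, so |G/Z(G)| <= |G'|. As G/Z(G) carries the nondegenerate alternating commutator form with
   values in a group of exponent p^t and G has three generators, this is only possible if
   |G/Z(G)| = |G'| = p^(3t). Hence G' consists of the p^r-th powers and is homocyclic of rank 3;
   the commutators of the generators and the p^r-th powers of the generators are two bases of G',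
   and the matrix relating them is [t_ij].
   The presented group has at most p^(3(r+t)) elements x^i y^j z^k, and exactly that many because
   triples of integers modulo p^(r+t) with a bilinearly twisted addition satisfy the relations.
   Uniqueness of the normal form yields both the isomorphism and the converse. *)

theory Submission
  imports Defs "HOL-Analysis.Cartesian_Space"
begin

text \<open>Three is the number n of generators with n(n-1)/2 = n: there are as many basic
  commutators as generators, so the bound |G/Z(G)| <= |G'| leaves no slack. If a member c of a
  generating triple a, b, c had a central p^s-th power with s < t, then [a,c] and [b,c] would have
  exponent p^s, only [a,b] could still have order p^t, and G' would be too small to receive the
  p^r-th powers. Hence all three directions of G/Z(G) have the full order p^t. In the converse,
  invertibility of [t_ij] enters at one point: it expresses the p^r-th powers of the generators by
  commutators, which is what brings exp(G/G') down to p^r.\<close>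

section \<open>2-Engel groups\<close>

context group begin

lemma inv_cancel_left [simp]:
  "x \<in> carrier G \<Longrightarrow> y \<in> carrier G \<Longrightarrow> inv x \<otimes> (x \<otimes> y) = y"
  "x \<in> carrier G \<Longrightarrow> y \<in> carrier G \<Longrightarrow> x \<otimes> (inv x \<otimes> y) = y"
  by (simp_all add: m_assoc [symmetric])

lemma commutator_closed [simp, intro]:
  "x \<in> carrier G \<Longrightarrow> y \<in> carrier G \<Longrightarrow> commutator G x y \<in> carrier G"
  by (simp add: commutator_def)

definition conjugate :: "'a \<Rightarrow> 'a \<Rightarrow> 'a" where
  "conjugate x g = inv g \<otimes> x \<otimes> g"

lemma conjugate_closed [simp, intro]:
  "x \<in> carrier G \<Longrightarrow> g \<in> carrier G \<Longrightarrow> conjugate x g \<in> carrier G"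
  by (simp add: conjugate_def)

lemma commutator_eq_conjugate:
  "x \<in> carrier G \<Longrightarrow> g \<in> carrier G \<Longrightarrow> commutator G x g = inv x \<otimes> conjugate x g"
  by (simp add: commutator_def conjugate_def m_assoc)

lemma conjugate_eq_mult_commutator:
  "x \<in> carrier G \<Longrightarrow> g \<in> carrier G \<Longrightarrow> conjugate x g = x \<otimes> commutator G x g"
  by (simp add: commutator_def conjugate_def m_assoc)

lemma conjugate_mult:
  "x \<in> carrier G \<Longrightarrow> y \<in> carrier G \<Longrightarrow> g \<in> carrier G \<Longrightarrow>
    conjugate (x \<otimes> y) g = conjugate x g \<otimes> conjugate y g"
  by (simp add: conjugate_def m_assoc)

lemma conjugate_conjugate:
  "x \<in> carrier G \<Longrightarrow> g \<in> carrier G \<Longrightarrow> h \<in> carrier G \<Longrightarrow>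
    conjugate (conjugate x g) h = conjugate x (g \<otimes> h)"
  by (simp add: conjugate_def m_assoc inv_mult_group)

lemma conjugate_inv:
  "x \<in> carrier G \<Longrightarrow> g \<in> carrier G \<Longrightarrow> conjugate (inv x) g = inv (conjugate x g)"
  by (simp add: conjugate_def m_assoc inv_mult_group)

lemma conjugate_int_pow:
  "x \<in> carrier G \<Longrightarrow> g \<in> carrier G \<Longrightarrow> conjugate (x [^] (i::int)) g = conjugate x g [^] i"
proof -
  assume x: "x \<in> carrier G" and g: "g \<in> carrier G"
  have "(\<lambda>x. conjugate x g) \<in> hom G G"
    using g by (auto simp: hom_def conjugate_mult)
  then show ?thesis using hom_int_pow[of "\<lambda>x. conjugate x g" G G x i] x is_group by simp
qed

lemma conjugate_eq_self:
  "x \<in> carrier G \<Longrightarrow> g \<in> carrier G \<Longrightarrow> x \<otimes> g = g \<otimes> x \<Longrightarrow> conjugate x g = x"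
  by (simp add: conjugate_def m_assoc)

lemma commutator_eq_one_iff:
  assumes "x \<in> carrier G" "y \<in> carrier G"
  shows "commutator G x y = \<one> \<longleftrightarrow> x \<otimes> y = y \<otimes> x"
proof -
  have "commutator G x y = inv (y \<otimes> x) \<otimes> (x \<otimes> y)"
    using assms by (simp add: commutator_def m_assoc inv_mult_group)
  then show ?thesis
    using assms by (metis inv_equality inv_inv m_closed inv_closed l_inv)
qed

lemma inv_commutator:
  "x \<in> carrier G \<Longrightarrow> y \<in> carrier G \<Longrightarrow> inv (commutator G x y) = commutator G y x"
  by (simp add: commutator_def m_assoc inv_mult_group)

lemma commutator_mult_left:
  "x \<in> carrier G \<Longrightarrow> y \<in> carrier G \<Longrightarrow> z \<in> carrier G \<Longrightarrow>
    commutator G (x \<otimes> y) z = conjugate (commutator G x z) y \<otimes> commutator G y z"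
  by (simp add: commutator_def conjugate_def m_assoc inv_mult_group)

lemma commutator_mult_right:
  "x \<in> carrier G \<Longrightarrow> y \<in> carrier G \<Longrightarrow> z \<in> carrier G \<Longrightarrow>
    commutator G x (y \<otimes> z) = commutator G x z \<otimes> conjugate (commutator G x y) z"
  by (simp add: commutator_def conjugate_def m_assoc inv_mult_group)

lemma Hall_Witt:
  assumes "x \<in> carrier G" "y \<in> carrier G" "z \<in> carrier G"
  shows "conjugate (commutator G (commutator G x (inv y)) z) y
       \<otimes> conjugate (commutator G (commutator G y (inv z)) x) z
       \<otimes> conjugate (commutator G (commutator G z (inv x)) y) x = \<one>"
  using assms by (simp add: commutator_def conjugate_def m_assoc inv_mult_group)

lemma commutes_inv:
  assumes "x \<in> carrier G" "y \<in> carrier G" "x \<otimes> y = y \<otimes> x"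
  shows "inv x \<otimes> y = y \<otimes> inv x"
proof -
  have "inv x \<otimes> (x \<otimes> y) \<otimes> inv x = inv x \<otimes> (y \<otimes> x) \<otimes> inv x" using assms(3) by simp
  then show ?thesis using assms(1,2) by (simp add: m_assoc)
qed

lemma subgroup_centralizer:
  assumes "a \<in> carrier G"
  shows "subgroup {x \<in> carrier G. x \<otimes> a = a \<otimes> x} G"
proof (rule subgroupI)
  show "x \<otimes> y \<in> {x \<in> carrier G. x \<otimes> a = a \<otimes> x}"
    if "x \<in> {x \<in> carrier G. x \<otimes> a = a \<otimes> x}" "y \<in> {x \<in> carrier G. x \<otimes> a = a \<otimes> x}" for x y
    using that assms by (simp add: m_assoc) (simp add: m_assoc [symmetric])
qed (use assms in \<open>auto simp: commutes_inv intro!: exI[of _ \<one>]\<close>)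

text \<open>Centralizers are subgroups: each t in T centralizes all of <S>, and then the centralizer
  of x contains <T>.\<close>

lemma generate_commutes:
  assumes S: "S \<subseteq> carrier G" "T \<subseteq> carrier G"
    and comm: "\<And>s t. s \<in> S \<Longrightarrow> t \<in> T \<Longrightarrow> s \<otimes> t = t \<otimes> s"
    and x: "x \<in> generate G S" and y: "y \<in> generate G T"
  shows "x \<otimes> y = y \<otimes> x"
proof -
  have xt: "x \<otimes> t = t \<otimes> x" if "t \<in> T" for t
    using generate_subgroup_incl[OF _ subgroup_centralizer[of t], of S] that S comm x by blast
  have "x \<in> carrier G" using x S generate_in_carrier by blast
  then show ?thesis
    using generate_subgroup_incl[OF _ subgroup_centralizer[of x], of T] S xt y by force
qed

lemma center_iff:
  "z \<in> group_center G \<longleftrightarrow> z \<in> carrier G \<and> (\<forall>g\<in>carrier G. commutator G z g = \<one>)"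
  by (auto simp: group_center_def commutator_eq_one_iff)

lemma subgroup_center: "subgroup (group_center G) G"
proof (rule subgroupI)
  show "group_center G \<noteq> {}" by (auto simp: group_center_def intro!: exI[of _ \<one>])
  show "inv a \<in> group_center G" if "a \<in> group_center G" for a
    using that unfolding group_center_def by (auto simp: commutes_inv)
  show "a \<otimes> b \<in> group_center G" if "a \<in> group_center G" "b \<in> group_center G" for a b
  proof -
    have ab: "a \<in> carrier G" "b \<in> carrier G" using that by (auto simp: group_center_def)
    have "a \<otimes> b \<otimes> g = g \<otimes> (a \<otimes> b)" if g: "g \<in> carrier G" for g
    proof -
      have "b \<otimes> g = g \<otimes> b" "a \<otimes> g = g \<otimes> a"
        using \<open>a \<in> group_center G\<close> \<open>b \<in> group_center G\<close> g by (auto simp: group_center_def)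
      then show ?thesis using ab g by (metis m_assoc)
    qed
    then show ?thesis using ab by (simp add: group_center_def)
  qed
qed (auto simp: group_center_def)

end

section \<open>Commuting conjugates in a 2-Engel group\<close>

locale two_engel_group = group G for G (structure) +
  assumes two_Engel: "two_Engel G"
begin

lemma engel: "x \<in> carrier G \<Longrightarrow> y \<in> carrier G \<Longrightarrow> commutator G (commutator G x y) y = \<one>"
  using two_Engel by (auto simp: two_Engel_def)

lemma commutator_commutes_right:
  "x \<in> carrier G \<Longrightarrow> y \<in> carrier G \<Longrightarrow> commutator G x y \<otimes> y = y \<otimes> commutator G x y"
  using engel commutator_eq_one_iff by auto

lemma commutator_commutes_left:
  assumes "x \<in> carrier G" "y \<in> carrier G"
  shows "commutator G x y \<otimes> x = x \<otimes> commutator G x y"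
proof -
  have "commutator G y x \<otimes> x = x \<otimes> commutator G y x"
    using assms by (simp add: commutator_commutes_right)
  then have "inv (commutator G y x) \<otimes> x = x \<otimes> inv (commutator G y x)"
    using assms by (simp add: commutes_inv)
  then show ?thesis using assms by (simp add: inv_commutator)
qed

text \<open>The conjugate is x [x,g], and the Engel law makes [x,g] commute with x.\<close>

lemma conjugate_commutes_self:
  assumes "x \<in> carrier G" "g \<in> carrier G"
  shows "conjugate x g \<otimes> x = x \<otimes> conjugate x g"
  using assms commutator_commutes_left[of x g]
  by (simp add: conjugate_eq_mult_commutator m_assoc)

text \<open>Conjugation by h turns the pair x^(g h^-1), x into x^g, x^h. Thus the normal closure of
  x is abelian, and conjugations act on it as endomorphisms that can be added.\<close>

lemma conjugates_commute:
  assumes "x \<in> carrier G" "g \<in> carrier G" "h \<in> carrier G"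
  shows "conjugate x g \<otimes> conjugate x h = conjugate x h \<otimes> conjugate x g"
proof -
  have "conjugate (conjugate x (g \<otimes> inv h) \<otimes> x) h = conjugate (x \<otimes> conjugate x (g \<otimes> inv h)) h"
    using assms by (simp add: conjugate_commutes_self)
  then show ?thesis
    using assms by (simp add: conjugate_mult conjugate_conjugate m_assoc)
qed

text \<open>The action of \<open>g\<close> on the abelian normal closure of \<open>x\<close> satisfies \<open>(g - 1)\<^sup>2 = 0\<close>,
  that is \<open>g + g\<^sup>-\<^sup>1 = 2\<close>.\<close>

lemma conjugate_mult_conjugate_inv:
  assumes x: "x \<in> carrier G" and g: "g \<in> carrier G"
  shows "conjugate x g \<otimes> conjugate x (inv g) = x \<otimes> x"
proof -
  let ?c = "commutator G x g"
  have "conjugate ?c (inv g) = ?c"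
  proof -
    have "conjugate ?c (inv g) = ?c \<otimes> g \<otimes> inv g"
      using x g by (simp add: conjugate_def commutator_commutes_right)
    then show ?thesis using x g by (simp add: m_assoc)
  qed
  moreover have "conjugate (x \<otimes> ?c) (inv g) = x"
    using x g by (simp add: conjugate_eq_mult_commutator [symmetric] conjugate_conjugate)
      (simp add: conjugate_def)
  ultimately have "conjugate x (inv g) \<otimes> ?c = x"
    using x g by (simp add: conjugate_mult)
  then have conj_inv: "conjugate x (inv g) = x \<otimes> inv ?c"
    using x g by (simp add: inv_solve_right)
  show ?thesis
  proof -
    have "x \<otimes> ?c \<otimes> (x \<otimes> inv ?c) = x \<otimes> (?c \<otimes> x) \<otimes> inv ?c"
      using x g by (simp add: m_assoc)
    also have "\<dots> = x \<otimes> x"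
      using x g by (simp add: commutator_commutes_left m_assoc)
    finally show ?thesis
      using x g conj_inv
      by (simp only: conjugate_eq_mult_commutator[OF x g])
  qed
qed

end

text \<open>The abelian computation behind \<open>triple_swap_23\<close>. There Y1, Y2, Z1 are the
  conjugates of x by y, y^-1, z, and e1, e2, e3, e4 those by yz, (yz)^-1, z y^-1, zy. Each
  hypothesis is an instance of g + g^-1 = 2; multiplying by e3 e2 and cancelling Y2^2 eliminates all
  inverses.\<close>

lemma (in comm_group) polarised_square_cancel:
  assumes c: "x \<in> carrier G" "Y1 \<in> carrier G" "Y2 \<in> carrier G" "Z1 \<in> carrier G"
    "e1 \<in> carrier G" "e2 \<in> carrier G" "e3 \<in> carrier G" "e4 \<in> carrier G"
    and h: "e1 \<otimes> e2 = x \<otimes> x" "e3 \<otimes> e2 = Y2 \<otimes> Y2" "e4 \<otimes> e3 = Z1 \<otimes> Z1" "Y1 \<otimes> Y2 = x \<otimes> x"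
  shows "x \<otimes> x \<otimes> e1 \<otimes> e4 = Y1 \<otimes> Y1 \<otimes> Z1 \<otimes> Z1"
proof -
  have "x \<otimes> x \<otimes> e1 \<otimes> e4 \<otimes> (e3 \<otimes> e2) = (x \<otimes> x) \<otimes> (e1 \<otimes> e2) \<otimes> (e4 \<otimes> e3)"
    using c by (simp add: m_ac)
  also have "\<dots> = (Y1 \<otimes> Y2) \<otimes> (Y1 \<otimes> Y2) \<otimes> (Z1 \<otimes> Z1)"
    using h by simp
  also have "\<dots> = Y1 \<otimes> Y1 \<otimes> Z1 \<otimes> Z1 \<otimes> (Y2 \<otimes> Y2)"
    using c by (simp add: m_ac)
  finally show ?thesis
    using c h(2) by (metis m_closed r_cancel)
qed

section \<open>The alternating triple commutator and the bound on the class\<close>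

context two_engel_group begin

definition conj_closure :: "'a \<Rightarrow> 'a set" where
  "conj_closure x = generate G {conjugate x g | g. g \<in> carrier G}"

lemma conj_closure_group:
  assumes x: "x \<in> carrier G"
  shows "subgroup (conj_closure x) G" "comm_group (G\<lparr>carrier := conj_closure x\<rparr>)"
    "g \<in> carrier G \<Longrightarrow> conjugate x g \<in> conj_closure x" "x \<in> conj_closure x"
proof -
  let ?S = "{conjugate x g | g. g \<in> carrier G}"
  have S: "?S \<subseteq> carrier G" using x by auto
  show *: "subgroup (conj_closure x) G"
    unfolding conj_closure_def using S by (rule generate_is_subgroup)
  have "u \<otimes> v = v \<otimes> u" if "u \<in> conj_closure x" "v \<in> conj_closure x" for u v
    using generate_commutes[OF S S _ that[unfolded conj_closure_def]] x conjugates_commute by blast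
  then show "comm_group (G\<lparr>carrier := conj_closure x\<rparr>)"
    using subgroup_imp_group[OF *] by (intro group.group_comm_groupI) auto
  show **: "g \<in> carrier G \<Longrightarrow> conjugate x g \<in> conj_closure x" for g
    unfolding conj_closure_def by (rule generate.incl) auto
  have "conjugate x \<one> = x" using x by (simp add: conjugate_def)
  then show "x \<in> conj_closure x" using **[of \<one>] by simp
qed

lemma commutator_inv_left:
  assumes "x \<in> carrier G" "y \<in> carrier G"
  shows "commutator G (inv x) y = inv (commutator G x y)"
proof -
  have "conjugate x y \<otimes> inv x = inv x \<otimes> conjugate x y"
    using assms by (simp add: commutes_inv conjugate_commutes_self)
  then have "inv (conjugate x y \<otimes> inv x) = inv (inv x \<otimes> conjugate x y)" by simp
  then show ?thesis
    using assms by (simp add: commutator_eq_conjugate conjugate_inv inv_mult_group)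
qed

lemma commutator_inv_right:
  assumes "x \<in> carrier G" "y \<in> carrier G"
  shows "commutator G x (inv y) = inv (commutator G x y)"
  using assms by (metis commutator_inv_left inv_commutator inv_closed)

text \<open>Conjugation by y sends x to x [x,y], a product of two commuting factors, so the i-th
  power splits.\<close>

lemma commutator_int_pow_left:
  assumes x: "x \<in> carrier G" and y: "y \<in> carrier G"
  shows "commutator G (x [^] (i::int)) y = commutator G x y [^] i"
proof -
  have "conjugate (x [^] i) y = (x \<otimes> commutator G x y) [^] i"
    using x y by (simp add: conjugate_int_pow conjugate_eq_mult_commutator [symmetric])
  also have "\<dots> = x [^] i \<otimes> commutator G x y [^] i"
    using x y commutator_commutes_left[OF x y] by (simp add: int_pow_mult_distrib)
  finally show ?thesis using x y by (simp add: commutator_eq_conjugate)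
qed

lemma commutator_int_pow_right:
  assumes x: "x \<in> carrier G" and y: "y \<in> carrier G"
  shows "commutator G x (y [^] (i::int)) = commutator G x y [^] i"
  using assms by (metis commutator_int_pow_left inv_commutator int_pow_inv int_pow_closed commutator_closed)

lemma triple_swap_12:
  assumes "x \<in> carrier G" "y \<in> carrier G" "z \<in> carrier G"
  shows "commutator G (commutator G y x) z = inv (commutator G (commutator G x y) z)"
  using assms by (metis commutator_inv_left inv_commutator commutator_closed)

text \<open>In the endomorphism ring of the normal closure, \<open>g + g\<^sup>-\<^sup>1 = 2\<close> for \<open>g = y, z, yz\<close> gives
  \<open>yz + zy + 2 = 2y + 2z\<close>, that is, \<open>y - 1\<close> and \<open>z - 1\<close> anticommute.\<close>

lemma triple_swap_23:
  assumes x: "x \<in> carrier G" and y: "y \<in> carrier G" and z: "z \<in> carrier G"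
  shows "commutator G (commutator G x z) y = inv (commutator G (commutator G x y) z)"
proof -
  let ?A = "G\<lparr>carrier := conj_closure x\<rparr>"
  let ?e1 = "conjugate x (y \<otimes> z)" and ?e2 = "conjugate x (inv z \<otimes> inv y)"
    and ?e3 = "conjugate x (z \<otimes> inv y)" and ?e4 = "conjugate x (z \<otimes> y)"
    and ?Y1 = "conjugate x y" and ?Y2 = "conjugate x (inv y)" and ?Z1 = "conjugate x z"
  note cl = conj_closure_group[OF x]
  interpret A: comm_group ?A by (rule cl(2))
  have h1: "?e1 \<otimes> ?e2 = x \<otimes> x"
    using conjugate_mult_conjugate_inv[OF x, of "y \<otimes> z"] y z by (simp add: inv_mult_group)
  have "conjugate (conjugate x z \<otimes> conjugate x (inv z)) (inv y) = conjugate (x \<otimes> x) (inv y)"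
    using conjugate_mult_conjugate_inv[OF x z] by simp
  then have h2: "?e3 \<otimes> ?e2 = ?Y2 \<otimes> ?Y2"
    using x y z by (simp add: conjugate_mult conjugate_conjugate)
  have h3: "?e4 \<otimes> ?e3 = ?Z1 \<otimes> ?Z1"
    using conjugate_mult_conjugate_inv[of "conjugate x z" y] x y z by (simp add: conjugate_conjugate)
  have h4: "?Y1 \<otimes> ?Y2 = x \<otimes> x" by (rule conjugate_mult_conjugate_inv[OF x y])
  have mem: "x \<in> conj_closure x" "?Y1 \<in> conj_closure x" "?Z1 \<in> conj_closure x"
      "?e1 \<in> conj_closure x" "?e4 \<in> conj_closure x" "?e2 \<in> conj_closure x" "?e3 \<in> conj_closure x"
      "?Y2 \<in> conj_closure x"
    using x y z cl by auto
  have main: "x \<otimes> x \<otimes> ?e1 \<otimes> ?e4 = ?Y1 \<otimes> ?Y1 \<otimes> ?Z1 \<otimes> ?Z1"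
    using A.polarised_square_cancel[of x ?Y1 ?Y2 ?Z1 ?e1 ?e2 ?e3 ?e4] mem h1 h2 h3 h4 by simp
  have comm: "u \<otimes> v = v \<otimes> u" if "u \<in> conj_closure x" "v \<in> conj_closure x" for u v
    using A.m_comm[of u v] that by simp
  \<comment> \<open>Written additively, [[x,y],z] is x (y - 1)(z - 1), so both triple commutators
    expand into the terms that \<open>main\<close> relates.\<close>
  have c: "commutator G (commutator G x y) z = inv ?Y1 \<otimes> x \<otimes> (inv ?Z1 \<otimes> ?e1)"
    "commutator G (commutator G x z) y = inv ?Z1 \<otimes> x \<otimes> (inv ?Y1 \<otimes> ?e4)"
    using x y z
    by (simp_all add: commutator_eq_conjugate conjugate_mult conjugate_inv conjugate_conjugate inv_mult_group m_assoc)
  have inv_mem: "inv u \<in> conj_closure x" if "u \<in> conj_closure x" for u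
    using cl(1) that by (rule subgroup.m_inv_closed)
  have lcomm: "u \<otimes> (v \<otimes> w) = v \<otimes> (u \<otimes> w)"
    if "u \<in> conj_closure x" "v \<in> conj_closure x" "w \<in> conj_closure x" for u v w
    using A.m_lcomm[of u v w] that by simp
  have mult_mem: "u \<otimes> v \<in> conj_closure x" if "u \<in> conj_closure x" "v \<in> conj_closure x" for u v
    using cl(1) that by (rule subgroup.m_closed)
  have assoc: "u \<otimes> v \<otimes> w = u \<otimes> (v \<otimes> w)"
    if "u \<in> conj_closure x" "v \<in> conj_closure x" "w \<in> conj_closure x" for u v w
    using A.m_assoc[of u v w] that by simp
  have "commutator G (commutator G x z) y \<otimes> commutator G (commutator G x y) z
      = inv ?Y1 \<otimes> inv ?Y1 \<otimes> inv ?Z1 \<otimes> inv ?Z1 \<otimes> (x \<otimes> x \<otimes> ?e1 \<otimes> ?e4)"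
    unfolding c using mem by (simp add: inv_mem mult_mem assoc comm lcomm)
  also have "\<dots> = \<one>"
    unfolding main using mem x y z by (simp add: inv_mem mult_mem assoc comm lcomm)
  finally show ?thesis
    using x y z by (simp add: inv_equality)
qed

text \<open>A cyclic shift is a product of two transpositions, so the two inversions cancel.\<close>

lemma triple_rotate:
  assumes "x \<in> carrier G" "y \<in> carrier G" "z \<in> carrier G"
  shows "commutator G (commutator G y z) x = commutator G (commutator G x y) z"
  using assms triple_swap_12[of x y z] triple_swap_23[of y x z] by simp

text \<open>In the Hall-Witt identity for x, y, z the three factors are rotations of one another, so
  each of them equals t^-1, where t = [[x,y],z].\<close>

lemma triple_cube:
  assumes "x \<in> carrier G" "y \<in> carrier G" "z \<in> carrier G"
  shows "commutator G (commutator G x y) z \<otimes> commutator G (commutator G x y) z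
    \<otimes> commutator G (commutator G x y) z = \<one>"
proof -
  let ?t = "commutator G (commutator G x y) z"
  have rot: "commutator G (commutator G y z) x = ?t" "commutator G (commutator G z x) y = ?t"
    using assms triple_rotate[of x y z] triple_rotate[of y z x] by simp_all
  \<comment> \<open>Each rotation of t has a different element in last place, and a commutator
    commutes with its last entry.\<close>
  have fix_: "conjugate ?t x = ?t" "conjugate ?t y = ?t" "conjugate ?t z = ?t"
    using assms commutator_commutes_right rot
    by (metis conjugate_eq_self commutator_closed)+
  have neg: "commutator G (commutator G x (inv y)) z = inv ?t"
    "commutator G (commutator G y (inv z)) x = inv ?t"
    "commutator G (commutator G z (inv x)) y = inv ?t"
    using assms rot by (simp_all add: commutator_inv_right commutator_inv_left)
  have "inv ?t \<otimes> inv ?t \<otimes> inv ?t = \<one>"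
    using Hall_Witt[OF assms] assms unfolding neg by (simp add: conjugate_inv fix_)
  then have "inv (inv ?t \<otimes> inv ?t \<otimes> inv ?t) = inv \<one>" by (rule arg_cong)
  then show ?thesis using assms by (simp add: inv_mult_group m_assoc)
qed

text \<open>A four-fold commutator is alternating, and reading \<open>[[x,y],[z,w]]\<close> as a triple commutator
  in two ways shows that it is its own inverse; as a triple commutator its cube is trivial.\<close>

theorem class_le_3:
  assumes "x \<in> carrier G" "y \<in> carrier G" "z \<in> carrier G" "w \<in> carrier G"
  shows "commutator G (commutator G (commutator G x y) z) w = \<one>"
proof -
  let ?C = "commutator G"
  let ?f = "\<lambda>x y z w. ?C (?C (?C x y) z) w"
  have s12: "?f y x z w = inv (?f x y z w)"
    if "x \<in> carrier G" "y \<in> carrier G" "z \<in> carrier G" "w \<in> carrier G" for x y z w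
    using that triple_swap_12[of x y z] by (simp add: commutator_inv_left)
  have s23: "?f x z y w = inv (?f x y z w)"
    if "x \<in> carrier G" "y \<in> carrier G" "z \<in> carrier G" "w \<in> carrier G" for x y z w
    using that triple_swap_23[of x y z] by (simp add: commutator_inv_left)
  have s34: "?f x y w z = inv (?f x y z w)"
    if "x \<in> carrier G" "y \<in> carrier G" "z \<in> carrier G" "w \<in> carrier G" for x y z w
    using that triple_swap_23[of "?C x y" z w] by simp
  let ?t = "?f x y z w"
  \<comment> \<open>The passage from x, y, z, w to z, w, x, y takes four adjacent transpositions, so
    the signs cancel.\<close>
  have "?f z w x y = ?t"
  proof -
    have "?f x z y w = inv ?t" using assms s23 by blast
    then have "?f z x y w = ?t" using assms s12[of x z y w] by simp
    then have "?f z x w y = inv ?t" using assms s34[of z x y w] by simp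
    then show ?thesis using assms s23[of z x w y] by simp
  qed
  moreover have "?C (?C z w) (?C x y) = ?t"
    using assms triple_rotate[of "?C x y" z w] by simp
  moreover have "?C (?C x y) (?C z w) = ?f z w x y"
    using assms triple_rotate[of "?C z w" x y] by simp
  moreover have "?C (?C z w) (?C x y) = inv (?C (?C x y) (?C z w))"
    using assms inv_commutator[of "?C x y" "?C z w"] by simp
  ultimately have "?t = inv ?t" by simp
  then have "?t \<otimes> ?t = \<one>" using assms r_inv[of ?t] by simp
  then show ?thesis using triple_cube[of "?C x y" z w] assms by simp
qed

lemma triple_center:
  assumes "x \<in> carrier G" "y \<in> carrier G" "z \<in> carrier G"
  shows "commutator G (commutator G x y) z \<in> group_center G"
  using assms class_le_3 by (auto simp: center_iff)

lemma conjugate_center: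
  "t \<in> group_center G \<Longrightarrow> g \<in> carrier G \<Longrightarrow> conjugate t g = t"
  by (rule conjugate_eq_self) (auto simp: group_center_def)

text \<open>The product [u,v][u',v] differs from [uu',v] by the factor [[u,v],u']. In class three
  this factor is central, so it disappears in the outer commutator.\<close>

lemma triple_mult_left:
  assumes "u \<in> carrier G" "u' \<in> carrier G" "v \<in> carrier G" "z \<in> carrier G"
  shows "commutator G (commutator G (u \<otimes> u') v) z
    = commutator G (commutator G u v) z \<otimes> commutator G (commutator G u' v) z"
proof -
  let ?g = "commutator G u v" and ?h = "commutator G u' v"
  let ?s = "commutator G ?g u'"
  have s: "?s \<in> group_center G" "commutator G ?g z \<in> group_center G"
    using assms triple_center by auto
  have "commutator G (?g \<otimes> ?s) z = commutator G ?g z"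
  proof -
    have "commutator G ?s z = \<one>" using s(1) assms by (simp add: center_iff)
    then show ?thesis using assms s by (simp add: commutator_mult_left conjugate_center)
  qed
  moreover have "commutator G (u \<otimes> u') v = ?g \<otimes> ?s \<otimes> ?h"
    using assms by (simp add: commutator_mult_left conjugate_eq_mult_commutator)
  ultimately show ?thesis
    using assms s commutator_mult_left[of "?g \<otimes> ?s" ?h z] by (simp add: conjugate_center)
qed

text \<open>Let \<open>w = [[a,b],c]\<close>. Since \<open>[x,y]\<^sup>n = [x\<^sup>n,y]\<close> is a power of \<open>w\<close>, some \<open>x = b\<^sup>-\<^sup>\<beta> c\<^sup>\<alpha>\<close> satisfies
  \<open>[a,x]\<^sup>n = 1\<close>, so \<open>[a,x]\<close> is central. This forces \<open>w\<^sup>\<alpha> = [a,b]\<^sup>n = 1\<close>, hence \<open>[a,b]\<close> is central.\<close>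

theorem three_generated_class_le_2:
  assumes gen: "generate G {a, b, c} = carrier G"
    and abc: "a \<in> carrier G" "b \<in> carrier G" "c \<in> carrier G"
    and pow_derived: "\<And>x. x \<in> carrier G \<Longrightarrow> x [^] (n::nat) \<in> derived G (carrier G)"
    and torsion_central: "\<And>x. x \<in> carrier G \<Longrightarrow> x [^] n = \<one> \<Longrightarrow> x \<in> group_center G"
    and xy: "x \<in> carrier G" "y \<in> carrier G"
  shows "commutator G x y \<in> group_center G"
proof -
  let ?C = "commutator G"
  define w where "w = ?C (?C a b) c"
  \<comment> \<open>An alternating trilinear function of three generators takes all its values in
    the group generated by its value w at (a, b, c).\<close>
  define W where "W = generate G {w}"
  have wc: "w \<in> carrier G" using abc by (simp add: w_def)
  have W: "subgroup W G" unfolding W_def using wc by (intro generate_is_subgroup) auto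
  have "w \<in> group_center G" using abc triple_center by (simp add: w_def)
  then have WZ: "W \<subseteq> group_center G"
    unfolding W_def by (intro generate_subgroup_incl subgroup_center) auto
  have w: "w \<in> W" unfolding W_def by (rule generate.incl) simp
  note Wcl = subgroup.m_closed[OF W] subgroup.m_inv_closed[OF W] subgroup.one_closed[OF W]
  \<comment> \<open>Triple commutators are additive in the first entry, so membership in W need only
    be tested on generators there.\<close>
  have extend: "?C (?C u v) z \<in> W"
    if vz: "v \<in> carrier G" "z \<in> carrier G" and g: "\<And>g. g \<in> {a, b, c} \<Longrightarrow> ?C (?C g v) z \<in> W"
      and u: "u \<in> carrier G" for u v z
  proof -
    let ?H = "{u \<in> carrier G. ?C (?C u v) z \<in> W}"
    have "subgroup ?H G"
    proof (rule subgroupI)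
      show "?H \<noteq> {}" using g abc by blast
    qed (use vz in \<open>auto simp: triple_mult_left commutator_inv_left Wcl\<close>)
    then have "generate G {a, b, c} \<subseteq> ?H"
      by (rule generate_subgroup_incl [rotated]) (use abc g in auto)
    then show ?thesis using u gen by blast
  qed
  have base: "?C (?C g h) k \<in> W" if ghk: "g \<in> {a, b, c}" "h \<in> {a, b, c}" "k \<in> {a, b, c}" for g h k
  proof -
    have car: "g \<in> carrier G" "h \<in> carrier G" "k \<in> carrier G" using ghk abc by auto
    have *: "?C (?C g h) k = \<one>" if "g = h \<or> h = k \<or> g = k"
    proof -
      have "?C g g = \<one>" using car commutator_eq_one_iff by simp
      moreover have "?C \<one> k = \<one>" using car by (simp add: commutator_eq_one_iff)
      moreover have "?C (?C g h) g = \<one>"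
        using car triple_swap_12[of h g g] engel[of h g] by simp
      ultimately show ?thesis using that engel car by auto
    qed
    have "?C (?C b c) a = w" "?C (?C c a) b = w"
      using triple_rotate[of a b c] triple_rotate[of b c a] abc by (simp_all add: w_def)
    moreover have "?C (?C b a) c = inv w" "?C (?C c b) a = inv w" "?C (?C a c) b = inv w"
      using triple_swap_12[of a b c] triple_swap_12[of b c a] triple_swap_12[of c a b] abc calculation
      by (simp_all add: w_def)
    ultimately have "g = h \<or> h = k \<or> g = k \<or> ?C (?C g h) k = w \<or> ?C (?C g h) k = inv w"
      using ghk by (auto simp: w_def)
    then show ?thesis using * Wcl w by metis
  qed
  have step1: "?C (?C u h) k \<in> W" if "u \<in> carrier G" "h \<in> {a, b, c}" "k \<in> {a, b, c}" for u h k
    using that abc base by (intro extend[of h k u]) auto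
  have step2: "?C (?C u v) k \<in> W" if "u \<in> carrier G" "v \<in> carrier G" "k \<in> {a, b, c}" for u v k
  proof (rule extend)
    show "?C (?C g v) k \<in> W" if g: "g \<in> {a, b, c}" for g
    proof -
      have "?C (?C g v) k = inv (?C (?C v g) k)"
        using triple_swap_12[of v g k] that \<open>v \<in> carrier G\<close> \<open>k \<in> {a, b, c}\<close> abc by auto
      then show ?thesis using step1[of v g k] \<open>v \<in> carrier G\<close> \<open>k \<in> {a, b, c}\<close> g Wcl by auto
    qed
  qed (use that abc in auto)
  \<comment> \<open>A rotation brings the last entry to the front, where the test on generators
    applies again.\<close>
  have all: "?C (?C u v) z \<in> W" if "u \<in> carrier G" "v \<in> carrier G" "z \<in> carrier G" for u v z
  proof -
    have "?C (?C z u) v \<in> W"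
    proof (rule extend)
      show "?C (?C g u) v \<in> W" if "g \<in> {a, b, c}" for g
        using triple_rotate[of g u v] step2[of u v g] \<open>u \<in> carrier G\<close> \<open>v \<in> carrier G\<close> that abc by auto
    qed (use that in auto)
    then show ?thesis using triple_rotate[of z u v] that by simp
  qed
  have derived_W: "?C g y \<in> W" if g: "g \<in> derived G (carrier G)" and y: "y \<in> carrier G" for g y
  proof -
    let ?H = "{g \<in> carrier G. ?C g y \<in> W}"
    have conj: "conjugate t h = t" if "t \<in> W" "h \<in> carrier G" for t h
      using that WZ conjugate_center by auto
    have "subgroup ?H G"
    proof (rule subgroupI)
      have "?C \<one> y = \<one>" using y by (simp add: commutator_eq_one_iff)
      then show "?H \<noteq> {}" using Wcl by (auto intro!: exI[of _ \<one>])
    qed (use y in \<open>auto simp: commutator_mult_left commutator_inv_left Wcl conj\<close>)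
    moreover have "h \<otimes> k \<otimes> inv h \<otimes> inv k \<in> ?H" if "h \<in> carrier G" "k \<in> carrier G" for h k
    proof -
      have "h \<otimes> k \<otimes> inv h \<otimes> inv k = ?C (inv h) (inv k)" using that by (simp add: commutator_def)
      then show ?thesis using all[of "inv h" "inv k" y] that y by simp
    qed
    ultimately have "derived G (carrier G) \<subseteq> ?H"
      unfolding derived_def by (intro generate_subgroup_incl) auto
    then show ?thesis using g by blast
  qed
  have pow: "?C x y [^] int n = ?C (x [^] n) y" "?C x y [^] int n \<in> W"
    if "x \<in> carrier G" "y \<in> carrier G" for x y
  proof -
    show "?C x y [^] int n = ?C (x [^] n) y"
      using that commutator_int_pow_left[of x y "int n"] by (simp add: int_pow_int)
    then show "?C x y [^] int n \<in> W" using derived_W pow_derived that by simp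
  qed
  obtain \<alpha> \<beta> :: int where ab: "?C a b [^] int n = w [^] \<alpha>" "?C a c [^] int n = w [^] \<beta>"
    using pow(2)[of a b] pow(2)[of a c] abc generate_pow[OF wc] unfolding W_def by auto
  let ?u = "b [^] (-\<beta>)" and ?v = "c [^] \<alpha>"
  let ?x = "?u \<otimes> ?v" and ?A = "a [^] n"
  have uv: "?u \<in> carrier G" "?v \<in> carrier G" using abc by auto
  have "?C a ?x [^] int n = ?C ?A ?x" using pow(1) abc by simp
  also have "\<dots> = ?C ?A ?v \<otimes> ?C ?A ?u"
  proof -
    have "?C ?A ?u \<in> group_center G"
      using derived_W[of ?A ?u] pow_derived[of a] abc WZ by auto
    then show ?thesis using abc by (simp add: commutator_mult_right conjugate_center)
  qed
  also have "\<dots> = ?C ?A c [^] \<alpha> \<otimes> ?C ?A b [^] (-\<beta>)"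
    using abc commutator_int_pow_right by simp
  also have "\<dots> = (w [^] \<beta>) [^] \<alpha> \<otimes> (w [^] \<alpha>) [^] (-\<beta>)"
    using pow(1)[of a b] pow(1)[of a c] abc ab by simp
  also have "\<dots> = \<one>"
    using wc by (simp add: int_pow_pow int_pow_mult [symmetric] mult.commute)
  finally have "?C a ?x [^] n = \<one>" by (simp add: int_pow_int)
  then have "?C a ?x \<in> group_center G" using torsion_central abc by simp
  then have "?C (?C a ?x) b = \<one>" using abc by (simp add: center_iff)
  then have "?C (?C ?x a) b = \<one>" using triple_swap_12[of a ?x b] abc by simp
  \<comment> \<open>Of the two factors of x only the power of c contributes, because [[b,a],b] = 1
    and [[c,a],b] = w.\<close>
  moreover have "?C (?C ?x a) b = ?C (?C b a) b [^] (-\<beta>) \<otimes> ?C (?C c a) b [^] \<alpha>"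
    using abc by (simp add: triple_mult_left commutator_int_pow_left)
  moreover have "?C (?C b a) b = \<one>" using triple_swap_12[of a b b] engel[of a b] abc by simp
  moreover have "?C (?C c a) b = w"
    using triple_rotate[of a b c] triple_rotate[of b c a] abc by (simp add: w_def)
  ultimately have "w [^] \<alpha> = \<one>" using wc by simp
  then have "?C a b [^] n = \<one>" using ab by (simp add: int_pow_int)
  then have "?C a b \<in> group_center G" using torsion_central abc by simp
  then have "w = \<one>" using abc by (simp add: w_def center_iff)
  then have "W = {\<one>}" by (simp add: W_def generate_one)
  then show ?thesis using all xy by (auto simp: center_iff)
qed

end

section \<open>Groups of class two\<close>

locale class2_group = group G for G (structure) +
  assumes commutator_center:
    "x \<in> carrier G \<Longrightarrow> y \<in> carrier G \<Longrightarrow> commutator G x y \<in> group_center G"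

sublocale class2_group \<subseteq> two_engel_group
proof
  show "two_Engel G" using commutator_center by (auto simp: two_Engel_def center_iff)
qed

context class2_group begin

lemma center_commutes:
  "z \<in> group_center G \<Longrightarrow> g \<in> carrier G \<Longrightarrow> z \<otimes> g = g \<otimes> z"
  by (simp add: group_center_def)

lemma commutator_bilinear_left:
  "x \<in> carrier G \<Longrightarrow> y \<in> carrier G \<Longrightarrow> z \<in> carrier G \<Longrightarrow>
    commutator G (x \<otimes> y) z = commutator G x z \<otimes> commutator G y z"
  by (simp add: commutator_mult_left conjugate_center commutator_center)

lemma commutator_bilinear_right:
  "x \<in> carrier G \<Longrightarrow> y \<in> carrier G \<Longrightarrow> z \<in> carrier G \<Longrightarrow>
    commutator G x (y \<otimes> z) = commutator G x y \<otimes> commutator G x z"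
  using center_commutes[OF commutator_center, of x z "commutator G x y"]
  by (simp add: commutator_mult_right conjugate_center commutator_center)

lemma center_closed [simp]: "z \<in> group_center G \<Longrightarrow> z \<in> carrier G"
  by (simp add: group_center_def)

lemma mult_swap:
  "x \<in> carrier G \<Longrightarrow> y \<in> carrier G \<Longrightarrow> x \<otimes> y = y \<otimes> x \<otimes> commutator G x y"
  by (simp add: commutator_def m_assoc)

lemma derived_subset_center: "derived G (carrier G) \<subseteq> group_center G"
  unfolding derived_def
proof (rule generate_subgroup_incl[OF _ subgroup_center], clarsimp)
  fix h k assume "h \<in> carrier G" "k \<in> carrier G"
  then show "h \<otimes> k \<otimes> inv h \<otimes> inv k \<in> group_center G"
    using commutator_center[of "inv h" "inv k"] by (simp add: commutator_def)
qed

lemma commutator_in_derived: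
  assumes "x \<in> carrier G" "y \<in> carrier G"
  shows "commutator G x y \<in> derived G (carrier G)"
proof -
  have "commutator G x y = inv x \<otimes> inv y \<otimes> inv (inv x) \<otimes> inv (inv y)"
    using assms by (simp add: commutator_def)
  then show ?thesis
    unfolding derived_def using assms
    by (intro generate.incl UN_I[of "inv x"] UN_I[of "inv y"]) simp_all
qed

text \<open>Moving x to the left past y^k costs [y,x]^k, and 0 + 1 + ... + (n-1) is n choose
  2.\<close>

lemma pow_mult_class2:
  assumes x: "x \<in> carrier G" and y: "y \<in> carrier G"
  shows "(x \<otimes> y) [^] (n::nat) = x [^] n \<otimes> y [^] n \<otimes> commutator G y x [^] (n choose 2)"
proof (induction n)
  case (Suc n)
  let ?c = "commutator G y x"
  have c: "?c \<in> group_center G" using x y commutator_center by simp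
  have cp: "?c [^] k \<in> group_center G" for k :: nat
    by (induction k) (use c subgroup.m_closed[OF subgroup_center] subgroup.one_closed[OF subgroup_center] in auto)
  have "commutator G (y [^] n) x = ?c [^] n"
    using commutator_int_pow_left[OF y x, of "int n"] by (simp add: int_pow_int)
  then have sw: "y [^] n \<otimes> x = x \<otimes> y [^] n \<otimes> ?c [^] n"
    using mult_swap[of "y [^] n" x] x y by simp
  have "(x \<otimes> y) [^] Suc n = x [^] n \<otimes> y [^] n \<otimes> ?c [^] (n choose 2) \<otimes> (x \<otimes> y)"
    by (simp add: Suc)
  also have "\<dots> = x [^] n \<otimes> y [^] n \<otimes> (?c [^] (n choose 2) \<otimes> (x \<otimes> y))"
    using x y by (simp add: m_assoc)
  also have "\<dots> = x [^] n \<otimes> (y [^] n \<otimes> x) \<otimes> y \<otimes> ?c [^] (n choose 2)"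
    using x y center_commutes[OF cp, of "x \<otimes> y"] by (simp add: m_assoc)
  also have "\<dots> = x [^] Suc n \<otimes> (y [^] n \<otimes> (?c [^] n \<otimes> y)) \<otimes> ?c [^] (n choose 2)"
    unfolding sw using x y by (simp add: m_assoc)
  also have "\<dots> = x [^] Suc n \<otimes> y [^] Suc n \<otimes> (?c [^] n \<otimes> ?c [^] (n choose 2))"
    using x y center_commutes[OF cp, of y n] by (simp add: m_assoc)
  also have "?c [^] n \<otimes> ?c [^] (n choose 2) = ?c [^] (Suc n choose 2)"
    using x y by (simp add: nat_pow_mult numeral_2_eq_2)
  finally show ?case .
qed (use x y in \<open>simp add: numeral_2_eq_2\<close>)

text \<open>For \<open>p = 2\<close> the correction term \<open>[y,x]\<^bsup>q(q-1)/2\<^esup>\<close> vanishes only if the exponent of the derived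
  subgroup properly divides \<open>q = 2\<^sup>r\<close>.\<close>

lemma prime_power_mult_distrib:
  assumes p: "Factorial_Ring.prime (p::nat)" and tr: "t \<le> r" "p = 2 \<Longrightarrow> t < r"
    and c: "commutator G y x [^] (p ^ t) = \<one>"
    and x: "x \<in> carrier G" and y: "y \<in> carrier G"
  shows "(x \<otimes> y) [^] (p ^ r) = x [^] (p ^ r) \<otimes> y [^] (p ^ r)"
proof -
  have "p ^ t dvd (p ^ r choose 2)"
  proof (cases "p = 2")
    case True
    then obtain k where r: "r = Suc k" "t \<le> k" using tr(2) by (cases r) auto
    have "(p ^ r choose 2) = 2 ^ k * (2 ^ r - 1)"
      unfolding choose_two using True r by simp
    then show ?thesis using True r by (auto intro: dvd_mult2 le_imp_power_dvd)
  next
    case False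
    have odd: "odd p" using p False by (metis prime_odd_nat prime_ge_2_nat le_neq_implies_less)
    then have "even (p ^ r - 1)" by simp
    then have "(p ^ r choose 2) = p ^ r * ((p ^ r - 1) div 2)"
      unfolding choose_two by (simp add: div_mult_swap)
    then show ?thesis using tr(1) by (auto intro: dvd_mult2 le_imp_power_dvd)
  qed
  then obtain k where "(p ^ r choose 2) = p ^ t * k" by (elim dvdE)
  then have "commutator G y x [^] (p ^ r choose 2) = \<one>"
    using c x y by (simp add: nat_pow_pow [symmetric])
  then show ?thesis using pow_mult_class2[OF x y, of "p ^ r"] x y by simp
qed

end

section \<open>Products a^i b^j c^k and their arithmetic\<close>

context group begin

text \<open>Integer exponents let matrix entries and differences be used as they are; reduction to
  residues is left to \<open>tri_mod\<close>.\<close>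

definition tri :: "'a \<Rightarrow> 'a \<Rightarrow> 'a \<Rightarrow> int \<Rightarrow> int \<Rightarrow> int \<Rightarrow> 'a" where
  "tri a b c i j k = a [^] i \<otimes> b [^] j \<otimes> c [^] k"

lemma tri_closed [simp]:
  "a \<in> carrier G \<Longrightarrow> b \<in> carrier G \<Longrightarrow> c \<in> carrier G \<Longrightarrow> tri a b c i j k \<in> carrier G"
  by (simp add: tri_def)

lemma tri_unit:
  assumes "a \<in> carrier G" "b \<in> carrier G" "c \<in> carrier G"
  shows "tri a b c 0 0 0 = \<one>" "tri a b c 1 0 0 = a" "tri a b c 0 1 0 = b" "tri a b c 0 0 1 = c"
  using assms by (simp_all add: tri_def)

lemma int_pow_in_subgroup:
  assumes "subgroup H G" "x \<in> H"
  shows "x [^] (n::int) \<in> H"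
  using int_pow_consistent[OF assms] group.int_pow_closed[OF subgroup_imp_group[OF assms(1)], of x n] assms(2)
  by simp

lemma tri_in_subgroup:
  assumes "subgroup H G" "a \<in> H" "b \<in> H" "c \<in> H"
  shows "tri a b c i j k \<in> H"
  using assms by (simp add: tri_def subgroup.m_closed int_pow_in_subgroup)

lemma int_pow_mod:
  assumes "x \<in> carrier G" "x [^] (m::nat) = \<one>"
  shows "x [^] (i mod int m) = x [^] i"
proof -
  have "x [^] i = x [^] (int m * (i div int m) + i mod int m)" by simp
  also have "\<dots> = (x [^] int m) [^] (i div int m) \<otimes> x [^] (i mod int m)"
    unfolding int_pow_mult[OF assms(1)] int_pow_pow[OF assms(1)] ..
  finally show ?thesis using assms by (simp add: int_pow_int)
qed

lemma int_pow_eq_one: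
  assumes "x \<in> carrier G" "x [^] (m::nat) = \<one>" "int m dvd i"
  shows "x [^] i = \<one>"
  using int_pow_mod[OF assms(1,2), of i] assms(3) by simp

lemma tri_mod:
  assumes "a \<in> carrier G" "b \<in> carrier G" "c \<in> carrier G"
    and "a [^] (l::nat) = \<one>" "b [^] (m::nat) = \<one>" "c [^] (n::nat) = \<one>"
  shows "tri a b c (i mod int l) (j mod int m) (k mod int n) = tri a b c i j k"
  using assms by (simp add: tri_def int_pow_mod)

lemma card_tri_le:
  assumes "a \<in> carrier G" "b \<in> carrier G" "c \<in> carrier G"
    and "a [^] (l::nat) = \<one>" "b [^] (m::nat) = \<one>" "c [^] (n::nat) = \<one>" "l > 0" "m > 0" "n > 0"
    and S: "S \<subseteq> {tri a b c i j k | i j k. True}"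
  shows "finite S" "card S \<le> l * m * n"
proof -
  let ?B = "{0..<int l} \<times> {0..<int m} \<times> {0..<int n}"
  have sub: "S \<subseteq> (\<lambda>(i, j, k). tri a b c i j k) ` ?B"
  proof
    fix x assume "x \<in> S"
    then obtain i j k where "x = tri a b c i j k" using S by blast
    then have "x = tri a b c (i mod int l) (j mod int m) (k mod int n)"
      using assms by (simp add: tri_mod)
    moreover have "(i mod int l, j mod int m, k mod int n) \<in> ?B" using assms by simp
    ultimately show "x \<in> (\<lambda>(i, j, k). tri a b c i j k) ` ?B" by (metis (no_types, lifting) case_prod_conv image_eqI)
  qed
  have B: "finite ?B" "card ?B = l * m * n" by (simp_all add: card_cartesian_product)
  show "finite S" using sub B(1) finite_surj by blast
  show "card S \<le> l * m * n" using surj_card_le[OF B(1) sub] B(2) by simp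
qed

end

lemma (in group_hom) hom_tri:
  "a \<in> carrier G \<Longrightarrow> b \<in> carrier G \<Longrightarrow> c \<in> carrier G \<Longrightarrow>
    h (G.tri a b c i j k) = H.tri (h a) (h b) (h c) i j k"
  by (simp add: G.tri_def H.tri_def hom_int_pow)

lemma (in group_hom) hom_commutator:
  "x \<in> carrier G \<Longrightarrow> y \<in> carrier G \<Longrightarrow> h (commutator G x y) = commutator H (h x) (h y)"
  by (simp add: commutator_def)

context class2_group begin

lemma derived_closed: "d \<in> derived G (carrier G) \<Longrightarrow> d \<in> carrier G"
  using derived_in_carrier by blast

lemma derived_central: "d \<in> derived G (carrier G) \<Longrightarrow> d \<in> group_center G"
  using derived_subset_center by blast

lemma subgroup_derived: "subgroup (derived G (carrier G)) G"
  by (rule derived_is_subgroup) simp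

lemma commutator_center_left: "z \<in> group_center G \<Longrightarrow> g \<in> carrier G \<Longrightarrow> commutator G z g = \<one>"
  using center_iff by blast

lemma commutator_center_right: "z \<in> group_center G \<Longrightarrow> g \<in> carrier G \<Longrightarrow> commutator G g z = \<one>"
  by (metis center_closed commutator_center_left inv_commutator inv_one)

lemma commutator_int_pow_both:
  "x \<in> carrier G \<Longrightarrow> y \<in> carrier G \<Longrightarrow>
    commutator G (x [^] (i::int)) (y [^] (j::int)) = commutator G x y [^] (i * j)"
  by (simp add: commutator_int_pow_left commutator_int_pow_right int_pow_pow mult.commute)

text \<open>Collection: v1 has to pass u3 and u2, and v2 has to pass u3. The three commutators
  created are central and move to the end.\<close>

lemma triple_mult:
  assumes "u1 \<in> carrier G" "u2 \<in> carrier G" "u3 \<in> carrier G"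
    and "v1 \<in> carrier G" "v2 \<in> carrier G" "v3 \<in> carrier G"
  shows "u1 \<otimes> u2 \<otimes> u3 \<otimes> (v1 \<otimes> v2 \<otimes> v3) = (u1 \<otimes> v1) \<otimes> (u2 \<otimes> v2) \<otimes> (u3 \<otimes> v3)
    \<otimes> (commutator G u3 v1 \<otimes> commutator G u3 v2 \<otimes> commutator G u2 v1)"
proof -
  let ?d = "commutator G u3 v1 \<otimes> commutator G u3 v2" and ?e = "commutator G u2 v1"
  have de: "?d \<in> group_center G" "?e \<in> group_center G"
    using assms by (auto intro!: commutator_center subgroup.m_closed[OF subgroup_center])
  have "u3 \<otimes> (v1 \<otimes> v2) = v1 \<otimes> v2 \<otimes> u3 \<otimes> ?d"
    using assms mult_swap[of u3 "v1 \<otimes> v2"] by (simp add: commutator_bilinear_right)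
  moreover have "u1 \<otimes> u2 \<otimes> u3 \<otimes> (v1 \<otimes> v2 \<otimes> v3) = u1 \<otimes> u2 \<otimes> (u3 \<otimes> (v1 \<otimes> v2)) \<otimes> v3"
    using assms by (simp add: m_assoc)
  ultimately have "u1 \<otimes> u2 \<otimes> u3 \<otimes> (v1 \<otimes> v2 \<otimes> v3) = u1 \<otimes> u2 \<otimes> (v1 \<otimes> v2 \<otimes> u3 \<otimes> ?d) \<otimes> v3"
    by (simp only:)
  also have "\<dots> = u1 \<otimes> (u2 \<otimes> v1) \<otimes> v2 \<otimes> u3 \<otimes> (?d \<otimes> v3)"
    using assms by (simp add: m_assoc)
  also have "\<dots> = u1 \<otimes> (v1 \<otimes> u2 \<otimes> ?e) \<otimes> v2 \<otimes> u3 \<otimes> (v3 \<otimes> ?d)"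
    using assms mult_swap[of u2 v1] center_commutes[OF de(1), of v3] by simp
  also have "\<dots> = u1 \<otimes> v1 \<otimes> u2 \<otimes> (?e \<otimes> (v2 \<otimes> u3 \<otimes> v3 \<otimes> ?d))"
    using assms by (simp add: m_assoc)
  also have "\<dots> = u1 \<otimes> v1 \<otimes> u2 \<otimes> (v2 \<otimes> u3 \<otimes> v3 \<otimes> ?d \<otimes> ?e)"
    using assms center_commutes[OF de(2), of "v2 \<otimes> u3 \<otimes> v3 \<otimes> ?d"] by simp
  finally show ?thesis using assms by (simp add: m_assoc)
qed

lemma tri_mult:
  assumes "a \<in> carrier G" "b \<in> carrier G" "c \<in> carrier G"
  shows "tri a b c i j k \<otimes> tri a b c i' j' k' = tri a b c (i + i') (j + j') (k + k')
    \<otimes> (commutator G c a [^] (k * i') \<otimes> commutator G c b [^] (k * j') \<otimes> commutator G b a [^] (j * i'))"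
  using assms triple_mult[of "a [^] i" "b [^] j" "c [^] k" "a [^] i'" "b [^] j'" "c [^] k'"]
  by (simp add: tri_def int_pow_mult commutator_int_pow_both)

text \<open>Many arguments below need the exponents only modulo G', where they simply add.\<close>

lemma tri_mult_derived:
  assumes "a \<in> carrier G" "b \<in> carrier G" "c \<in> carrier G"
  obtains d where "d \<in> derived G (carrier G)"
    "tri a b c i j k \<otimes> tri a b c i' j' k' = tri a b c (i + i') (j + j') (k + k') \<otimes> d"
proof -
  have "commutator G c a [^] (k * i') \<otimes> commutator G c b [^] (k * j') \<otimes> commutator G b a [^] (j * i')
      \<in> derived G (carrier G)"
    using assms
    by (intro subgroup.m_closed[OF subgroup_derived] int_pow_in_subgroup[OF subgroup_derived] commutator_in_derived)
  then show ?thesis using that tri_mult[OF assms] by blast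
qed

lemma tri_pow_derived:
  assumes "a \<in> carrier G" "b \<in> carrier G" "c \<in> carrier G"
  obtains d where "d \<in> derived G (carrier G)"
    "tri a b c i j k [^] (n::nat) = tri a b c (int n * i) (int n * j) (int n * k) \<otimes> d"
proof -
  have "\<exists>d\<in>derived G (carrier G).
      tri a b c i j k [^] n = tri a b c (int n * i) (int n * j) (int n * k) \<otimes> d"
  proof (induction n)
    case 0
    show ?case
      by (rule bexI[of _ \<one>]) (simp_all add: subgroup.one_closed[OF subgroup_derived] tri_unit assms)
  next
    case (Suc n)
    let ?x = "tri a b c i j k" and ?y = "tri a b c (int n * i) (int n * j) (int n * k)"
    from Suc obtain d where d: "d \<in> derived G (carrier G)" "?x [^] n = ?y \<otimes> d" by blast
    obtain e where e: "e \<in> derived G (carrier G)"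
      "?y \<otimes> ?x = tri a b c (int n * i + i) (int n * j + j) (int n * k + k) \<otimes> e"
      using tri_mult_derived[OF assms] by blast
    have dx: "d \<otimes> ?x = ?x \<otimes> d"
      using center_commutes[OF derived_central[OF d(1)], of ?x] assms by simp
    have "?x [^] Suc n = ?y \<otimes> (d \<otimes> ?x)" using d assms derived_closed by (simp add: m_assoc)
    also have "\<dots> = ?y \<otimes> ?x \<otimes> d" unfolding dx using d(1) assms derived_closed by (simp add: m_assoc)
    also have "\<dots> = tri a b c (int n * i + i) (int n * j + j) (int n * k + k) \<otimes> (e \<otimes> d)"
      unfolding e(2) using d(1) e(1) assms derived_closed by (simp add: m_assoc)
    finally show ?case
      using subgroup.m_closed[OF subgroup_derived e(1) d(1)] by (auto simp: algebra_simps)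
  qed
  then show ?thesis using that by blast
qed

lemma tri_inv_derived:
  assumes "a \<in> carrier G" "b \<in> carrier G" "c \<in> carrier G"
  obtains d where "d \<in> derived G (carrier G)"
    "inv (tri a b c i j k) = tri a b c (-i) (-j) (-k) \<otimes> d"
proof -
  obtain d where d: "d \<in> derived G (carrier G)"
    "tri a b c i j k \<otimes> tri a b c (-i) (-j) (-k) = tri a b c (i + -i) (j + -j) (k + -k) \<otimes> d"
    using tri_mult_derived[OF assms] by blast
  let ?e = "inv d"
  have e: "?e \<in> derived G (carrier G)" using d(1) subgroup.m_inv_closed[OF subgroup_derived] by blast
  have dc: "d \<in> carrier G" using d(1) derived_closed by blast
  have "tri a b c i j k \<otimes> (tri a b c (-i) (-j) (-k) \<otimes> ?e) = \<one>"
    using d(2) dc assms by (simp add: m_assoc [symmetric] tri_unit)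
  then have "inv (tri a b c i j k) = tri a b c (-i) (-j) (-k) \<otimes> ?e"
    using assms dc by (metis inv_equality inv_inv m_closed inv_closed tri_closed)
  then show ?thesis using e that by blast
qed

lemma tri_diff_derived:
  assumes "a \<in> carrier G" "b \<in> carrier G" "c \<in> carrier G"
  obtains d where "d \<in> derived G (carrier G)"
    "tri a b c i j k \<otimes> inv (tri a b c i' j' k') = tri a b c (i - i') (j - j') (k - k') \<otimes> d"
proof -
  obtain d where d: "d \<in> derived G (carrier G)"
    "inv (tri a b c i' j' k') = tri a b c (-i') (-j') (-k') \<otimes> d"
    using tri_inv_derived[OF assms] by blast
  obtain e where e: "e \<in> derived G (carrier G)"
    "tri a b c i j k \<otimes> tri a b c (-i') (-j') (-k') = tri a b c (i + -i') (j + -j') (k + -k') \<otimes> e"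
    using tri_mult_derived[OF assms] by blast
  have "tri a b c i j k \<otimes> inv (tri a b c i' j' k') = tri a b c i j k \<otimes> tri a b c (-i') (-j') (-k') \<otimes> d"
    unfolding d(2) using d(1) derived_closed assms by (simp add: m_assoc)
  also have "\<dots> = tri a b c (i - i') (j - j') (k - k') \<otimes> (e \<otimes> d)"
    unfolding e(2) using d(1) e(1) derived_closed assms by (simp add: m_assoc)
  finally show ?thesis using that subgroup.m_closed[OF subgroup_derived e(1) d(1)] by blast
qed

lemma tri_central_mult:
  assumes "a \<in> group_center G" "b \<in> group_center G" "c \<in> group_center G"
  shows "tri a b c i j k \<otimes> tri a b c i' j' k' = tri a b c (i + i') (j + j') (k + k')"
  using assms by (simp add: tri_mult commutator_center_left)

lemma tri_central_pow:
  assumes "a \<in> group_center G" "b \<in> group_center G" "c \<in> group_center G"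
  shows "tri a b c i j k [^] (n::int) = tri a b c (n * i) (n * j) (n * k)"
proof -
  have pow: "x [^] (m::int) \<in> group_center G" if "x \<in> group_center G" for x m
    using int_pow_in_subgroup[OF subgroup_center that] .
  have "(a [^] i \<otimes> b [^] j \<otimes> c [^] k) [^] n = (a [^] i \<otimes> b [^] j) [^] n \<otimes> (c [^] k) [^] n"
    using assms pow center_commutes[of "c [^] k" "a [^] i \<otimes> b [^] j"]
    by (intro int_pow_mult_distrib) auto
  also have "(a [^] i \<otimes> b [^] j) [^] n = (a [^] i) [^] n \<otimes> (b [^] j) [^] n"
    using assms pow center_commutes[of "a [^] i" "b [^] j"] by (intro int_pow_mult_distrib) auto
  finally show ?thesis
    using assms by (simp add: tri_def int_pow_pow mult.commute)
qed

text \<open>Exponents transform like a row vector multiplied by a matrix. Through this rule,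
  substituting one generating system of G' into another becomes a product of integer
  matrices.\<close>

lemma tri_tri:
  assumes "a \<in> group_center G" "b \<in> group_center G" "c \<in> group_center G"
  shows "tri (tri a b c i1 j1 k1) (tri a b c i2 j2 k2) (tri a b c i3 j3 k3) l m n
    = tri a b c (l * i1 + m * i2 + n * i3) (l * j1 + m * j2 + n * j3) (l * k1 + m * k2 + n * k3)"
  using assms unfolding tri_def[of "tri a b c i1 j1 k1"]
  by (simp add: tri_central_pow tri_central_mult)

section \<open>Class-two groups with three generators\<close>

definition generating_triple :: "'a \<Rightarrow> 'a \<Rightarrow> 'a \<Rightarrow> bool" where
  "generating_triple a b c \<longleftrightarrow>
    a \<in> carrier G \<and> b \<in> carrier G \<and> c \<in> carrier G \<and> generate G {a, b, c} = carrier G"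

lemma generating_triple_subgroup:
  assumes "generating_triple a b c" "subgroup H G" "a \<in> H" "b \<in> H" "c \<in> H" "g \<in> carrier G"
  shows "g \<in> H"
  using assms generate_subgroup_incl[of "{a, b, c}" H] unfolding generating_triple_def by auto

text \<open>Modulo G' the group is abelian and generated by a, b, c, so the products of this form
  are already a subgroup.\<close>

lemma carrier_decomposition:
  assumes gt: "generating_triple a b c" and g: "g \<in> carrier G"
  obtains i j k d where "d \<in> derived G (carrier G)" "g = tri a b c i j k \<otimes> d"
proof -
  have abc: "a \<in> carrier G" "b \<in> carrier G" "c \<in> carrier G"
    using gt by (auto simp: generating_triple_def)
  note D = subgroup_derived and dc = derived_closed
  let ?H = "{tri a b c i j k \<otimes> d | i j k d. d \<in> derived G (carrier G)}"
  have mem: "tri a b c i j k \<in> ?H" for i j k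
  proof -
    have "tri a b c i j k = tri a b c i j k \<otimes> \<one>" using abc by simp
    then show ?thesis using subgroup.one_closed[OF D] by blast
  qed
  have "subgroup ?H G"
  proof (rule subgroupI)
    show "?H \<subseteq> carrier G" using abc dc by auto
    show "?H \<noteq> {}" using mem by blast
    show "inv x \<in> ?H" if "x \<in> ?H" for x
    proof -
      from that obtain i j k d where x: "x = tri a b c i j k \<otimes> d" "d \<in> derived G (carrier G)" by blast
      obtain e where e: "e \<in> derived G (carrier G)" "inv (tri a b c i j k) = tri a b c (-i) (-j) (-k) \<otimes> e"
        using tri_inv_derived[OF abc] by blast
      have "inv x = inv (tri a b c i j k) \<otimes> inv d"
        using x abc dc derived_central[OF x(2)] center_commutes[of d "tri a b c i j k"]
        by (metis inv_mult_group tri_closed)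
      also have "\<dots> = tri a b c (-i) (-j) (-k) \<otimes> (e \<otimes> inv d)"
        unfolding e(2) using abc dc x(2) e(1) by (simp add: m_assoc)
      finally show ?thesis
        using subgroup.m_closed[OF D e(1) subgroup.m_inv_closed[OF D x(2)]] by blast
    qed
    show "x \<otimes> y \<in> ?H" if "x \<in> ?H" "y \<in> ?H" for x y
    proof -
      from that obtain i j k d i' j' k' d'
        where x: "x = tri a b c i j k \<otimes> d" "d \<in> derived G (carrier G)"
          and y: "y = tri a b c i' j' k' \<otimes> d'" "d' \<in> derived G (carrier G)" by blast
      obtain e where e: "e \<in> derived G (carrier G)"
        "tri a b c i j k \<otimes> tri a b c i' j' k' = tri a b c (i + i') (j + j') (k + k') \<otimes> e"
        using tri_mult_derived[OF abc] by blast
      have "x \<otimes> y = tri a b c i j k \<otimes> (d \<otimes> tri a b c i' j' k') \<otimes> d'"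
        unfolding x(1) y(1) using abc dc x(2) y(2) by (simp add: m_assoc)
      also have "d \<otimes> tri a b c i' j' k' = tri a b c i' j' k' \<otimes> d"
        using center_commutes[OF derived_central[OF x(2)]] abc by simp
      also have "tri a b c i j k \<otimes> (tri a b c i' j' k' \<otimes> d) \<otimes> d'
          = tri a b c i j k \<otimes> tri a b c i' j' k' \<otimes> (d \<otimes> d')"
        using abc dc x(2) y(2) by (simp add: m_assoc)
      also have "\<dots> = tri a b c (i + i') (j + j') (k + k') \<otimes> (e \<otimes> (d \<otimes> d'))"
        unfolding e(2) using abc dc x(2) y(2) e(1) by (simp add: m_assoc)
      finally show ?thesis
        using subgroup.m_closed[OF D e(1) subgroup.m_closed[OF D x(2) y(2)]] by blast
    qed
  qed
  moreover have "a \<in> ?H" "b \<in> ?H" "c \<in> ?H"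
    using mem[of 1 0 0] mem[of 0 1 0] mem[of 0 0 1] tri_unit[OF abc] by auto
  ultimately have "g \<in> ?H" using generating_triple_subgroup[OF gt _ _ _ _ g] by blast
  then show ?thesis using that by blast
qed

text \<open>The products of powers of the three central commutators form a subgroup D. By
  bilinearity the u with [u,v] in D form a subgroup for each v, so all commutators lie in D as soon
  as those of the generators do.\<close>

lemma derived_decomposition:
  assumes gt: "generating_triple a b c" and d: "d \<in> derived G (carrier G)"
  obtains i j k where "d = tri (commutator G a b) (commutator G a c) (commutator G b c) i j k"
proof -
  have abc: "a \<in> carrier G" "b \<in> carrier G" "c \<in> carrier G"
    using gt by (auto simp: generating_triple_def)
  let ?t = "tri (commutator G a b) (commutator G a c) (commutator G b c)"
  have Z: "commutator G a b \<in> group_center G" "commutator G a c \<in> group_center G"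
    "commutator G b c \<in> group_center G" using abc commutator_center by auto
  define D where "D = {?t i j k | i j k. True}"
  have Dsub: "subgroup D G"
    unfolding D_def
  proof (rule subgroupI)
    show "inv x \<in> {?t i j k | i j k. True}" if "x \<in> {?t i j k | i j k. True}" for x
    proof -
      from that obtain i j k where x: "x = ?t i j k" by blast
      have "inv x = x [^] (-1 :: int)" using x abc by (simp add: int_pow_neg)
      then show ?thesis unfolding x tri_central_pow[OF Z] by blast
    qed
    show "x \<otimes> y \<in> {?t i j k | i j k. True}" if "x \<in> {?t i j k | i j k. True}" "y \<in> {?t i j k | i j k. True}" for x y
      using that by (auto simp: tri_central_mult[OF Z]) blast
  qed (use abc in auto)
  have mem: "commutator G a b \<in> D" "commutator G a c \<in> D" "commutator G b c \<in> D" "\<one> \<in> D"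
    using tri_unit[of "commutator G a b" "commutator G a c" "commutator G b c"] abc
    unfolding D_def by (auto, metis+)
  have memi: "commutator G b a \<in> D" "commutator G c a \<in> D" "commutator G c b \<in> D"
    using subgroup.m_inv_closed[OF Dsub mem(1)] subgroup.m_inv_closed[OF Dsub mem(2)]
      subgroup.m_inv_closed[OF Dsub mem(3)] abc by (simp_all add: inv_commutator)
  have self: "commutator G g g = \<one>" if "g \<in> carrier G" for g using that by (simp add: commutator_eq_one_iff)
  have left: "commutator G u v \<in> D"
    if v: "v \<in> carrier G" and g: "commutator G a v \<in> D" "commutator G b v \<in> D" "commutator G c v \<in> D"
      and u: "u \<in> carrier G" for u v
  proof -
    let ?H = "{u \<in> carrier G. commutator G u v \<in> D}"
    have "subgroup ?H G"
    proof (rule subgroupI)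
      show "?H \<noteq> {}" using g abc by blast
      show "inv x \<in> ?H" if "x \<in> ?H" for x
        using that v subgroup.m_inv_closed[OF Dsub, of "commutator G x v"] by (simp add: commutator_inv_left)
      show "x \<otimes> y \<in> ?H" if "x \<in> ?H" "y \<in> ?H" for x y
        using that v subgroup.m_closed[OF Dsub, of "commutator G x v" "commutator G y v"]
        by (simp add: commutator_bilinear_left)
    qed auto
    then show ?thesis using generating_triple_subgroup[OF gt, of ?H u] g abc u by blast
  qed
  have left_gen: "commutator G u a \<in> D" "commutator G u b \<in> D" "commutator G u c \<in> D"
    if "u \<in> carrier G" for u
    using left[OF abc(1) _ _ _ that] left[OF abc(2) _ _ _ that] left[OF abc(3) _ _ _ that]
      abc mem memi self by simp_all
  have all: "commutator G u v \<in> D" if "u \<in> carrier G" "v \<in> carrier G" for u v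
  proof -
    have "commutator G g u \<in> D" if "g \<in> {a, b, c}" for g
    proof -
      have "commutator G u g \<in> D" using left_gen[OF \<open>u \<in> carrier G\<close>] that by blast
      moreover have "g \<in> carrier G" using that abc by blast
      ultimately show ?thesis
        using subgroup.m_inv_closed[OF Dsub, of "commutator G u g"] \<open>u \<in> carrier G\<close> by (simp add: inv_commutator)
    qed
    then have "commutator G v u \<in> D" using left[of u v] that by simp
    then show ?thesis
      using subgroup.m_inv_closed[OF Dsub, of "commutator G v u"] that by (simp add: inv_commutator)
  qed
  have "derived G (carrier G) \<subseteq> D" unfolding derived_def
  proof (rule generate_subgroup_incl[OF _ Dsub], rule subsetI)
    fix x assume "x \<in> derived_set G (carrier G)"
    then obtain h k where "h \<in> carrier G" "k \<in> carrier G" "x = h \<otimes> k \<otimes> inv h \<otimes> inv k" by blast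
    then show "x \<in> D" using all[of "inv h" "inv k"] by (simp add: commutator_def)
  qed
  then show ?thesis using that d unfolding D_def by blast
qed

end

section \<open>Structure of three-generated pE-groups\<close>

text \<open>The consequences of the pE-hypotheses that remain once class two is known. The exponent
  p^t of G' is split into a law and an element violating the law for p^(t-1); in the counting
  argument that element forces a basic commutator to have order exactly p^t.\<close>

locale pE_class2 = class2_group G for G (structure) +
  fixes p r t :: nat
  assumes prime: "Factorial_Ring.prime p"
    and fin: "finite (carrier G)"
    and order_prime_power: "\<exists>N. order G = p ^ N"
    and t_pos: "1 \<le> t"
    and t_le: "t \<le> r"
    and t_less: "p = 2 \<Longrightarrow> t < r"
    and derived_exponent: "x \<in> derived G (carrier G) \<Longrightarrow> x [^] (p ^ t) = \<one>"
    and derived_exponent_sharp: "\<exists>x \<in> derived G (carrier G). x [^] (p ^ (t - 1)) \<noteq> \<one>"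
    and pow_in_derived: "x \<in> carrier G \<Longrightarrow> x [^] (p ^ r) \<in> derived G (carrier G)"
    and torsion_central: "x \<in> carrier G \<Longrightarrow> x [^] (p ^ r) = \<one> \<Longrightarrow> x \<in> group_center G"
begin

lemma p_gt_1: "p > 1" using prime prime_gt_1_nat by blast

text \<open>The exponent k is invertible modulo the order p^N of G, so x is a power of x^k.\<close>

lemma root_in_subgroup:
  assumes H: "subgroup H G" and x: "x \<in> carrier G" "x [^] (k::int) \<in> H" and k: "\<not> int p dvd k"
  shows "x \<in> H"
proof -
  obtain N where N: "order G = p ^ N" using order_prime_power by blast
  have pi: "Factorial_Ring.prime (int p)" using prime by simp
  have "coprime k (int p ^ N)"
    using prime_imp_coprime[OF pi k] by (simp add: coprime_commute)
  then obtain l where "[k * l = 1] (mod int p ^ N)" using cong_solve_coprime_int by blast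
  then have "int (p ^ N) dvd k * l - 1" by (simp add: cong_iff_dvd_diff)
  then have "x [^] (k * l - 1) = \<one>"
    using x(1) pow_order_eq_1[OF x(1)] N by (intro int_pow_eq_one[of _ "p ^ N"]) auto
  then have "x [^] (k * l) \<otimes> inv x = \<one>" using x(1) by (simp add: int_pow_diff)
  then have "x [^] (k * l) = x"
    using x(1) by (metis int_pow_closed inv_closed inv_inv inv_equality)
  moreover have "x [^] (k * l) \<in> H"
    using int_pow_in_subgroup[OF H x(2), of l] x(1) by (simp add: int_pow_pow)
  ultimately show ?thesis by simp
qed

lemma generating_triple_transfer:
  assumes "generating_triple a b c" "a' \<in> carrier G" "b' \<in> carrier G" "c' \<in> carrier G"
    and "a \<in> generate G {a', b', c'}" "b \<in> generate G {a', b', c'}" "c \<in> generate G {a', b', c'}"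
  shows "generating_triple a' b' c'"
proof -
  have sub: "subgroup (generate G {a', b', c'}) G"
    using assms by (intro generate_is_subgroup) auto
  have "carrier G \<subseteq> generate G {a', b', c'}"
    using generating_triple_subgroup[OF assms(1) sub assms(5-7)] by blast
  then show ?thesis
    using assms subgroup.subset[OF sub] by (auto simp: generating_triple_def)
qed

text \<open>Steinitz exchange for a p-group: a generator whose exponent is prime to p is a power of
  the corresponding factor, and this factor is expressed by the product and the two other
  generators.\<close>

lemma generating_triple_exchange:
  assumes gt: "generating_triple a b c" and ijk: "\<not> (int p dvd i \<and> int p dvd j \<and> int p dvd k)"
  shows "\<exists>u v. generating_triple u v (tri a b c i j k)"
proof -
  let ?x = "tri a b c i j k"
  have abc: "a \<in> carrier G" "b \<in> carrier G" "c \<in> carrier G"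
    using gt by (auto simp: generating_triple_def)
  have sub: "subgroup (generate G {u, v, ?x}) G" if "u \<in> carrier G" "v \<in> carrier G" for u v
    using that abc by (intro generate_is_subgroup) auto
  have mem: "u \<in> generate G {u, v, ?x}" "v \<in> generate G {u, v, ?x}" "?x \<in> generate G {u, v, ?x}" for u v
    by (auto intro: generate.incl)
  note cl = subgroup.m_closed[OF sub] subgroup.m_inv_closed[OF sub] int_pow_in_subgroup[OF sub]
  have a_pow: "a [^] i = ?x \<otimes> inv (c [^] k) \<otimes> inv (b [^] j)"
    and b_pow: "b [^] j = inv (a [^] i) \<otimes> (?x \<otimes> inv (c [^] k))"
    and c_pow: "c [^] k = inv (b [^] j) \<otimes> (inv (a [^] i) \<otimes> ?x)"
    using abc by (simp_all add: tri_def m_assoc)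
  from ijk consider "\<not> int p dvd i" | "\<not> int p dvd j" | "\<not> int p dvd k" by blast
  then show ?thesis
  proof cases
    case 1
    have "a [^] i \<in> generate G {b, c, ?x}"
      unfolding a_pow using mem[where u = b and v = c] abc by (intro cl) auto
    then have "a \<in> generate G {b, c, ?x}" using root_in_subgroup[OF sub] abc 1 by blast
    then have "generating_triple b c ?x"
      using abc mem[where u = b and v = c] by (intro generating_triple_transfer[OF gt]) auto
    then show ?thesis by blast
  next
    case 2
    have "b [^] j \<in> generate G {a, c, ?x}"
      unfolding b_pow using mem[where u = a and v = c] abc by (intro cl) auto
    then have "b \<in> generate G {a, c, ?x}" using root_in_subgroup[OF sub] abc 2 by blast
    then have "generating_triple a c ?x"
      using abc mem[where u = a and v = c] by (intro generating_triple_transfer[OF gt]) auto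
    then show ?thesis by blast
  next
    case 3
    have "c [^] k \<in> generate G {a, b, ?x}"
      unfolding c_pow using mem[where u = a and v = b] abc by (intro cl) auto
    then have "c \<in> generate G {a, b, ?x}" using root_in_subgroup[OF sub] abc 3 by blast
    then have "generating_triple a b ?x"
      using abc mem[where u = a and v = b] by (intro generating_triple_transfer[OF gt]) auto
    then show ?thesis by blast
  qed
qed

section \<open>Counting with the p^r-th power map\<close>

abbreviation pw :: "'a \<Rightarrow> 'a" where "pw x \<equiv> x [^] (p ^ r)"

lemma pw_hom: "group_hom G G pw"
proof -
  have "pw (x \<otimes> y) = pw x \<otimes> pw y" if "x \<in> carrier G" "y \<in> carrier G" for x y
    using that derived_exponent commutator_in_derived t_le t_less prime
    by (intro prime_power_mult_distrib[of p t]) auto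
  then show ?thesis
    unfolding group_hom_def group_hom_axioms_def hom_def using is_group by auto
qed

lemma pw_tri:
  "a \<in> carrier G \<Longrightarrow> b \<in> carrier G \<Longrightarrow> c \<in> carrier G \<Longrightarrow>
    pw (tri a b c i j k) = tri (pw a) (pw b) (pw c) i j k"
  by (rule group_hom.hom_tri[OF pw_hom])

lemma pw_eq_imp_center:
  assumes "x \<in> carrier G" "y \<in> carrier G" "pw x = pw y"
  shows "x \<otimes> inv y \<in> group_center G"
proof (rule torsion_central)
  show "pw (x \<otimes> inv y) = \<one>"
    using assms group_hom.hom_mult[OF pw_hom] group_hom.hom_inv[OF pw_hom] by simp
qed (use assms in auto)

lemma center_cancel_derived:
  assumes "x \<in> carrier G" "d \<in> derived G (carrier G)"
  shows "x \<otimes> d \<in> group_center G \<longleftrightarrow> x \<in> group_center G"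
proof
  assume "x \<otimes> d \<in> group_center G"
  then have "x \<otimes> d \<otimes> inv d \<in> group_center G"
    using derived_central[OF assms(2)] subgroup_center by (metis subgroup.m_closed subgroup.m_inv_closed)
  then show "x \<in> group_center G" using assms derived_closed by (simp add: m_assoc)
next
  assume "x \<in> group_center G"
  then show "x \<otimes> d \<in> group_center G"
    using derived_central[OF assms(2)] subgroup_center by (metis subgroup.m_closed)
qed

lemma pw_tri_eq_imp_center:
  assumes "a \<in> carrier G" "b \<in> carrier G" "c \<in> carrier G"
    and "pw (tri a b c i j k) = pw (tri a b c i' j' k')"
  shows "tri a b c (i - i') (j - j') (k - k') \<in> group_center G"
proof -
  obtain d where "d \<in> derived G (carrier G)"
    "tri a b c i j k \<otimes> inv (tri a b c i' j' k') = tri a b c (i - i') (j - j') (k - k') \<otimes> d"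
    using tri_diff_derived[OF assms(1-3)] by blast
  then show ?thesis
    using pw_eq_imp_center[OF _ _ assms(4)] assms(1-3) center_cancel_derived by simp
qed

lemma dvd_of_pow_eq_one:
  assumes x: "x \<in> carrier G" and "x [^] (p ^ m) = \<one>" "x [^] (p ^ (m - 1)) \<noteq> \<one>" "x [^] (i::int) = \<one>"
  shows "int (p ^ m) dvd i"
proof -
  have "ord x dvd p ^ m" using assms pow_eq_id by blast
  then obtain k where k: "k \<le> m" "ord x = p ^ k" using divides_primepow_nat[OF prime] by blast
  have "\<not> ord x dvd p ^ (m - 1)" using assms pow_eq_id by blast
  then have "\<not> k \<le> m - 1" using k le_imp_power_dvd by metis
  \<comment> \<open>Truncated subtraction is harmless: for m = 0 the two hypotheses on x contradict
    each other.\<close>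
  then have "k = m" using k(1) by linarith
  then have "ord x = p ^ m" using k(2) by simp
  moreover have "int (ord x) dvd i" using assms int_pow_eq_id by blast
  ultimately show ?thesis by simp
qed

text \<open>Common factors p are stripped one at a time. If the exponents are p^m times i', j', k'
  with m < s, and one of these is prime to p, then a^i' b^j' c^k' belongs to a generating triple
  although its p^m-th power is central, against minimality.\<close>

lemma tri_center_dvd_of_minimal:
  assumes min: "\<And>m a b c. m < s \<Longrightarrow> generating_triple a b c \<Longrightarrow> c [^] (p ^ m) \<notin> group_center G"
    and gt: "generating_triple a b c" and Z: "tri a b c i j k \<in> group_center G"
  shows "int (p ^ s) dvd i \<and> int (p ^ s) dvd j \<and> int (p ^ s) dvd k"
proof -
  have abc: "a \<in> carrier G" "b \<in> carrier G" "c \<in> carrier G"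
    using gt by (auto simp: generating_triple_def)
  have "m \<le> s \<Longrightarrow> int (p ^ m) dvd i \<and> int (p ^ m) dvd j \<and> int (p ^ m) dvd k" for m
  proof (induction m)
    case (Suc m)
    then obtain i' j' k' where ijk: "i = int (p ^ m) * i'" "j = int (p ^ m) * j'" "k = int (p ^ m) * k'"
      by (auto elim!: dvdE)
    let ?x = "tri a b c i' j' k'"
    obtain d where d: "d \<in> derived G (carrier G)" "?x [^] (p ^ m) = tri a b c i j k \<otimes> d"
      using tri_pow_derived[OF abc, of i' j' k' "p ^ m"] ijk by metis
    have "?x [^] (p ^ m) \<in> group_center G"
      using d Z center_cancel_derived abc by simp
    then have "int p dvd i' \<and> int p dvd j' \<and> int p dvd k'"
      using min[of m] Suc.prems generating_triple_exchange[OF gt] by (meson Suc_le_eq)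
    then show ?case unfolding ijk by (auto simp: mult.commute intro: mult_dvd_mono)
  qed simp
  then show ?thesis by blast
qed

text \<open>Comparing \<open>|G / Z(G)| \<le> |G\<^bsup>p^r\<^esup>| \<le> |G'|\<close> for a triple \<open>a, b, c\<close> with \<open>c\<^bsup>p^s\<^esup>\<close> central and \<open>s\<close>
  minimal: the left side is at least \<open>p\<^bsup>2t+s\<^esup>\<close> and the right side at most \<open>p\<^bsup>t+2s\<^esup>\<close>.\<close>

lemma generating_triple_pow_not_central:
  assumes "generating_triple a0 b0 c0" "s0 < t"
  shows "c0 [^] (p ^ s0) \<notin> group_center G"
proof
  assume c0: "c0 [^] (p ^ s0) \<in> group_center G"
  let ?P = "\<lambda>s. \<exists>a b c. generating_triple a b c \<and> c [^] (p ^ s) \<in> group_center G"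
  define s where "s = (LEAST s. ?P s)"
  have "?P s0" using c0 assms by blast
  then have s: "?P s" "s \<le> s0" and min: "\<And>m. m < s \<Longrightarrow> \<not> ?P m"
    unfolding s_def by (rule LeastI, rule Least_le) (use not_less_Least in blast)
  from s obtain a b c where gt: "generating_triple a b c" and c: "c [^] (p ^ s) \<in> group_center G" by blast
  have st: "s < t" using s assms by simp
  have abc: "a \<in> carrier G" "b \<in> carrier G" "c \<in> carrier G"
    using gt by (auto simp: generating_triple_def)
  let ?u = "commutator G a b" and ?v = "commutator G a c" and ?w = "commutator G b c"
  have uvw: "?u \<in> carrier G" "?v \<in> carrier G" "?w \<in> carrier G"
    and uvwZ: "?u \<in> group_center G" "?v \<in> group_center G" "?w \<in> group_center G"
    using abc commutator_center by auto
  have c_trivial: "commutator G g c [^] (p ^ s) = \<one>" if "g \<in> carrier G" for g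
  proof -
    have "commutator G g (c [^] (p ^ s)) = commutator G g c [^] (p ^ s)"
      using commutator_int_pow_right[OF that abc(3), of "int (p ^ s)"] unfolding int_pow_int .
    then show ?thesis using commutator_center_right[OF c that] by simp
  qed
  have u_t: "?u [^] (p ^ t) = \<one>" using abc derived_exponent commutator_in_derived by blast
  \<comment> \<open>The other two basic commutators have exponent p^s, which divides p^(t-1), so
    [a,b] alone must account for the exponent p^t of G'.\<close>
  have u_sharp: "?u [^] (p ^ (t - 1)) \<noteq> \<one>"
  proof
    assume u1: "?u [^] (p ^ (t - 1)) = \<one>"
    obtain d where d: "d \<in> derived G (carrier G)" "d [^] (p ^ (t - 1)) \<noteq> \<one>"
      using derived_exponent_sharp by blast
    obtain i j k where ijk: "d = tri ?u ?v ?w i j k" using derived_decomposition[OF gt d(1)] by blast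
    have "int (p ^ s) dvd int (p ^ (t - 1)) * l" for l
      using st by (intro dvd_mult2) (simp add: le_imp_power_dvd)
    then have "d [^] int (p ^ (t - 1)) = \<one>"
      unfolding ijk tri_central_pow[OF uvwZ]
      using abc u1 c_trivial int_pow_eq_one[of ?u "p ^ (t - 1)"] int_pow_eq_one[of ?v "p ^ s"]
        int_pow_eq_one[of ?w "p ^ s"]
      by (simp add: tri_def)
    then show False using d(2) by (simp only: int_pow_int)
  qed
  let ?D = "derived G (carrier G)"
  have D_tri: "?D \<subseteq> {tri ?u ?v ?w i j k | i j k. True}"
  proof
    fix d assume "d \<in> ?D"
    then obtain i j k where "d = tri ?u ?v ?w i j k" by (rule derived_decomposition[OF gt])
    then show "d \<in> {tri ?u ?v ?w i j k | i j k. True}" by blast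
  qed
  have finD: "finite ?D" using fin derived_in_carrier finite_subset by blast
  have pos: "p ^ l > 0" for l using p_gt_1 by simp
  have card_D: "card ?D \<le> p ^ t * p ^ s * p ^ s"
    by (rule card_tri_le(2)[OF uvw u_t c_trivial[OF abc(1)] c_trivial[OF abc(2)] pos pos pos D_tri])
  \<comment> \<open>The box has p^(2t+s) elements: the exponents of a and b are recovered modulo p^t
    from commutators with b and a, the exponent of c modulo p^s from the minimality of s.\<close>
  let ?B = "{0..<int (p ^ t)} \<times> {0..<int (p ^ t)} \<times> {0..<int (p ^ s)}"
  let ?f = "\<lambda>(i, j, k). pw (tri a b c i j k)"
  have "inj_on ?f ?B"
  proof (rule inj_onI)
    fix x y assume xy: "x \<in> ?B" "y \<in> ?B" "?f x = ?f y"
    obtain i j k i' j' k' where ijk: "x = (i, j, k)" "y = (i', j', k')" by (metis prod_cases3)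
    have *: "i \<in> {0..<int (p ^ t)}" "j \<in> {0..<int (p ^ t)}" "k \<in> {0..<int (p ^ s)}"
      "i' \<in> {0..<int (p ^ t)}" "j' \<in> {0..<int (p ^ t)}" "k' \<in> {0..<int (p ^ s)}"
      and eq: "pw (tri a b c i j k) = pw (tri a b c i' j' k')"
      using xy unfolding ijk by simp_all
    have Z: "tri a b c (i - i') (j - j') (k - k') \<in> group_center G"
      by (rule pw_tri_eq_imp_center[OF abc eq])
    have small: "z = z'" if "z \<in> {0..<m}" "z' \<in> {0..<m}" "m dvd z - z'" for m z z' :: int
      using that by (metis atLeastLessThan_iff mod_eq_dvd_iff mod_pos_pos_trivial)
    have k: "k = k'"
      using tri_center_dvd_of_minimal[OF _ gt Z] min * by (intro small) blast+
    have self: "commutator G g g = \<one>" if "g \<in> carrier G" for g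
      using that by (simp add: commutator_eq_one_iff)
    \<comment> \<open>Once k = k', the commutator with b retains only [a,b]^(i-i'), and the
      commutator with a only [a,b]^(j-j').\<close>
    have "commutator G (tri a b c (i - i') (j - j') 0) b = \<one>"
      "commutator G a (tri a b c (i - i') (j - j') 0) = \<one>"
      using Z k abc commutator_center_left commutator_center_right by simp_all
    then have "?u [^] (i - i') = \<one>" "?u [^] (j - j') = \<one>"
      using abc by (simp_all add: tri_def commutator_bilinear_left commutator_bilinear_right
        commutator_int_pow_left commutator_int_pow_right self)
    then have "int (p ^ t) dvd i - i'" "int (p ^ t) dvd j - j'"
      using dvd_of_pow_eq_one[OF uvw(1) u_t u_sharp] by blast+
    then show "x = y" using k * small unfolding ijk by blast
  qed
  moreover have "?f ` ?B \<subseteq> ?D" using abc pow_in_derived by auto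
  ultimately have "card ?B \<le> card ?D" using finD card_inj_on_le by blast
  also have "card ?B = p ^ t * p ^ t * p ^ s"
    by (simp add: card_cartesian_product del: of_nat_power)
  finally have "p ^ t * p ^ t * p ^ s \<le> p ^ t * p ^ s * p ^ s" using card_D by linarith
  then have "p ^ (t + t + s) \<le> p ^ (t + s + s)" by (simp only: power_add)
  then have "t + t + s \<le> t + s + s" using p_gt_1 by (simp only: power_le_imp_le_exp)
  then show False using st by simp
qed

text \<open>No member of a generating triple has a central p^m-th power with m < t, so s = t is
  allowed in \<open>tri_center_dvd_of_minimal\<close>: a, b, c are independent modulo p^t in
  G/Z(G).\<close>

lemma tri_center_dvd:
  assumes "generating_triple a b c" "tri a b c i j k \<in> group_center G"
  shows "int (p ^ t) dvd i" "int (p ^ t) dvd j" "int (p ^ t) dvd k"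
  using tri_center_dvd_of_minimal[OF generating_triple_pow_not_central assms] by auto

end

text \<open>The relations read in an arbitrary group, so that they can be carried along
  homomorphisms from the free group.\<close>

definition (in group) pE_relations_hold ::
    "nat \<Rightarrow> nat \<Rightarrow> nat \<Rightarrow> int ^ 3 ^ 3 \<Rightarrow> 'a \<Rightarrow> 'a \<Rightarrow> 'a \<Rightarrow> bool" where
  "pE_relations_hold p r t T a b c \<longleftrightarrow>
    a [^] (p ^ (r + t)) = \<one> \<and> b [^] (p ^ (r + t)) = \<one> \<and> c [^] (p ^ (r + t)) = \<one> \<and>
    commutator G (a [^] (p ^ t)) b = \<one> \<and> commutator G (a [^] (p ^ t)) c = \<one> \<and>
    commutator G (b [^] (p ^ t)) a = \<one> \<and> commutator G (b [^] (p ^ t)) c = \<one> \<and>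
    commutator G (c [^] (p ^ t)) a = \<one> \<and> commutator G (c [^] (p ^ t)) b = \<one> \<and>
    commutator G a b = tri a b c (int (p ^ r) * T $ 1 $ 1) (int (p ^ r) * T $ 1 $ 2) (int (p ^ r) * T $ 1 $ 3) \<and>
    commutator G a c = tri a b c (int (p ^ r) * T $ 2 $ 1) (int (p ^ r) * T $ 2 $ 2) (int (p ^ r) * T $ 2 $ 3) \<and>
    commutator G b c = tri a b c (int (p ^ r) * T $ 3 $ 1) (int (p ^ r) * T $ 3 $ 2) (int (p ^ r) * T $ 3 $ 3)"

lemma (in group) tri_pow_arg:
  assumes "a \<in> carrier G" "b \<in> carrier G" "c \<in> carrier G"
  shows "tri (a [^] (n::nat)) (b [^] n) (c [^] n) i j k = tri a b c (int n * i) (int n * j) (int n * k)"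
  using assms int_pow_pow[of a "int n" i] int_pow_pow[of b "int n" j] int_pow_pow[of c "int n" k]
  by (simp add: tri_def int_pow_int)

context class2_group begin

lemma commutator_nat_pow_left:
  "x \<in> carrier G \<Longrightarrow> y \<in> carrier G \<Longrightarrow> commutator G (x [^] (n::nat)) y = commutator G x y [^] n"
  using commutator_int_pow_left[of x y "int n"] unfolding int_pow_int .

text \<open>The commutators created by collection have exponents divisible by n, hence by m, and
  vanish.\<close>

lemma tri_mult_multiple:
  assumes abc: "a \<in> carrier G" "b \<in> carrier G" "c \<in> carrier G"
    and comm: "\<And>x y. x \<in> carrier G \<Longrightarrow> y \<in> carrier G \<Longrightarrow> commutator G x y [^] m = \<one>"
    and "m dvd n"
  shows "tri a b c i j k \<otimes> tri a b c (int n * i') (int n * j') (int n * k')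
    = tri a b c (i + int n * i') (j + int n * j') (k + int n * k')"
proof -
  have "commutator G x y [^] (l * (int n * l')) = \<one>"
    if "x \<in> carrier G" "y \<in> carrier G" for x y l l'
    using that comm \<open>m dvd n\<close> by (intro int_pow_eq_one[of _ m]) auto
  then show ?thesis using abc by (simp only: tri_mult) simp
qed

text \<open>The rows of T S and of the unit matrix are both coordinates of the elements of A with
  respect to A itself, and \<open>indep\<close> makes coordinates unique modulo m. Exchanging A and
  B gives the inverse on the other side.\<close>

lemma central_base_change:
  fixes A B :: "3 \<Rightarrow> 'a" and T S :: "int ^ 3 ^ 3"
  assumes Z: "\<And>i. A i \<in> group_center G"
    and AB: "\<And>i. A i = tri (B 1) (B 2) (B 3) (T $ i $ 1) (T $ i $ 2) (T $ i $ 3)"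
    and BA: "\<And>i. B i = tri (A 1) (A 2) (A 3) (S $ i $ 1) (S $ i $ 2) (S $ i $ 3)"
    and indep: "\<And>i j k. tri (A 1) (A 2) (A 3) i j k = \<one> \<Longrightarrow> m dvd i \<and> m dvd j \<and> m dvd k"
  shows "[(T ** S) $ i $ j = mat 1 $ i $ j] (mod m)"
proof -
  let ?t = "tri (A 1) (A 2) (A 3)"
  have Ac: "A i \<in> carrier G" for i using Z by simp
  have ac: "A i = ?t ((T ** S) $ i $ 1) ((T ** S) $ i $ 2) ((T ** S) $ i $ 3)" for i
    using AB[of i] unfolding BA[of 1] BA[of 2] BA[of 3] tri_tri[OF Z Z Z]
    by (simp add: matrix_matrix_mult_def sum_3)
  have unit: "A i = ?t (mat 1 $ i $ 1) (mat 1 $ i $ 2) (mat 1 $ i $ 3)" for i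
    using exhaust_3[of i] tri_unit[OF Ac Ac Ac, of 1 2 3] by (auto simp: mat_def)
  have "?t ((T ** S) $ i $ 1 - mat 1 $ i $ 1) ((T ** S) $ i $ 2 - mat 1 $ i $ 2)
      ((T ** S) $ i $ 3 - mat 1 $ i $ 3) = \<one>" for i
  proof -
    let ?x = "(T ** S) $ i $ 1 - mat 1 $ i $ 1" and ?y = "(T ** S) $ i $ 2 - mat 1 $ i $ 2"
      and ?z = "(T ** S) $ i $ 3 - mat 1 $ i $ 3"
    have "A i \<otimes> ?t ?x ?y ?z = A i"
    proof -
      have "A i \<otimes> ?t ?x ?y ?z = ?t (mat 1 $ i $ 1) (mat 1 $ i $ 2) (mat 1 $ i $ 3) \<otimes> ?t ?x ?y ?z"
        using unit[of i] by simp
      also have "\<dots> = ?t ((T ** S) $ i $ 1) ((T ** S) $ i $ 2) ((T ** S) $ i $ 3)"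
        unfolding tri_central_mult[OF Z Z Z] by simp
      finally show ?thesis using ac[of i] by simp
    qed
    then show ?thesis using Ac l_cancel_one[of "A i" "?t ?x ?y ?z"] by simp
  qed
  from indep[OF this[of i]] show ?thesis
    using exhaust_3[of j] by (auto simp: cong_iff_dvd_diff)
qed

end

section \<open>The two bases of G', the order of G and the relation matrix\<close>

context pE_class2 begin

context
  fixes a b c
  assumes gt: "generating_triple a b c"
begin

lemma gen_closed: "a \<in> carrier G" "b \<in> carrier G" "c \<in> carrier G"
  using gt by (auto simp: generating_triple_def)

lemma commutator_pow_trivial:
  "x \<in> carrier G \<Longrightarrow> y \<in> carrier G \<Longrightarrow> commutator G x y [^] (p ^ t) = \<one>"
  using derived_exponent commutator_in_derived by blast

lemma pow_t_central: "x \<in> carrier G \<Longrightarrow> x [^] (p ^ t) \<in> group_center G"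
  unfolding center_iff by (simp add: commutator_nat_pow_left commutator_pow_trivial)

lemma pw_independent:
  assumes "tri (pw a) (pw b) (pw c) i j k = \<one>"
  shows "int (p ^ t) dvd i \<and> int (p ^ t) dvd j \<and> int (p ^ t) dvd k"
proof -
  have "pw (tri a b c i j k) = \<one>" using assms gen_closed pw_tri by simp
  then have "tri a b c i j k \<in> group_center G" using torsion_central gen_closed by simp
  then show ?thesis using tri_center_dvd[OF gt] by blast
qed

text \<open>The commutators bound |G'| from above by p^(3t). The p^r-th powers give the same bound
  from below, because the power map separates exponent triples modulo p^t. So the powers fill
  G'.\<close>

lemma derived_card_facts:
  shows "derived G (carrier G) \<subseteq> {tri (pw a) (pw b) (pw c) i j k | i j k. True}"
    and "card (derived G (carrier G)) = p ^ t * p ^ t * p ^ t"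
proof -
  let ?u = "commutator G a b" and ?v = "commutator G a c" and ?w = "commutator G b c"
  let ?D = "derived G (carrier G)"
  note abc = gen_closed
  have finD: "finite ?D" using fin derived_in_carrier finite_subset by blast
  have pos: "p ^ l > 0" for l using p_gt_1 by simp
  have D_tri: "?D \<subseteq> {tri ?u ?v ?w i j k | i j k. True}"
  proof
    fix d assume "d \<in> ?D"
    then obtain i j k where "d = tri ?u ?v ?w i j k" by (rule derived_decomposition[OF gt])
    then show "d \<in> {tri ?u ?v ?w i j k | i j k. True}" by blast
  qed
  have card_D: "card ?D \<le> p ^ t * p ^ t * p ^ t"
    by (rule card_tri_le(2)[OF _ _ _ _ _ _ pos pos pos D_tri]) (use abc commutator_pow_trivial in auto)
  let ?B = "{0..<int (p ^ t)} \<times> {0..<int (p ^ t)} \<times> {0..<int (p ^ t)}"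
  let ?f = "\<lambda>(i, j, k). pw (tri a b c i j k)"
  have inj: "inj_on ?f ?B"
  proof (rule inj_onI)
    fix x y assume xy: "x \<in> ?B" "y \<in> ?B" "?f x = ?f y"
    obtain i j k i' j' k' where ijk: "x = (i, j, k)" "y = (i', j', k')" by (metis prod_cases3)
    have *: "i \<in> {0..<int (p ^ t)}" "j \<in> {0..<int (p ^ t)}" "k \<in> {0..<int (p ^ t)}"
      "i' \<in> {0..<int (p ^ t)}" "j' \<in> {0..<int (p ^ t)}" "k' \<in> {0..<int (p ^ t)}"
      and eq: "pw (tri a b c i j k) = pw (tri a b c i' j' k')"
      using xy unfolding ijk by simp_all
    have small: "z = z'" if "z \<in> {0..<m}" "z' \<in> {0..<m}" "m dvd z - z'" for m z z' :: int
      using that by (metis atLeastLessThan_iff mod_eq_dvd_iff mod_pos_pos_trivial)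
    show "x = y"
      using tri_center_dvd[OF gt pw_tri_eq_imp_center[OF abc eq]] * small unfolding ijk by blast
  qed
  have im: "?f ` ?B \<subseteq> ?D" using abc pow_in_derived by auto
  have "card ?B = p ^ t * p ^ t * p ^ t"
    by (simp add: card_cartesian_product del: of_nat_power)
  then have card_im: "card (?f ` ?B) = p ^ t * p ^ t * p ^ t" using card_image[OF inj] by simp
  then show card: "card ?D = p ^ t * p ^ t * p ^ t"
    using card_D card_mono[OF finD im] by simp
  have "?f ` ?B = ?D" using card_subset_eq[OF finD im] card_im card by simp
  then have "?D \<subseteq> range ?f" by blast
  then show "?D \<subseteq> {tri (pw a) (pw b) (pw c) i j k | i j k. True}"
    unfolding pw_tri[OF abc] by fastforce
qed

text \<open>The p^(3t) exponent triples cover a set of p^(3t) elements, so each element is reached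
  once: generating G' already implies independence.\<close>

lemma commutator_independent:
  assumes "tri (commutator G a b) (commutator G a c) (commutator G b c) i j k = \<one>"
  shows "int (p ^ t) dvd i \<and> int (p ^ t) dvd j \<and> int (p ^ t) dvd k"
proof -
  let ?t = "tri (commutator G a b) (commutator G a c) (commutator G b c)"
  let ?D = "derived G (carrier G)" and ?m = "int (p ^ t)"
  let ?B = "{0..<?m} \<times> {0..<?m} \<times> {0..<?m}" and ?f = "\<lambda>(i, j, k). ?t i j k"
  note abc = gen_closed
  have tmod: "?t (i mod ?m) (j mod ?m) (k mod ?m) = ?t i j k" for i j k
    by (rule tri_mod) (use abc commutator_pow_trivial in auto)
  have mpos: "?m > 0" using p_gt_1 by simp
  have sub: "?D \<subseteq> ?f ` ?B"
  proof
    fix d assume "d \<in> ?D"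
    then obtain i j k where "d = ?t i j k" by (rule derived_decomposition[OF gt])
    then have "d = ?f (i mod ?m, j mod ?m, k mod ?m)" using tmod by simp
    moreover have "(i mod ?m, j mod ?m, k mod ?m) \<in> ?B" using mpos by simp
    ultimately show "d \<in> ?f ` ?B" by blast
  qed
  have cardB: "card ?B = p ^ t * p ^ t * p ^ t"
    by (simp add: card_cartesian_product del: of_nat_power)
  have "card (?f ` ?B) = card ?B"
    using card_mono[OF _ sub] card_image_le[of ?B ?f] derived_card_facts(2) cardB by simp
  then have inj: "inj_on ?f ?B" by (simp add: eq_card_imp_inj_on)
  have "?f (i mod ?m, j mod ?m, k mod ?m) = ?f (0, 0, 0)"
    using assms tmod tri_unit[of "commutator G a b" "commutator G a c" "commutator G b c"] abc by simp
  then have "(i mod ?m, j mod ?m, k mod ?m) = (0, 0, 0)"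
    using mpos by (intro inj_onD[OF inj]) auto
  then show ?thesis by auto
qed

text \<open>In effect, a, b, c are independent modulo p^r in G/G'. If the exponents are p^m times
  i', j', k' with m < r, then a^i' b^j' c^k' has a central p^(t-1)-th power, so p divides i', j' and
  k'.\<close>

lemma derived_tri_dvd:
  assumes D: "tri a b c i j k \<in> derived G (carrier G)"
  shows "int (p ^ r) dvd i \<and> int (p ^ r) dvd j \<and> int (p ^ r) dvd k"
proof -
  note abc = gen_closed
  obtain t' where t': "t = Suc t'" using t_pos by (cases t) auto
  have "m \<le> r \<Longrightarrow> int (p ^ m) dvd i \<and> int (p ^ m) dvd j \<and> int (p ^ m) dvd k" for m
  proof (induction m)
    case (Suc m)
    then obtain i' j' k' where ijk: "i = int (p ^ m) * i'" "j = int (p ^ m) * j'" "k = int (p ^ m) * k'"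
      by (auto elim!: dvdE)
    let ?x = "tri a b c i' j' k'"
    have xc: "?x \<in> carrier G" using abc by simp
    obtain d where d: "d \<in> derived G (carrier G)" "?x [^] (p ^ m) = tri a b c i j k \<otimes> d"
      using tri_pow_derived[OF abc, of i' j' k' "p ^ m"] ijk by metis
    have xm: "?x [^] (p ^ m) \<in> derived G (carrier G)"
      unfolding d(2) by (rule subgroup.m_closed[OF subgroup_derived D d(1)])
    \<comment> \<open>As m < r, the sum (t - 1) + r is at least m + t, and p^(m+t) kills x because
      x^(p^m) lies in G'.\<close>
    have e: "p ^ t' * p ^ r = p ^ m * (p ^ t * p ^ (r - Suc m))"
    proof -
      have "t' + r = m + (t + (r - Suc m))" using Suc.prems t' by simp
      then show ?thesis by (simp only: power_add [symmetric])
    qed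
    have "pw (?x [^] (p ^ t')) = ((?x [^] (p ^ m)) [^] (p ^ t)) [^] (p ^ (r - Suc m))"
      using xc by (simp only: nat_pow_pow e nat_pow_closed mult.assoc)
    also have "\<dots> = \<one>" unfolding derived_exponent[OF xm] by simp
    finally have "?x [^] (p ^ t') \<in> group_center G" using torsion_central xc by simp
    moreover obtain d' where d': "d' \<in> derived G (carrier G)"
      "?x [^] (p ^ t') = tri a b c (int (p ^ t') * i') (int (p ^ t') * j') (int (p ^ t') * k') \<otimes> d'"
      using tri_pow_derived[OF abc] by blast
    ultimately have "tri a b c (int (p ^ t') * i') (int (p ^ t') * j') (int (p ^ t') * k') \<in> group_center G"
      using center_cancel_derived abc by simp
    from tri_center_dvd[OF gt this] have "int p dvd i'" "int p dvd j'" "int p dvd k'"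
      using p_gt_1 unfolding t' by (simp_all add: mult.commute[of "int p"])
    then show ?case unfolding ijk by (auto simp: mult.commute intro: mult_dvd_mono)
  qed simp
  then show ?thesis by blast
qed

lemma tri_mult_pw_multiple:
  "tri a b c i j k \<otimes> tri a b c (int (p ^ r) * i') (int (p ^ r) * j') (int (p ^ r) * k')
    = tri a b c (i + int (p ^ r) * i') (j + int (p ^ r) * j') (k + int (p ^ r) * k')"
  by (rule tri_mult_multiple[where m = "p ^ t"])
    (use gen_closed commutator_pow_trivial t_le in \<open>auto intro: le_imp_power_dvd\<close>)

text \<open>The exponents are determined modulo p^r in G/G', and a further factor p^t by the
  independence of the p^r-th powers in G'. The products cover G because G' consists of products of
  such powers.\<close>

lemma order_eq: "order G = p ^ (3 * (r + t))"
proof -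
  note abc = gen_closed
  let ?m = "int (p ^ (r + t))"
  let ?B = "{0..<?m} \<times> {0..<?m} \<times> {0..<?m}" and ?f = "\<lambda>(i, j, k). tri a b c i j k"
  have mpos: "?m > 0" using p_gt_1 by simp
  have m: "?m = int (p ^ r) * int (p ^ t)" by (simp add: power_add)
  have one: "x [^] (p ^ (r + t)) = \<one>" if "x \<in> carrier G" for x
    using derived_exponent[OF pow_in_derived[OF that]] that by (simp add: nat_pow_pow power_add)
  have surj: "carrier G \<subseteq> ?f ` ?B"
  proof
    fix g assume "g \<in> carrier G"
    then obtain i j k d where g: "d \<in> derived G (carrier G)" "g = tri a b c i j k \<otimes> d"
      by (rule carrier_decomposition[OF gt])
    obtain i' j' k' where "d = tri (pw a) (pw b) (pw c) i' j' k'"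
      using derived_card_facts(1) g(1) by blast
    then obtain i'' j'' k'' where "g = tri a b c i'' j'' k''"
      using g(2) tri_mult_pw_multiple abc by (auto simp only: tri_pow_arg)
    then have "g = ?f (i'' mod ?m, j'' mod ?m, k'' mod ?m)"
      using tri_mod[OF abc one[OF abc(1)] one[OF abc(2)] one[OF abc(3)]] by simp
    moreover have "(i'' mod ?m, j'' mod ?m, k'' mod ?m) \<in> ?B" using mpos by simp
    ultimately show "g \<in> ?f ` ?B" by blast
  qed
  have inj: "inj_on ?f ?B"
  proof (rule inj_onI)
    fix x y assume xy: "x \<in> ?B" "y \<in> ?B" "?f x = ?f y"
    obtain i j k i' j' k' where ijk: "x = (i, j, k)" "y = (i', j', k')" by (metis prod_cases3)
    have eq: "tri a b c i j k = tri a b c i' j' k'" using xy unfolding ijk by simp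
    obtain d where d: "d \<in> derived G (carrier G)"
      "tri a b c i j k \<otimes> inv (tri a b c i' j' k') = tri a b c (i - i') (j - j') (k - k') \<otimes> d"
      using tri_diff_derived[OF abc] by blast
    have "tri a b c (i - i') (j - j') (k - k') \<otimes> d = \<one>" using d(2) eq abc by simp
    then have "tri a b c (i - i') (j - j') (k - k') = inv d"
      using inv_equality[of "tri a b c (i - i') (j - j') (k - k')" d] abc derived_closed[OF d(1)] by simp
    then have "tri a b c (i - i') (j - j') (k - k') \<in> derived G (carrier G)"
      using subgroup.m_inv_closed[OF subgroup_derived d(1)] by simp
    from derived_tri_dvd[OF this] obtain i0 j0 k0
      where 0: "i - i' = int (p ^ r) * i0" "j - j' = int (p ^ r) * j0" "k - k' = int (p ^ r) * k0"
      by (auto elim!: dvdE)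
    \<comment> \<open>No commutator survives in this split: its exponent would be a multiple of p^r,
      hence of p^t.\<close>
    then have "tri a b c i j k = tri a b c i' j' k' \<otimes> tri a b c (int (p ^ r) * i0) (int (p ^ r) * j0) (int (p ^ r) * k0)"
      unfolding tri_mult_pw_multiple by (simp flip: 0 del: of_nat_power)
    then have "tri a b c (int (p ^ r) * i0) (int (p ^ r) * j0) (int (p ^ r) * k0) = \<one>"
      using eq abc by simp
    then have "tri (pw a) (pw b) (pw c) i0 j0 k0 = \<one>" using abc by (simp only: tri_pow_arg)
    then have "?m dvd i - i'" "?m dvd j - j'" "?m dvd k - k'"
      using pw_independent unfolding 0 m by (auto intro: mult_dvd_mono)
    moreover have small: "z = z'" if "z \<in> {0..<m}" "z' \<in> {0..<m}" "m dvd z - z'" for m z z' :: int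
      using that by (metis atLeastLessThan_iff mod_eq_dvd_iff mod_pos_pos_trivial)
    ultimately show "x = y" using xy(1,2) unfolding ijk by (auto intro!: small simp del: of_nat_power)
  qed
  have "?f ` ?B = carrier G" using surj abc by auto
  then have "order G = card ?B" using card_image[OF inj] by (simp add: order_def)
  also have "\<dots> = p ^ (r + t) * (p ^ (r + t) * p ^ (r + t))"
    by (simp add: card_cartesian_product del: of_nat_power)
  also have "\<dots> = p ^ (3 * (r + t))"
  proof -
    have "3 * (r + t) = (r + t) + ((r + t) + (r + t))" by simp
    then show ?thesis by (simp only: power_add)
  qed
  finally show ?thesis .
qed

text \<open>T and S express each of the two bases of G' in the other; uniqueness of coordinates in
  either basis makes them inverse modulo p^t.\<close>

lemma relation_matrix:
  obtains T S :: "int ^ 3 ^ 3"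
  where "pE_relations_hold p r t T a b c"
    "\<And>i j. [(T ** S) $ i $ j = mat 1 $ i $ j] (mod int (p ^ t))"
    "\<And>i j. [(S ** T) $ i $ j = mat 1 $ i $ j] (mod int (p ^ t))"
proof -
  note abc = gen_closed
  define A where "A = (\<lambda>i::3. if i = 1 then commutator G a b else if i = 2 then commutator G a c else commutator G b c)"
  define B where "B = (\<lambda>i::3. if i = 1 then pw a else if i = 2 then pw b else pw c)"
  have A: "A 1 = commutator G a b" "A 2 = commutator G a c" "A 3 = commutator G b c"
    and B: "B 1 = pw a" "B 2 = pw b" "B 3 = pw c" by (simp_all add: A_def B_def)
  have AD: "A i \<in> derived G (carrier G)" for i using abc commutator_in_derived by (simp add: A_def)
  have BD: "B i \<in> derived G (carrier G)" for i using abc pow_in_derived by (simp add: B_def)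
  have "\<forall>i. \<exists>v :: int ^ 3. A i = tri (B 1) (B 2) (B 3) (v $ 1) (v $ 2) (v $ 3)"
  proof
    fix i
    obtain x y z where "A i = tri (B 1) (B 2) (B 3) x y z"
      using derived_card_facts(1) AD[of i] unfolding B by blast
    then show "\<exists>v :: int ^ 3. A i = tri (B 1) (B 2) (B 3) (v $ 1) (v $ 2) (v $ 3)"
      by (intro exI[of _ "vector [x, y, z]"]) (simp add: vector_3)
  qed
  then obtain T' :: "3 \<Rightarrow> int ^ 3" where T': "\<And>i. A i = tri (B 1) (B 2) (B 3) (T' i $ 1) (T' i $ 2) (T' i $ 3)"
    by metis
  have "\<forall>i. \<exists>v :: int ^ 3. B i = tri (A 1) (A 2) (A 3) (v $ 1) (v $ 2) (v $ 3)"
  proof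
    fix i
    obtain x y z where "B i = tri (A 1) (A 2) (A 3) x y z"
      using derived_decomposition[OF gt BD[of i]] unfolding A by blast
    then show "\<exists>v :: int ^ 3. B i = tri (A 1) (A 2) (A 3) (v $ 1) (v $ 2) (v $ 3)"
      by (intro exI[of _ "vector [x, y, z]"]) (simp add: vector_3)
  qed
  then obtain S' :: "3 \<Rightarrow> int ^ 3" where S': "\<And>i. B i = tri (A 1) (A 2) (A 3) (S' i $ 1) (S' i $ 2) (S' i $ 3)"
    by metis
  define T S where "T = (\<chi> i. T' i)" and "S = (\<chi> i. S' i)"
  have AB: "A i = tri (B 1) (B 2) (B 3) (T $ i $ 1) (T $ i $ 2) (T $ i $ 3)" for i
    using T' by (simp add: T_def)
  have BA: "B i = tri (A 1) (A 2) (A 3) (S $ i $ 1) (S $ i $ 2) (S $ i $ 3)" for i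
    using S' by (simp add: S_def)
  have AZ: "A i \<in> group_center G" and BZ: "B i \<in> group_center G" for i
    using AD BD derived_central by auto
  have one: "x [^] (p ^ (r + t)) = \<one>" if "x \<in> carrier G" for x
    using derived_exponent[OF pow_in_derived[OF that]] that by (simp add: nat_pow_pow power_add)
  show ?thesis
  proof (rule that)
    show "[(T ** S) $ i $ j = mat 1 $ i $ j] (mod int (p ^ t))" for i j
      by (rule central_base_change[OF AZ AB BA]) (use commutator_independent in \<open>simp add: A\<close>)
    show "[(S ** T) $ i $ j = mat 1 $ i $ j] (mod int (p ^ t))" for i j
      by (rule central_base_change[OF BZ BA AB]) (use pw_independent in \<open>simp add: B\<close>)
    show "pE_relations_hold p r t T a b c"
      unfolding pE_relations_hold_def
      using abc one pow_t_central commutator_center_left AB[of 1] AB[of 2] AB[of 3]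
      unfolding A B tri_pow_arg[OF abc] by blast
  qed
qed

end

end

section \<open>Groups satisfying the relations\<close>

lemma group_exponent_eqI:
  assumes "n > 0" "\<And>g. g \<in> carrier G \<Longrightarrow> g [^]\<^bsub>G\<^esub> n = \<one>\<^bsub>G\<^esub>"
    and "\<And>m. m > 0 \<Longrightarrow> (\<And>g. g \<in> carrier G \<Longrightarrow> g [^]\<^bsub>G\<^esub> m = \<one>\<^bsub>G\<^esub>) \<Longrightarrow> n \<le> m"
  shows "group_exponent G = n"
  unfolding group_exponent_def by (rule Least_equality) (use assms in auto)

lemma (in group) group_exponent_facts:
  assumes "finite (carrier G)"
  shows "group_exponent G > 0" "\<And>g. g \<in> carrier G \<Longrightarrow> g [^] group_exponent G = \<one>"
    and "\<And>m. m > 0 \<Longrightarrow> (\<And>g. g \<in> carrier G \<Longrightarrow> g [^] m = \<one>) \<Longrightarrow> group_exponent G \<le> m"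
proof -
  let ?P = "\<lambda>n. n > 0 \<and> (\<forall>g\<in>carrier G. g [^] n = \<one>)"
  have "?P (order G)" using assms pow_order_eq_1 order_gt_0_iff_finite by auto
  then have "?P (group_exponent G)" unfolding group_exponent_def by (rule LeastI)
  then show "group_exponent G > 0" "\<And>g. g \<in> carrier G \<Longrightarrow> g [^] group_exponent G = \<one>" by auto
  show "group_exponent G \<le> m" if "m > 0" "\<And>g. g \<in> carrier G \<Longrightarrow> g [^] m = \<one>" for m
    unfolding group_exponent_def by (rule Least_le) (use that in auto)
qed

context group begin

lemma derived_quotient_pow_eq_one_iff:
  assumes "g \<in> carrier G"
  shows "(derived G (carrier G) #> g) [^]\<^bsub>G Mod derived G (carrier G)\<^esub> (n::nat)
      = \<one>\<^bsub>G Mod derived G (carrier G)\<^esub> \<longleftrightarrow> g [^] n \<in> derived G (carrier G)"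
proof -
  have N: "derived G (carrier G) \<lhd> G" by (rule derived_self_is_normal)
  have "(derived G (carrier G) #> g) [^]\<^bsub>G Mod derived G (carrier G)\<^esub> n = derived G (carrier G) #> g [^] n"
    using normal.FactGroup_pow[OF N assms] by simp
  then show ?thesis
    using assms normal_imp_subgroup[OF N]
    by (metis coset_join1 coset_join2 nat_pow_closed one_FactGroup subgroup.subset)
qed

lemma derived_quotient_pow_eq_one:
  "(\<forall>q\<in>carrier (G Mod derived G (carrier G)). q [^]\<^bsub>G Mod derived G (carrier G)\<^esub> (n::nat)
      = \<one>\<^bsub>G Mod derived G (carrier G)\<^esub>) \<longleftrightarrow> (\<forall>g\<in>carrier G. g [^] n \<in> derived G (carrier G))"
  unfolding carrier_FactGroup using derived_quotient_pow_eq_one_iff by auto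

text \<open>Only the general commutator identities are available here. They suffice because a
  central commutator is fixed by conjugation, so the u with [u,y] central form a subgroup; inverting
  commutators handles the other entry.\<close>

lemma class2_groupI:
  assumes gen: "generate G S = carrier G" "S \<subseteq> carrier G"
    and S: "\<And>x y. x \<in> S \<Longrightarrow> y \<in> S \<Longrightarrow> commutator G x y \<in> group_center G"
  shows "class2_group G"
proof -
  note Z = subgroup_center
  have conj: "conjugate z g = z" if "z \<in> group_center G" "g \<in> carrier G" for z g
    using that by (intro conjugate_eq_self) (auto simp: group_center_def)
  have ext: "commutator G x y \<in> group_center G"
    if y: "y \<in> carrier G" "\<And>x. x \<in> S \<Longrightarrow> commutator G x y \<in> group_center G" and x: "x \<in> carrier G" for x y
  proof -
    let ?H = "{x \<in> carrier G. commutator G x y \<in> group_center G}"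
    have "subgroup ?H G"
    proof (rule subgroupI)
      have "commutator G \<one> y = \<one>" using y by (simp add: commutator_eq_one_iff)
      then show "?H \<noteq> {}" using subgroup.one_closed[OF Z] by auto
      show "inv u \<in> ?H" if "u \<in> ?H" for u
      proof -
        have "commutator G (inv u) y = conjugate (inv (commutator G u y)) (inv u)"
          using that y by (simp add: commutator_def conjugate_def m_assoc inv_mult_group)
        then show ?thesis using that y conj subgroup.m_inv_closed[OF Z] by simp
      qed
      show "u \<otimes> v \<in> ?H" if "u \<in> ?H" "v \<in> ?H" for u v
        using that y conj subgroup.m_closed[OF Z] by (simp add: commutator_mult_left)
    qed auto
    then have "generate G S \<subseteq> ?H" by (rule generate_subgroup_incl[rotated]) (use gen y in auto)
    then show ?thesis using x gen by blast
  qed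
  have sym: "commutator G y x \<in> group_center G"
    if "commutator G x y \<in> group_center G" "x \<in> carrier G" "y \<in> carrier G" for x y
    using subgroup.m_inv_closed[OF Z that(1)] that by (simp add: inv_commutator)
  have one: "commutator G x s \<in> group_center G" if "x \<in> carrier G" "s \<in> S" for x s
    using that S gen by (intro ext[of s x]) auto
  have two: "commutator G x y \<in> group_center G" if "x \<in> carrier G" "y \<in> carrier G" for x y
    using that by (intro ext[of y x]) (use sym one gen in blast)+
  show ?thesis by unfold_locales (rule two)
qed

lemma group_center_generators:
  assumes "generate G S = carrier G" "S \<subseteq> carrier G" "z \<in> carrier G"
    and "\<And>s. s \<in> S \<Longrightarrow> commutator G z s = \<one>"
  shows "z \<in> group_center G"
proof -
  have "s \<otimes> z = z \<otimes> s" if "s \<in> S" for s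
    using assms that commutator_eq_one_iff[of z s] by auto
  then have "generate G S \<subseteq> {x \<in> carrier G. x \<otimes> z = z \<otimes> x}"
    using assms by (intro generate_subgroup_incl subgroup_centralizer) auto
  then show ?thesis using assms by (auto simp: group_center_def)
qed

end

text \<open>Any group with three generators satisfying the relations, for any T. The bound on the
  order is proved at this level; the exact order and an inverse of T enter in the inner context, for
  the pE-property.\<close>

locale pE_presented = group G for G (structure) +
  fixes p r t :: nat and T :: "int ^ 3 ^ 3" and a b c
  assumes prime: "Factorial_Ring.prime p"
    and t_pos: "1 \<le> t"
    and t_le: "t \<le> r"
    and t_less: "p = 2 \<Longrightarrow> t < r"
    and gen_closed: "a \<in> carrier G" "b \<in> carrier G" "c \<in> carrier G"
    and gen: "generate G {a, b, c} = carrier G"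
    and rel: "pE_relations_hold p r t T a b c"
begin

lemma p_gt_1: "p > 1" using prime prime_gt_1_nat by blast

lemma gen_pow_t_central:
  "a [^] (p ^ t) \<in> group_center G" "b [^] (p ^ t) \<in> group_center G" "c [^] (p ^ t) \<in> group_center G"
proof -
  have self: "commutator G (x [^] n) x = \<one>" if "x \<in> carrier G" for x and n :: nat
  proof -
    have "x [^] n \<otimes> x = x \<otimes> x [^] n" using that by (metis nat_pow_Suc nat_pow_Suc2)
    then show ?thesis using that by (simp add: commutator_eq_one_iff)
  qed
  show "a [^] (p ^ t) \<in> group_center G" "b [^] (p ^ t) \<in> group_center G" "c [^] (p ^ t) \<in> group_center G"
    using gen gen_closed rel[unfolded pE_relations_hold_def] self
    by (auto intro!: group_center_generators[of "{a, b, c}"])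
qed

lemma gen_pow_r_central:
  "a [^] (p ^ r) \<in> group_center G" "b [^] (p ^ r) \<in> group_center G" "c [^] (p ^ r) \<in> group_center G"
proof -
  have "x [^] (p ^ r) \<in> group_center G" if "x \<in> carrier G" "x [^] (p ^ t) \<in> group_center G" for x
  proof -
    have "p ^ r = p ^ t * p ^ (r - t)" using t_le by (simp add: power_add [symmetric])
    then have "x [^] (p ^ r) = (x [^] (p ^ t)) [^] int (p ^ (r - t))"
      using that by (simp only: int_pow_int nat_pow_pow)
    then show ?thesis
      using int_pow_in_subgroup[OF subgroup_center that(2)] by simp
  qed
  then show "a [^] (p ^ r) \<in> group_center G" "b [^] (p ^ r) \<in> group_center G" "c [^] (p ^ r) \<in> group_center G"
    using gen_closed gen_pow_t_central by auto
qed

lemma generator_commutators: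
  "commutator G a b = tri (a [^] (p ^ r)) (b [^] (p ^ r)) (c [^] (p ^ r)) (T $ 1 $ 1) (T $ 1 $ 2) (T $ 1 $ 3)"
  "commutator G a c = tri (a [^] (p ^ r)) (b [^] (p ^ r)) (c [^] (p ^ r)) (T $ 2 $ 1) (T $ 2 $ 2) (T $ 2 $ 3)"
  "commutator G b c = tri (a [^] (p ^ r)) (b [^] (p ^ r)) (c [^] (p ^ r)) (T $ 3 $ 1) (T $ 3 $ 2) (T $ 3 $ 3)"
  using rel unfolding pE_relations_hold_def tri_pow_arg[OF gen_closed] by blast+

text \<open>The relations write the commutators of generators as products of p^r-th powers of
  generators. As t <= r, these are powers of the central p^t-th powers.\<close>

lemma class2: "class2_group G"
proof (rule class2_groupI[OF gen])
  have Z: "commutator G a b \<in> group_center G" "commutator G a c \<in> group_center G"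
    "commutator G b c \<in> group_center G"
    unfolding generator_commutators by (intro tri_in_subgroup[OF subgroup_center] gen_pow_r_central)+
  have sym: "commutator G y x \<in> group_center G"
    if "commutator G x y \<in> group_center G" "x \<in> carrier G" "y \<in> carrier G" for x y
    using subgroup.m_inv_closed[OF subgroup_center that(1)] that by (simp add: inv_commutator)
  have self: "commutator G x x \<in> group_center G" if "x \<in> carrier G" for x
    using commutator_eq_one_iff[of x x] that subgroup.one_closed[OF subgroup_center] by simp
  show "commutator G x y \<in> group_center G" if "x \<in> {a, b, c}" "y \<in> {a, b, c}" for x y
    using that Z sym[OF Z(1)] sym[OF Z(2)] sym[OF Z(3)] self gen_closed by auto
qed (use gen_closed in auto)

sublocale class2_group G by (rule class2)

lemma gt: "generating_triple a b c"
  using gen gen_closed by (simp add: generating_triple_def)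

abbreviation "A \<equiv> a [^] (p ^ r)"
abbreviation "B \<equiv> b [^] (p ^ r)"
abbreviation "C \<equiv> c [^] (p ^ r)"

lemma ABC_pow: "A [^] (p ^ t) = \<one>" "B [^] (p ^ t) = \<one>" "C [^] (p ^ t) = \<one>"
  using rel gen_closed unfolding pE_relations_hold_def by (simp_all add: nat_pow_pow power_add)

lemma derived_tri_pow:
  assumes "d \<in> derived G (carrier G)"
  obtains i j k where "d = tri A B C i j k"
proof -
  obtain i j k where "d = tri (commutator G a b) (commutator G a c) (commutator G b c) i j k"
    using assms by (rule derived_decomposition[OF gt])
  then have "\<exists>i j k. d = tri A B C i j k"
    unfolding generator_commutators tri_tri[OF gen_pow_r_central] by blast
  then show ?thesis using that by blast
qed

lemma derived_exponent:
  assumes "d \<in> derived G (carrier G)"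
  shows "d [^] (p ^ t) = \<one>"
proof -
  obtain i j k where d: "d = tri A B C i j k" using assms by (rule derived_tri_pow)
  have "d [^] int (p ^ t) = \<one>"
    unfolding d tri_central_pow[OF gen_pow_r_central]
    using ABC_pow gen_closed int_pow_eq_one[of _ "p ^ t"] by (simp add: tri_def)
  then show ?thesis by (simp only: int_pow_int)
qed

lemma commutator_pow_trivial:
  "x \<in> carrier G \<Longrightarrow> y \<in> carrier G \<Longrightarrow> commutator G x y [^] (p ^ t) = \<one>"
  using derived_exponent commutator_in_derived by blast

lemma pow_hom: "group_hom G G (\<lambda>x. x [^] (p ^ r))"
proof -
  have "(x \<otimes> y) [^] (p ^ r) = x [^] (p ^ r) \<otimes> y [^] (p ^ r)" if "x \<in> carrier G" "y \<in> carrier G" for x y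
    using that commutator_pow_trivial t_le t_less prime
    by (intro prime_power_mult_distrib[of p t]) auto
  then show ?thesis
    unfolding group_hom_def group_hom_axioms_def hom_def using is_group by auto
qed

text \<open>The derived part of an element is a product of p^r-th powers of the generators and is
  absorbed into the exponents, since p^t divides p^r.\<close>

lemma carrier_subset_box:
  "carrier G \<subseteq> (\<lambda>(i, j, k). tri a b c i j k) `
    ({0..<int (p ^ (r + t))} \<times> {0..<int (p ^ (r + t))} \<times> {0..<int (p ^ (r + t))})"
    (is "_ \<subseteq> ?f ` ?B")
proof
  let ?m = "int (p ^ (r + t))"
  have mpos: "?m > 0" using p_gt_1 by simp
  fix g assume "g \<in> carrier G"
  then obtain i j k d where g: "d \<in> derived G (carrier G)" "g = tri a b c i j k \<otimes> d"
    by (rule carrier_decomposition[OF gt])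
  obtain i' j' k' where "d = tri A B C i' j' k'" using g(1) by (rule derived_tri_pow)
  then have "g = tri a b c i j k \<otimes> tri a b c (int (p ^ r) * i') (int (p ^ r) * j') (int (p ^ r) * k')"
    using g(2) by (simp only: tri_pow_arg gen_closed)
  also have "\<dots> = tri a b c (i + int (p ^ r) * i') (j + int (p ^ r) * j') (k + int (p ^ r) * k')"
    by (rule tri_mult_multiple[where m = "p ^ t"])
      (use gen_closed commutator_pow_trivial t_le in \<open>auto intro: le_imp_power_dvd\<close>)
  finally obtain i'' j'' k'' where "g = tri a b c i'' j'' k''" by blast
  moreover have "tri a b c (i'' mod ?m) (j'' mod ?m) (k'' mod ?m) = tri a b c i'' j'' k''"
    using rel unfolding pE_relations_hold_def by (intro tri_mod gen_closed) auto
  ultimately have "g = ?f (i'' mod ?m, j'' mod ?m, k'' mod ?m)" by simp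
  moreover have "(i'' mod ?m, j'' mod ?m, k'' mod ?m) \<in> ?B" using mpos by simp
  ultimately show "g \<in> ?f ` ?B" by blast
qed

lemma carrier_tri:
  assumes "x \<in> carrier G"
  obtains i j k where "x = tri a b c i j k"
  using subsetD[OF carrier_subset_box assms] by auto

lemma card_box:
  "card ({0..<int (p ^ (r + t))} \<times> {0..<int (p ^ (r + t))} \<times> {0..<int (p ^ (r + t))}) = p ^ (3 * (r + t))"
proof -
  have "3 * (r + t) = (r + t) + ((r + t) + (r + t))" by simp
  then show ?thesis by (simp only: power_add card_cartesian_product card_atLeastLessThan_int) (simp del: of_nat_power of_nat_mult)
qed

lemma finite_carrier: "finite (carrier G)"
  using carrier_subset_box by (rule finite_surj[rotated]) simp

lemma order_le: "order G \<le> p ^ (3 * (r + t))"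
  using surj_card_le[OF _ carrier_subset_box] card_box by (simp add: order_def)

context
  fixes S :: "int ^ 3 ^ 3"
  assumes order_eq: "order G = p ^ (3 * (r + t))"
    and inverse: "\<And>i j. [(S ** T) $ i $ j = mat 1 $ i $ j] (mod int (p ^ t))"
begin

text \<open>At the exact order the surjection from the box of residues onto G is a
  bijection.\<close>

lemma tri_cong:
  assumes "tri a b c i j k = tri a b c i' j' k'"
  shows "int (p ^ (r + t)) dvd i - i' \<and> int (p ^ (r + t)) dvd j - j' \<and> int (p ^ (r + t)) dvd k - k'"
proof -
  let ?m = "int (p ^ (r + t))"
  let ?B = "{0..<?m} \<times> {0..<?m} \<times> {0..<?m}" and ?f = "\<lambda>(i, j, k). tri a b c i j k"
  have mpos: "?m > 0" using p_gt_1 by simp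
  have "card ?B \<le> card (?f ` ?B)"
    using card_mono[OF _ carrier_subset_box] order_eq card_box by (simp add: order_def del: of_nat_power)
  then have "card (?f ` ?B) = card ?B" using card_image_le[of ?B ?f] by simp
  then have inj: "inj_on ?f ?B" by (simp add: eq_card_imp_inj_on)
  have tmod: "tri a b c (i mod ?m) (j mod ?m) (k mod ?m) = tri a b c i j k" for i j k
    using rel unfolding pE_relations_hold_def by (intro tri_mod gen_closed) auto
  have "?f (i mod ?m, j mod ?m, k mod ?m) = ?f (i' mod ?m, j' mod ?m, k' mod ?m)"
    using assms tmod by simp
  then have "(i mod ?m, j mod ?m, k mod ?m) = (i' mod ?m, j' mod ?m, k' mod ?m)"
    by (rule inj_onD[OF inj]) (use mpos in simp_all)
  then show ?thesis by (simp add: mod_eq_dvd_iff)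
qed

text \<open>Here invertibility enters: multiplying the commutator relations by S modulo p^t yields
  the p^r-th powers of the generators as products of commutators. The power map, a homomorphism,
  extends this to all elements.\<close>

lemma pow_in_derived:
  assumes "x \<in> carrier G"
  shows "x [^] (p ^ r) \<in> derived G (carrier G)"
proof -
  let ?t = "tri (commutator G a b) (commutator G a c) (commutator G b c)"
  have S: "?t i j k \<in> derived G (carrier G)" for i j k
    using gen_closed commutator_in_derived by (intro tri_in_subgroup[OF subgroup_derived]) auto
  have row: "?t (S $ i $ 1) (S $ i $ 2) (S $ i $ 3) = tri A B C (mat 1 $ i $ 1) (mat 1 $ i $ 2) (mat 1 $ i $ 3)" for i
  proof -
    let ?m = "int (p ^ t)" and ?M = "mat 1 :: int ^ 3 ^ 3"
    have tmod: "tri A B C (i mod ?m) (j mod ?m) (k mod ?m) = tri A B C i j k" for i j k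
      using ABC_pow gen_closed by (intro tri_mod) auto
    have "?t (S $ i $ 1) (S $ i $ 2) (S $ i $ 3)
        = tri A B C ((S ** T) $ i $ 1) ((S ** T) $ i $ 2) ((S ** T) $ i $ 3)"
      unfolding generator_commutators tri_tri[OF gen_pow_r_central]
      by (simp add: matrix_matrix_mult_def sum_3)
    also have "\<dots> = tri A B C ((S ** T) $ i $ 1 mod ?m) ((S ** T) $ i $ 2 mod ?m) ((S ** T) $ i $ 3 mod ?m)"
      by (simp only: tmod)
    also have "\<dots> = tri A B C (?M $ i $ 1 mod ?m) (?M $ i $ 2 mod ?m) (?M $ i $ 3 mod ?m)"
      using inverse[of i 1] inverse[of i 2] inverse[of i 3] by (simp only: cong_def)
    finally show ?thesis by (simp only: tmod)
  qed
  have ABC: "A \<in> derived G (carrier G)" "B \<in> derived G (carrier G)" "C \<in> derived G (carrier G)"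
    using row[of 1] row[of 2] row[of 3] S tri_unit[of A B C] gen_closed by (simp_all add: mat_def) metis+
  obtain i j k where x: "x = tri a b c i j k" using assms by (rule carrier_tri)
  have "x [^] (p ^ r) = tri A B C i j k"
    unfolding x by (rule group_hom.hom_tri[OF pow_hom gen_closed])
  then show ?thesis using tri_in_subgroup[OF subgroup_derived ABC] by simp
qed

text \<open>For minimality: if a^m lies in G', it is a product of p^r-th powers of the generators,
  and uniqueness of the exponent of a gives p^r | m.\<close>

lemma derived_quotient_exponent: "group_exponent (G Mod derived G (carrier G)) = p ^ r"
proof (rule group_exponent_eqI)
  show "p ^ r > 0" using p_gt_1 by simp
  show "q [^]\<^bsub>G Mod derived G (carrier G)\<^esub> (p ^ r) = \<one>\<^bsub>G Mod derived G (carrier G)\<^esub>"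
    if "q \<in> carrier (G Mod derived G (carrier G))" for q
    using derived_quotient_pow_eq_one[of "p ^ r"] pow_in_derived that by blast
  show "p ^ r \<le> m" if "m > 0" "\<And>q. q \<in> carrier (G Mod derived G (carrier G)) \<Longrightarrow>
      q [^]\<^bsub>G Mod derived G (carrier G)\<^esub> m = \<one>\<^bsub>G Mod derived G (carrier G)\<^esub>" for m
  proof -
    have "a [^] m \<in> derived G (carrier G)"
      using derived_quotient_pow_eq_one[of m] that(2) gen_closed(1) by blast
    then obtain i j k where "a [^] m = tri A B C i j k" by (rule derived_tri_pow)
    then have "tri a b c (int m) 0 0 = tri a b c (int (p ^ r) * i) (int (p ^ r) * j) (int (p ^ r) * k)"
      using gen_closed by (simp only: tri_pow_arg) (simp add: tri_def int_pow_int)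
    then have "int (p ^ (r + t)) dvd int m - int (p ^ r) * i" using tri_cong by blast
    then have "int (p ^ r) dvd int m - int (p ^ r) * i"
      by (rule dvd_trans[rotated]) (simp add: le_imp_power_dvd)
    then have "int (p ^ r) dvd int m - int (p ^ r) * i + int (p ^ r) * i"
      by (intro dvd_add) auto
    then have "p ^ r dvd m" by (simp only: diff_add_cancel of_nat_dvd_iff)
    then show ?thesis using \<open>m > 0\<close> dvd_imp_le by blast
  qed
qed

text \<open>Uniqueness makes p^(r+t) divide p^r i, p^r j and p^r k. So x is a product of powers of
  the p^t-th powers of the generators, which are central by the relations.\<close>

lemma torsion_central:
  assumes x: "x \<in> carrier G" "x [^] (p ^ r) = \<one>"
  shows "x \<in> group_center G"
proof -
  obtain i j k where ijk: "x = tri a b c i j k" using x(1) by (rule carrier_tri)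
  have "tri A B C i j k = \<one>"
    using x(2) group_hom.hom_tri[OF pow_hom gen_closed, of i j k] unfolding ijk by simp
  then have "tri a b c (int (p ^ r) * i) (int (p ^ r) * j) (int (p ^ r) * k) = tri a b c 0 0 0"
    using gen_closed by (simp only: tri_pow_arg tri_unit)
  from tri_cong[OF this] have "int (p ^ t) dvd i" "int (p ^ t) dvd j" "int (p ^ t) dvd k"
    using p_gt_1 by (simp_all add: power_add)
  then obtain i' j' k' where "i = int (p ^ t) * i'" "j = int (p ^ t) * j'" "k = int (p ^ t) * k'"
    by (auto elim!: dvdE)
  then have "x = tri (a [^] (p ^ t)) (b [^] (p ^ t)) (c [^] (p ^ t)) i' j' k'"
    unfolding ijk tri_pow_arg[OF gen_closed] by simp
  then show ?thesis using tri_in_subgroup[OF subgroup_center gen_pow_t_central] by simp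
qed

lemma pE_group: "pE_group p G"
proof -
  have "Omega p r G \<subseteq> group_center G"
    unfolding Omega_def using torsion_central
    by (intro generate_subgroup_incl subgroup_center) auto
  then show ?thesis
    unfolding pE_group_def finite_p_group_def
    using is_group finite_carrier order_eq two_Engel derived_quotient_exponent by blast
qed

end

end

section \<open>Free groups and presentations\<close>

context group begin

definition eval_word :: "('c \<Rightarrow> 'a) \<Rightarrow> 'c word \<Rightarrow> 'a" where
  "eval_word f w = foldr (\<lambda>(x, s) g. (if s then f x else inv (f x)) \<otimes> g) w \<one>"

context
  fixes f :: "'c \<Rightarrow> 'a"
  assumes f: "\<And>x. f x \<in> carrier G"
begin

lemma eval_word_closed [simp]: "eval_word f w \<in> carrier G"
  by (induction w) (auto simp: eval_word_def f)

lemma eval_word_append: "eval_word f (u @ v) = eval_word f u \<otimes> eval_word f v"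
proof (induction u)
  case Nil
  then show ?case using eval_word_closed[of v] by (simp add: eval_word_def)
next
  case (Cons x u)
  then show ?case using eval_word_closed[of u] eval_word_closed[of v] f
    by (cases x) (simp add: eval_word_def m_assoc)
qed

lemma eval_word_cong: "word_eq u v \<Longrightarrow> eval_word f u = eval_word f v"
proof (induction rule: word_eq.induct)
  case (cancel u a b v)
  have "eval_word f ((a, b) # (a, \<not> b) # v) = eval_word f v"
    using f eval_word_closed[of v] by (simp add: eval_word_def)
  then show ?case by (simp add: eval_word_append)
qed simp_all

text \<open>A class is evaluated at a chosen representative; \<open>eval_word_cong\<close> makes the
  choice irrelevant.\<close>

definition free_hom :: "'c word set \<Rightarrow> 'a" where
  "free_hom A = eval_word f (SOME w. w \<in> A)"

lemma free_hom_word_class: "free_hom (word_class w) = eval_word f w"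
proof -
  have "w \<in> word_class w" by (simp add: word_class_def word_eq.refl)
  then have "(SOME v. v \<in> word_class w) \<in> word_class w" by (rule someI)
  then show ?thesis using eval_word_cong by (simp add: free_hom_def word_class_def)
qed

lemma free_hom_group_hom: "group_hom free_group G free_hom"
proof -
  have "free_hom \<in> hom free_group G"
  proof (rule homI)
    show "free_hom A \<in> carrier G" if "A \<in> carrier free_group" for A
      by (simp add: free_hom_def)
    show "free_hom (A \<otimes>\<^bsub>free_group\<^esub> B) = free_hom A \<otimes> free_hom B"
      if AB: "A \<in> carrier free_group" "B \<in> carrier free_group" for A B
    proof -
      obtain u v where "A = word_class u" "B = word_class v"
        using AB by (auto simp: free_group_def)
      then show ?thesis by (simp only: free_group_mult free_hom_word_class eval_word_append)
    qed
  qed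
  then show ?thesis
    using group_free_group is_group by (simp add: group_hom_def group_hom_axioms_def)
qed

lemma free_hom_gen: "free_hom (free_gen x) = f x"
  unfolding free_gen_def free_hom_word_class using f by (simp add: eval_word_def)

end

lemma normal_closure_normal:
  assumes "S \<subseteq> carrier G"
  shows "normal_closure G S \<lhd> G"
  unfolding normal_closure_def
proof (rule normal_generateI)
  let ?K = "{g \<otimes> s \<otimes> inv g | g s. g \<in> carrier G \<and> s \<in> S}"
  show "?K \<subseteq> carrier G" using assms by auto
  fix h g assume "h \<in> ?K" and g: "g \<in> carrier G"
  then obtain k s where ks: "h = k \<otimes> s \<otimes> inv k" "k \<in> carrier G" "s \<in> S" by blast
  then have "g \<otimes> h \<otimes> inv g = (g \<otimes> k) \<otimes> s \<otimes> inv (g \<otimes> k)"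
    using g subsetD[OF assms ks(3)] by (simp add: m_assoc inv_mult_group)
  then show "g \<otimes> h \<otimes> inv g \<in> ?K" using ks g by blast
qed

lemma normal_closure_incl:
  assumes "S \<subseteq> carrier G" "s \<in> S"
  shows "s \<in> normal_closure G S"
proof -
  have "s = \<one> \<otimes> s \<otimes> inv \<one>" using assms by auto
  then show ?thesis
    unfolding normal_closure_def using assms by (intro generate.incl) blast
qed

lemma normal_closure_subset:
  assumes "N \<lhd> G" "S \<subseteq> N"
  shows "normal_closure G S \<subseteq> N"
  unfolding normal_closure_def
  by (rule generate_subgroup_incl[OF _ normal_imp_subgroup[OF assms(1)]])
    (use assms normal_inv_iff[of N] in blast)

end

lemma word_class_closed [simp]: "word_class w \<in> carrier free_group"
  by (simp add: free_group_def)

lemma free_gen_closed [simp]: "free_gen x \<in> carrier free_group"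
  by (simp add: free_gen_def)

lemma generate_free_gen: "generate free_group (range free_gen) = carrier (free_group :: 'a word set monoid)"
proof
  interpret F: group "free_group :: 'a word set monoid" by (rule group_free_group)
  show "generate free_group (range free_gen) \<subseteq> carrier (free_group :: 'a word set monoid)"
    by (rule F.generate_incl) auto
  have letter: "word_class [(x, s)] \<in> generate free_group (range free_gen)" for x :: 'a and s
  proof (cases s)
    case True
    then show ?thesis by (auto simp: free_gen_def intro: generate.incl)
  next
    case False
    have "word_class [(x, False)] \<otimes>\<^bsub>free_group\<^esub> free_gen x = \<one>\<^bsub>free_group\<^esub>"
      using word_eq.cancel[of "[]" x False "[]"]
      by (simp add: free_gen_def free_group_mult word_class_eq_iff) (simp add: free_group_def word_class_eq_iff)
    then have "word_class [(x, False)] = inv\<^bsub>free_group\<^esub> free_gen x"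
      by (intro F.inv_equality [symmetric]) simp_all
    then show ?thesis using False by (auto intro: generate.inv)
  qed
  have "word_class w \<in> generate free_group (range free_gen)" for w :: "'a word"
  proof (induction w)
    case Nil
    then show ?case using generate.one[of free_group "range free_gen"] by (simp add: free_group_def)
  next
    case (Cons x w)
    then show ?case
      using generate.eng[OF letter[of "fst x" "snd x"] Cons] by (simp add: free_group_mult)
  qed
  then show "carrier (free_group :: 'a word set monoid) \<subseteq> generate free_group (range free_gen)"
    by (auto simp: free_group_def)
qed

section \<open>Presented groups and their homomorphisms\<close>

definition relators :: "('a word set \<times> 'a word set) set \<Rightarrow> 'a word set set" where
  "relators R = {u \<otimes>\<^bsub>free_group\<^esub> inv\<^bsub>free_group\<^esub> v | u v. (u, v) \<in> R}"

definition presented_map :: "('a word set \<times> 'a word set) set \<Rightarrow> 'a word set \<Rightarrow> 'a word set set" where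
  "presented_map R u = normal_closure free_group (relators R) #>\<^bsub>free_group\<^esub> u"

context
  fixes R :: "('a word set \<times> 'a word set) set"
  assumes R: "R \<subseteq> carrier free_group \<times> carrier free_group"
begin

interpretation F: group "free_group :: 'a word set monoid" by (rule group_free_group)

lemma relators_closed: "relators R \<subseteq> carrier free_group"
  using R by (auto simp: relators_def)

lemma presented_map_group_hom: "group_hom free_group (presented_group R) (presented_map R)"
proof -
  note N = F.normal_closure_normal[OF relators_closed]
  have "presented_group R = free_group Mod normal_closure free_group (relators R)"
    by (simp add: presented_group_def relators_def)
  then show ?thesis
    using normal.factorgroup_is_group[OF N] normal.r_coset_hom_Mod[OF N] group_free_group
    by (simp add: group_hom_def group_hom_axioms_def presented_map_def[abs_def])
qed

lemma carrier_presented_group: "carrier (presented_group R) = presented_map R ` carrier free_group"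
  unfolding presented_group_def relators_def [symmetric] carrier_FactGroup presented_map_def ..

lemma presented_map_relation:
  assumes uv: "(u, v) \<in> R"
  shows "presented_map R u = presented_map R v"
proof -
  interpret q: group_hom free_group "presented_group R" "presented_map R"
    by (rule presented_map_group_hom)
  have c: "u \<in> carrier free_group" "v \<in> carrier free_group" using R uv by auto
  have "u \<otimes>\<^bsub>free_group\<^esub> inv\<^bsub>free_group\<^esub> v \<in> normal_closure free_group (relators R)"
    by (rule F.normal_closure_incl[OF relators_closed]) (use uv in \<open>auto simp: relators_def\<close>)
  then have "presented_map R (u \<otimes>\<^bsub>free_group\<^esub> inv\<^bsub>free_group\<^esub> v) = \<one>\<^bsub>presented_group R\<^esub>"
    using F.normal_closure_normal[OF relators_closed] c
    unfolding presented_map_def presented_group_def relators_def [symmetric]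
    by (simp add: F.coset_join2 normal_imp_subgroup)
  then have "presented_map R u \<otimes>\<^bsub>presented_group R\<^esub> inv\<^bsub>presented_group R\<^esub> presented_map R v
      = \<one>\<^bsub>presented_group R\<^esub>"
    using c by simp
  then show ?thesis
    using c by (metis q.H.inv_equality q.H.inv_inv q.H.inv_closed q.hom_closed)
qed

lemma generate_presented_group:
  "generate (presented_group R) (range (\<lambda>x. presented_map R (free_gen x))) = carrier (presented_group R)"
proof -
  interpret q: group_hom free_group "presented_group R" "presented_map R"
    by (rule presented_map_group_hom)
  have "generate (presented_group R) (presented_map R ` range free_gen)
      = presented_map R ` generate free_group (range free_gen)"
    by (rule q.generate_img) auto
  then show ?thesis
    by (simp add: generate_free_gen carrier_presented_group image_image)
qed

text \<open>The kernel of h is normal and contains the relators, hence also their normal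
  closure.\<close>

lemma von_Dyck:
  fixes H (structure)
  assumes h: "group_hom free_group H h" and rel: "\<And>u v. (u, v) \<in> R \<Longrightarrow> h u = h v"
  obtains g where "g \<in> hom (presented_group R) H"
    "\<And>u. u \<in> carrier free_group \<Longrightarrow> g (presented_map R u) = h u"
proof -
  interpret h: group_hom free_group H h by (rule h)
  have "relators R \<subseteq> kernel free_group H h"
  proof
    fix s assume "s \<in> relators R"
    then obtain u v where uv: "(u, v) \<in> R" "s = u \<otimes>\<^bsub>free_group\<^esub> inv\<^bsub>free_group\<^esub> v"
      by (auto simp: relators_def)
    have "u \<in> carrier free_group" "v \<in> carrier free_group" using R uv by auto
    then show "s \<in> kernel free_group H h" using rel[OF uv(1)] uv(2) by (simp add: kernel_def)
  qed
  then have "normal_closure free_group (relators R) \<subseteq> kernel free_group H h"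
    by (rule F.normal_closure_subset[OF h.normal_kernel])
  from h.FactGroup_universal_kernel[OF F.normal_closure_normal[OF relators_closed] this]
  obtain g where "g \<in> hom (free_group Mod normal_closure free_group (relators R)) H"
    "\<And>x. x \<in> carrier free_group \<Longrightarrow> g (normal_closure free_group (relators R) #>\<^bsub>free_group\<^esub> x) = h x"
    by blast
  then show ?thesis
    using that unfolding presented_group_def relators_def [symmetric] presented_map_def by blast
qed

end

lemma pE_relations_closed: "pE_relations p r t T \<subseteq> carrier free_group \<times> carrier free_group"
proof -
  interpret F: group "free_group :: gen3 word set monoid" by (rule group_free_group)
  show ?thesis by (auto simp: pE_relations_def Let_def)
qed

text \<open>All twelve relations are built from products, powers and commutators, which h preserves.
  One direction serves the quotient map of the presentation, the other the homomorphism that sends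
  the free generators to given elements.\<close>

lemma pE_relations_hom_iff:
  assumes h: "group_hom free_group H h"
  shows "(\<forall>(u, v)\<in>pE_relations p r t T. h u = h v)
    \<longleftrightarrow> group.pE_relations_hold H p r t T (h (free_gen Gx)) (h (free_gen Gy)) (h (free_gen Gz))"
proof -
  interpret h: group_hom "free_group :: gen3 word set monoid" H h by (rule h)
  show ?thesis
    unfolding pE_relations_def Let_def h.H.pE_relations_hold_def
    by (simp add: h.H.tri_def h.hom_commutator h.hom_nat_pow h.hom_int_pow del: of_nat_power)
qed

lemma range_gen3: "range f = {f Gx, f Gy, f Gz}"
proof
  show "range f \<subseteq> {f Gx, f Gy, f Gz}"
  proof
    fix y assume "y \<in> range f"
    then obtain x where "y = f x" by blast
    then show "y \<in> {f Gx, f Gy, f Gz}" by (cases x) auto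
  qed
qed auto

definition pE_gen :: "nat \<Rightarrow> nat \<Rightarrow> nat \<Rightarrow> int ^ 3 ^ 3 \<Rightarrow> gen3 \<Rightarrow> gen3 word set set" where
  "pE_gen p r t T x = presented_map (pE_relations p r t T) (free_gen x)"

lemma pE_presented_presented_group:
  assumes "Factorial_Ring.prime p" "1 \<le> t" "t \<le> r" "p = 2 \<Longrightarrow> t < r"
  shows "pE_presented (presented_group (pE_relations p r t T)) p r t T
    (pE_gen p r t T Gx) (pE_gen p r t T Gy) (pE_gen p r t T Gz)"
proof -
  let ?R = "pE_relations p r t T"
  note cl = pE_relations_closed[of p r t T]
  interpret q: group_hom free_group "presented_group ?R" "presented_map ?R"
    by (rule presented_map_group_hom[OF cl])
  have "range (\<lambda>x. presented_map ?R (free_gen x)) = {pE_gen p r t T Gx, pE_gen p r t T Gy, pE_gen p r t T Gz}"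
    unfolding pE_gen_def by (rule range_gen3)
  then have gen: "generate (presented_group ?R) {pE_gen p r t T Gx, pE_gen p r t T Gy, pE_gen p r t T Gz}
      = carrier (presented_group ?R)"
    using generate_presented_group[OF cl] by simp
  have rel: "group.pE_relations_hold (presented_group ?R) p r t T
      (pE_gen p r t T Gx) (pE_gen p r t T Gy) (pE_gen p r t T Gz)"
    unfolding pE_gen_def pE_relations_hom_iff[OF q.group_hom_axioms, symmetric]
    using presented_map_relation[OF cl] by blast
  show ?thesis
    using assms gen rel by unfold_locales (auto simp: pE_gen_def)
qed

lemma pE_von_Dyck:
  fixes H (structure)
  assumes H: "group H" and abc: "a \<in> carrier H" "b \<in> carrier H" "c \<in> carrier H"
    and gen: "generate H {a, b, c} = carrier H"
    and rel: "group.pE_relations_hold H p r t T a b c"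
  obtains g where "group_hom (presented_group (pE_relations p r t T)) H g"
    "g ` carrier (presented_group (pE_relations p r t T)) = carrier H"
proof -
  interpret H: group H by (rule H)
  let ?R = "pE_relations p r t T"
  note cl = pE_relations_closed[of p r t T]
  define f where "f = (\<lambda>x. case x of Gx \<Rightarrow> a | Gy \<Rightarrow> b | Gz \<Rightarrow> c)"
  have f: "f x \<in> carrier H" for x using abc by (cases x) (simp_all add: f_def)
  let ?h = "H.free_hom f"
  interpret h: group_hom free_group H ?h by (rule H.free_hom_group_hom[OF f])
  interpret q: group_hom free_group "presented_group ?R" "presented_map ?R"
    by (rule presented_map_group_hom[OF cl])
  have hg: "?h (free_gen x) = f x" for x by (rule H.free_hom_gen[OF f])
  have "\<forall>(u, v)\<in>?R. ?h u = ?h v"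
    unfolding pE_relations_hom_iff[OF h.group_hom_axioms] hg using rel by (simp add: f_def)
  then obtain g where g: "g \<in> hom (presented_group ?R) H"
    "\<And>u. u \<in> carrier free_group \<Longrightarrow> g (presented_map ?R u) = ?h u"
    using von_Dyck[OF cl h.group_hom_axioms] by blast
  have "?h ` range free_gen = range (\<lambda>x. ?h (free_gen x))" by (simp only: image_image)
  also have "\<dots> = {?h (free_gen Gx), ?h (free_gen Gy), ?h (free_gen Gz)}" by (rule range_gen3)
  also have "\<dots> = {f Gx, f Gy, f Gz}" by (simp only: hg)
  finally have "?h ` range free_gen = {a, b, c}" by (simp add: f_def)
  then have "?h ` carrier free_group = carrier H"
    using h.generate_img[of "range free_gen"] gen by (simp add: generate_free_gen image_subset_iff)
  moreover have "g ` carrier (presented_group ?R) = ?h ` carrier free_group"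
    unfolding carrier_presented_group[OF cl] image_image using g(2) by (intro image_cong) simp_all
  moreover have "group_hom (presented_group ?R) H g"
    using g(1) q.H.group_axioms H by (simp add: group_hom_def group_hom_axioms_def)
  ultimately show ?thesis using that by simp
qed

text \<open>The model is the set of triples modulo \<open>n\<close> with the product \<open>v + w + q \<beta>(v, w)\<close>, where the
  bilinear map \<open>\<beta>\<close> has the rows of \<open>T\<close> as its values on \<open>(e\<^sub>1, e\<^sub>2)\<close>, \<open>(e\<^sub>1, e\<^sub>3)\<close>, \<open>(e\<^sub>2, e\<^sub>3)\<close> and vanishes on
  the other pairs of basis vectors. It is associative because \<open>n\<close> divides \<open>q\<^sup>2\<close>.\<close>

section \<open>A model of the presented group\<close>

lemma (in group) int_pow_eqI:
  assumes closed: "\<And>i. e i \<in> carrier G" and add: "\<And>i j. e i \<otimes> e j = e (i + j :: int)"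
  shows "e 1 [^] (i::int) = e i"
proof -
  have zero: "e 0 = \<one>" using add[of 0 0] closed[of 0] by simp
  have nat: "e 1 [^] m = e (int m)" for m :: nat
    by (induction m) (simp_all add: zero add add.commute)
  have neg: "inv (e m) = e (- m)" for m
    using add[of "- m" m] zero closed by (intro inv_equality) auto
  show ?thesis
    by (cases i rule: int_cases2) (simp_all add: int_pow_int nat int_pow_neg closed neg)
qed

lemma (in group) commutator_eqI:
  assumes "x \<in> carrier G" "y \<in> carrier G" "z \<in> carrier G" "x \<otimes> y = y \<otimes> x \<otimes> z"
  shows "commutator G x y = z"
proof -
  have "commutator G x y = inv (y \<otimes> x) \<otimes> (x \<otimes> y)"
    using assms by (simp add: commutator_def m_assoc inv_mult_group)
  then show ?thesis using assms by (simp add: m_assoc inv_mult_group)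
qed

text \<open>Used with n = p^(r+t) and q = p^r, where n | q^2 is the inequality t <= r.\<close>

locale triple_model =
  fixes n q :: int and T :: "int ^ 3 ^ 3"
  assumes n_gt_1: "n > 1" and n_dvd: "n dvd q * q"
begin

text \<open>The orientation matters: e1 e2 carries q times the first row of T while e2 e1 carries no
  twist, in accordance with gh = hg[g,h].\<close>

definition raw :: "int \<times> int \<times> int \<Rightarrow> int \<times> int \<times> int \<Rightarrow> int \<times> int \<times> int" where
  "raw = (\<lambda>(a, b, c) (a', b', c').
    (a + a' + q * (a * b' * T $ 1 $ 1 + a * c' * T $ 2 $ 1 + b * c' * T $ 3 $ 1),
     b + b' + q * (a * b' * T $ 1 $ 2 + a * c' * T $ 2 $ 2 + b * c' * T $ 3 $ 2),
     c + c' + q * (a * b' * T $ 1 $ 3 + a * c' * T $ 2 $ 3 + b * c' * T $ 3 $ 3)))"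

definition red :: "int \<times> int \<times> int \<Rightarrow> int \<times> int \<times> int" where
  "red = (\<lambda>(a, b, c). (a mod n, b mod n, c mod n))"

definition M :: "(int \<times> int \<times> int) monoid" where
  "M = \<lparr>carrier = {0..<n} \<times> {0..<n} \<times> {0..<n}, monoid.mult = (\<lambda>v w. red (raw v w)), one = (0, 0, 0)\<rparr>"

lemma red_closed [simp]: "red v \<in> carrier M"
  using n_gt_1 by (cases v) (simp add: red_def M_def)

lemma red_id: "v \<in> carrier M \<Longrightarrow> red v = v"
  by (cases v) (auto simp: red_def M_def)

lemma red_eq_iff: "red (a, b, c) = red (a', b', c') \<longleftrightarrow> n dvd a - a' \<and> n dvd b - b' \<and> n dvd c - c'"
  by (simp add: red_def mod_eq_dvd_iff)

lemma red_raw: "red (raw (red v) (red w)) = red (raw v w)"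
  unfolding raw_def red_def
  by (cases v; cases w; simp; fold cong_def)
    (intro conjI cong_add cong_mult cong_refl; simp add: cong_def)

lemma mult_red: "red v \<otimes>\<^bsub>M\<^esub> red w = red (raw v w)"
  by (simp add: M_def red_raw)

lemma one_red: "\<one>\<^bsub>M\<^esub> = red (0, 0, 0)"
  by (simp add: M_def red_def)

text \<open>Substituting one product into another leaves an error divisible by q^2; each witness
  \<open>z\<close> below is the quotient of such an error by q^2.\<close>

lemma sq_dvd: "x - y = q * q * z \<Longrightarrow> n dvd x - y"
  using n_dvd by simp

text \<open>Both bracketings are the sum of the three vectors plus q times beta over the three
  pairs. The \<open>m1\<close> to \<open>m4\<close> are values of beta that occur inside a further
  argument of beta and so carry the factor q twice.\<close>

lemma assoc_component:
  "n dvd (x + y + q * (a * e * s1 + a * f * s2 + b * f * s3) + z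
      + q * ((a + d + q * m1) * h * s1 + (a + d + q * m1) * k * s2 + (b + e + q * m2) * k * s3))
    - (x + (y + z + q * (d * h * s1 + d * k * s2 + e * k * s3))
      + q * (a * (e + h + q * m3) * s1 + a * (f + k + q * m4) * s2 + b * (f + k + q * m4) * s3))"
  by (rule sq_dvd[where z = "m1 * h * s1 + m1 * k * s2 + m2 * k * s3 - a * m3 * s1 - a * m4 * s2 - b * m4 * s3"])
    (simp add: algebra_simps)

lemma raw_assoc: "red (raw (raw u v) w) = red (raw u (raw v w))"
proof -
  obtain a b c where u: "u = (a, b, c)" by (cases u)
  obtain d e f where v: "v = (d, e, f)" by (cases v)
  obtain g h k where w: "w = (g, h, k)" by (cases w)
  show ?thesis
    unfolding u v w raw_def prod.case red_eq_iff by (intro conjI assoc_component)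
qed

lemma inverse_component:
  "n dvd (- x + q * (a * b * s1 + a * c * s2 + b * c * s3) + x
      + q * ((- a + q * m1) * b * s1 + (- a + q * m1) * c * s2 + (- b + q * m2) * c * s3)) - 0"
  by (rule sq_dvd[where z = "m1 * b * s1 + m1 * c * s2 + m2 * c * s3"]) (simp add: algebra_simps)

lemma group_M: "group M"
proof (rule groupI)
  show "\<one>\<^bsub>M\<^esub> \<in> carrier M" by (simp add: one_red)
  show "x \<otimes>\<^bsub>M\<^esub> y \<in> carrier M" if "x \<in> carrier M" "y \<in> carrier M" for x y
  proof -
    have "x \<otimes>\<^bsub>M\<^esub> y = red (raw x y)" by (simp add: M_def)
    then show ?thesis by simp
  qed
  show "x \<otimes>\<^bsub>M\<^esub> y \<otimes>\<^bsub>M\<^esub> z = x \<otimes>\<^bsub>M\<^esub> (y \<otimes>\<^bsub>M\<^esub> z)" if "x \<in> carrier M" "y \<in> carrier M" "z \<in> carrier M" for x y z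
  proof -
    have "red x \<otimes>\<^bsub>M\<^esub> red y \<otimes>\<^bsub>M\<^esub> red z = red x \<otimes>\<^bsub>M\<^esub> (red y \<otimes>\<^bsub>M\<^esub> red z)"
      by (simp add: mult_red raw_assoc)
    then show ?thesis using that by (simp add: red_id)
  qed
  show "\<one>\<^bsub>M\<^esub> \<otimes>\<^bsub>M\<^esub> x = x" if "x \<in> carrier M" for x
  proof -
    have "red (0, 0, 0) \<otimes>\<^bsub>M\<^esub> red x = red x"
      unfolding mult_red by (cases x) (simp add: raw_def)
    then show ?thesis using that by (simp add: red_id one_red)
  qed
  show "\<exists>y\<in>carrier M. y \<otimes>\<^bsub>M\<^esub> x = \<one>\<^bsub>M\<^esub>" if "x \<in> carrier M" for x
  proof -
    obtain a b c where x: "x = (a, b, c)" by (cases x)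
    let ?b = "\<lambda>j. a * b * T $ 1 $ j + a * c * T $ 2 $ j + b * c * T $ 3 $ j"
    \<comment> \<open>Bilinearity gives beta(-v, v) = - beta(v, v), so -v + q beta(v, v) inverts v
      up to multiples of q^2.\<close>
    have "red (- a + q * ?b 1, - b + q * ?b 2, - c + q * ?b 3) \<otimes>\<^bsub>M\<^esub> red (a, b, c) = \<one>\<^bsub>M\<^esub>"
      unfolding mult_red one_red raw_def prod.case red_eq_iff
      by (intro conjI inverse_component)
    then show ?thesis using that red_id x by (metis red_closed)
  qed
qed

interpretation M: group M by (rule group_M)

abbreviation "e1 \<equiv> red (1, 0, 0)"
abbreviation "e2 \<equiv> red (0, 1, 0)"
abbreviation "e3 \<equiv> red (0, 0, 1)"

text \<open>beta vanishes on multiples of the same basis vector, so these add without twist.\<close>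

lemma basis_int_pow:
  "e1 [^]\<^bsub>M\<^esub> (i::int) = red (i, 0, 0)" "e2 [^]\<^bsub>M\<^esub> (i::int) = red (0, i, 0)"
  "e3 [^]\<^bsub>M\<^esub> (i::int) = red (0, 0, i)"
  using M.int_pow_eqI[of "\<lambda>i. red (i, 0, 0)" i] M.int_pow_eqI[of "\<lambda>i. red (0, i, 0)" i]
    M.int_pow_eqI[of "\<lambda>i. red (0, 0, i)" i]
  by (simp_all add: mult_red raw_def)

lemma basis_nat_pow:
  "e1 [^]\<^bsub>M\<^esub> (m::nat) = red (int m, 0, 0)" "e2 [^]\<^bsub>M\<^esub> (m::nat) = red (0, int m, 0)"
  "e3 [^]\<^bsub>M\<^esub> (m::nat) = red (0, 0, int m)"
  using basis_int_pow[of "int m"] unfolding int_pow_int by auto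

lemma tri_component:
  "n dvd (x + q * (i * j * s) + y + q * ((i + q * (i * j * m1)) * k * s2 + (j + q * (i * j * m2)) * k * s3))
    - (x + y + q * (i * j * s + i * k * s2 + j * k * s3))"
  by (rule sq_dvd[where z = "i * j * m1 * k * s2 + i * j * m2 * k * s3"]) (simp add: algebra_simps)

text \<open>For v = (i, j, k) the result is v + q beta(v, v), up to multiples of q^2.\<close>

lemma tri_basis:
  "M.tri e1 e2 e3 i j k = red
    (i + q * (i * j * T $ 1 $ 1 + i * k * T $ 2 $ 1 + j * k * T $ 3 $ 1),
     j + q * (i * j * T $ 1 $ 2 + i * k * T $ 2 $ 2 + j * k * T $ 3 $ 2),
     k + q * (i * j * T $ 1 $ 3 + i * k * T $ 2 $ 3 + j * k * T $ 3 $ 3))"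
proof -
  have "M.tri e1 e2 e3 i j k = red (raw (raw (i, 0, 0) (0, j, 0)) (0, 0, k))"
    by (simp add: M.tri_def basis_int_pow mult_red)
  then show ?thesis
    using tri_component[of i i j "T $ 1 $ 1" 0 "T $ 1 $ 1" k "T $ 2 $ 1" "T $ 1 $ 2" "T $ 3 $ 1"]
      tri_component[of j i j "T $ 1 $ 2" 0 "T $ 1 $ 1" k "T $ 2 $ 2" "T $ 1 $ 2" "T $ 3 $ 2"]
      tri_component[of 0 i j "T $ 1 $ 3" k "T $ 1 $ 1" k "T $ 2 $ 3" "T $ 1 $ 2" "T $ 3 $ 3"]
    by (simp add: raw_def red_eq_iff)
qed

text \<open>The twist is now q beta(qv, qv), a multiple of q^3.\<close>

lemma tri_basis_multiple: "M.tri e1 e2 e3 (q * i) (q * j) (q * k) = red (q * i, q * j, q * k)"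
proof -
  have "n dvd (q * x + q * (q * i * (q * j) * s1 + q * i * (q * k) * s2 + q * j * (q * k) * s3)) - q * x"
    for x s1 s2 s3
    by (rule sq_dvd[where z = "q * (i * j * s1 + i * k * s2 + j * k * s3)"]) (simp add: algebra_simps)
  then show ?thesis unfolding tri_basis red_eq_iff by blast
qed

lemma generate_basis: "generate M {e1, e2, e3} = carrier M"
proof
  show "generate M {e1, e2, e3} \<subseteq> carrier M" by (rule M.generate_incl) auto
  have sub: "subgroup (generate M {e1, e2, e3}) M" by (rule M.generate_is_subgroup) auto
  have tri: "M.tri e1 e2 e3 i j k \<in> generate M {e1, e2, e3}" for i j k
    by (rule M.tri_in_subgroup[OF sub]) (auto intro: generate.incl)
  show "carrier M \<subseteq> generate M {e1, e2, e3}"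
  proof
    fix v assume v: "v \<in> carrier M"
    obtain a b c where abc: "v = (a, b, c)" by (cases v)
    let ?g = "\<lambda>l. a * b * T $ 1 $ l + a * c * T $ 2 $ l + b * c * T $ 3 $ l"
    have dvd: "n dvd (x + q * x' + q * - x' + q * ((a + q * m1) * (q * m2) * s1
        + (a + q * m1) * (q * m3) * s2 + (b + q * m4) * (q * m3) * s3)) - x" for x x' m1 m2 m3 m4 s1 s2 s3
      by (rule sq_dvd[where z = "(a + q * m1) * m2 * s1 + (a + q * m1) * m3 * s2 + (b + q * m4) * m3 * s3"])
        (simp add: algebra_simps)
    \<comment> \<open>The product with exponents v overshoots v by q beta(v, v). The second factor
      subtracts this and, being divisible by q, creates no new twist modulo n.\<close>
    have "red (a, b, c) = M.tri e1 e2 e3 a b c \<otimes>\<^bsub>M\<^esub> M.tri e1 e2 e3 (q * - ?g 1) (q * - ?g 2) (q * - ?g 3)"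
      unfolding tri_basis_multiple
      unfolding tri_basis mult_red raw_def prod.case
      by (subst eq_commute) (unfold red_eq_iff, intro conjI dvd)
    then show "v \<in> generate M {e1, e2, e3}"
      using subgroup.m_closed[OF sub tri tri] red_id[OF v] unfolding abc by simp
  qed
qed

lemma order_M: "order M = nat n ^ 3"
  by (simp add: order_def M_def card_cartesian_product power3_eq_cube)

lemma basis_relations:
  assumes nq: "n = int (p ^ (r + t))" "q = int (p ^ r)"
  shows "M.pE_relations_hold p r t T e1 e2 e3"
proof -
  have n: "n = q * int (p ^ t)" unfolding nq by (simp add: power_add)
  have dvd: "n dvd q * (int (p ^ t) * x)" for x unfolding n by simp
  have comp: "n dvd x - (x + q * (u * (q * m1) * s1 + u * (q * m2) * s2 + v * (q * m2) * s3))"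
    for x u v m1 m2 s1 s2 s3
    by (rule sq_dvd[where z = "- (u * m1 * s1 + u * m2 * s2 + v * m2 * s3)"]) (simp add: algebra_simps)
  \<comment> \<open>Right multiplication by a vector divisible by q is plain addition. This writes
    e1 e2 as e2 e1 times a multiple of a row of T, the form that \<open>commutator_eqI\<close>
    expects.\<close>
  have absorb: "red (a + q * d, b + q * e, c + q * f) = red (a, b, c) \<otimes>\<^bsub>M\<^esub> red (q * d, q * e, q * f)"
    for a b c d e f
    unfolding mult_red raw_def prod.case red_eq_iff by (intro conjI comp)
  have comm: "commutator M e1 e2 = red (q * T $ 1 $ 1, q * T $ 1 $ 2, q * T $ 1 $ 3)"
    "commutator M e1 e3 = red (q * T $ 2 $ 1, q * T $ 2 $ 2, q * T $ 2 $ 3)"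
    "commutator M e2 e3 = red (q * T $ 3 $ 1, q * T $ 3 $ 2, q * T $ 3 $ 3)"
    using absorb[of 1 "T $ 1 $ 1" 1 "T $ 1 $ 2" 0 "T $ 1 $ 3"] absorb[of 1 "T $ 2 $ 1" 0 "T $ 2 $ 2" 1 "T $ 2 $ 3"]
      absorb[of 0 "T $ 3 $ 1" 1 "T $ 3 $ 2" 1 "T $ 3 $ 3"]
    by (auto intro!: M.commutator_eqI simp: mult_red[of "(1, 0, 0)"] mult_red[of "(0, 1, 0)"] mult_red[of "(0, 0, 1)"] raw_def)
  have commute: "commutator M (red v) (red w) = \<one>\<^bsub>M\<^esub> \<longleftrightarrow> red (raw v w) = red (raw w v)" for v w
    by (simp add: M.commutator_eq_one_iff mult_red)
  show ?thesis
    unfolding M.pE_relations_hold_def nq(2) [symmetric] tri_basis_multiple comm basis_nat_pow nq(1) [symmetric]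
    by (simp add: commute [unfolded one_red] raw_def red_eq_iff dvd one_red del: of_nat_power)
qed

end

section \<open>The presentation theorem\<close>

text \<open>The normal form bounds the order from above, and von Dyck's surjection onto the model
  bounds it from below.\<close>

lemma order_presented_group:
  assumes p: "Factorial_Ring.prime p" and t: "1 \<le> t" "t \<le> r" "p = 2 \<Longrightarrow> t < r"
  shows "order (presented_group (pE_relations p r t T)) = p ^ (3 * (r + t))"
proof -
  let ?P = "presented_group (pE_relations p r t T)"
  interpret P: pE_presented ?P p r t T "pE_gen p r t T Gx" "pE_gen p r t T Gy" "pE_gen p r t T Gz"
    by (rule pE_presented_presented_group[OF assms])
  have p1: "p > 1" using p prime_gt_1_nat by blast
  interpret M: triple_model "int (p ^ (r + t))" "int (p ^ r)" T
  proof
    show "int (p ^ (r + t)) > 1" using p1 t one_less_power[of p "r + t"] by simp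
    have "p ^ (r + t) dvd p ^ (r + r)" using t by (intro le_imp_power_dvd) simp
    then show "int (p ^ (r + t)) dvd int (p ^ r) * int (p ^ r)"
      by (simp only: power_add of_nat_mult [symmetric] of_nat_dvd_iff)
  qed
  obtain g where g: "g ` carrier ?P = carrier M.M"
    using pE_von_Dyck[OF M.group_M M.red_closed M.red_closed M.red_closed M.generate_basis M.basis_relations[OF HOL.refl HOL.refl]]
    by blast
  have "card (carrier M.M) \<le> card (carrier ?P)"
    unfolding g [symmetric] by (rule card_image_le[OF P.finite_carrier])
  then have "p ^ (3 * (r + t)) \<le> order ?P"
    using M.order_M by (simp add: order_def power_mult [symmetric] nat_power_eq mult.commute)
  then show ?thesis using P.order_le by simp
qed

section \<open>Matrices over the residue ring and integer representatives\<close>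

lemma residue_matrix_mult:
  fixes A B :: "int ^ 3 ^ 3"
  assumes m: "m > 1"
  shows "(A \<otimes>\<^bsub>matrix_monoid (residue_ring m)\<^esub> B) $ i $ j = (A ** B) $ i $ j mod m"
proof -
  interpret R: residues m "residue_ring m" by unfold_locales (use m in simp_all)
  let ?f = "\<lambda>k. A $ i $ k * B $ k $ j mod m"
  have f: "?f k \<in> carrier (residue_ring m)" for k using m by (simp add: residue_ring_def)
  have ne: "(1::3) \<noteq> 2" "(1::3) \<noteq> 3" "(2::3) \<noteq> 3" by simp_all
  have "(\<Oplus>\<^bsub>residue_ring m\<^esub>k\<in>UNIV. ?f k) = ?f 1 \<oplus>\<^bsub>residue_ring m\<^esub> (?f 2 \<oplus>\<^bsub>residue_ring m\<^esub> ?f 3)"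
    unfolding UNIV_3 using f ne by simp
  also have "\<dots> = (A ** B) $ i $ j mod m"
    by (simp add: residue_ring_def matrix_matrix_mult_def sum_3 mod_simps add.assoc)
  finally show ?thesis by (simp add: matrix_monoid_def residue_ring_def)
qed

lemma residue_matrix_one:
  "\<one>\<^bsub>matrix_monoid (residue_ring m)\<^esub> $ i $ j = (mat 1 :: int ^ 3 ^ 3) $ i $ j"
  by (simp add: matrix_monoid_def residue_ring_def mat_def)

lemma GL_representative_inverse:
  assumes m: "m > 1" and M: "M \<in> (GL (residue_ring (int m)) :: (int ^ 3 ^ 3) set)" and T: "represents T m M"
  obtains S where "\<And>i j. [(S ** T) $ i $ j = mat 1 $ i $ j] (mod int m)"
proof -
  obtain S where S: "S \<otimes>\<^bsub>matrix_monoid (residue_ring (int m))\<^esub> M = \<one>\<^bsub>matrix_monoid (residue_ring (int m))\<^esub>"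
    using M unfolding GL_def Units_def by auto
  have "[(S ** T) $ i $ j = mat 1 $ i $ j] (mod int m)" for i j
  proof -
    have "[(S ** T) $ i $ j = (S ** M) $ i $ j] (mod int m)"
      using T unfolding represents_def
      by (simp add: matrix_matrix_mult_def sum_3 cong_add cong_mult)
    moreover have "(S ** M) $ i $ j mod int m = mat 1 $ i $ j"
      using residue_matrix_mult[of "int m" S M i j] m residue_matrix_one S by simp
    moreover have "(mat 1 :: int ^ 3 ^ 3) $ i $ j mod int m = mat 1 $ i $ j"
      using m by (simp add: mat_def)
    ultimately show ?thesis by (simp add: cong_def)
  qed
  then show ?thesis using that by blast
qed

lemma GL_of_inverse:
  fixes T S :: "int ^ 3 ^ 3"
  assumes m: "m > 1"
    and TS: "\<And>i j. [(T ** S) $ i $ j = mat 1 $ i $ j] (mod int m)"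
    and ST: "\<And>i j. [(S ** T) $ i $ j = mat 1 $ i $ j] (mod int m)"
  shows "(\<chi> i j. T $ i $ j mod int m) \<in> GL (residue_ring (int m))"
proof -
  let ?R = "residue_ring (int m)"
  let ?r = "\<lambda>T :: int ^ 3 ^ 3. \<chi> i j. T $ i $ j mod int m"
  have closed: "?r T \<in> carrier (matrix_monoid ?R)" for T
    using m by (simp add: matrix_monoid_def residue_ring_def)
  have "?r A \<otimes>\<^bsub>matrix_monoid ?R\<^esub> ?r B = \<one>\<^bsub>matrix_monoid ?R\<^esub>"
    if "\<And>i j. [(A ** B) $ i $ j = mat 1 $ i $ j] (mod int m)" for A B
  proof -
    have "(?r A \<otimes>\<^bsub>matrix_monoid ?R\<^esub> ?r B) $ i $ j = \<one>\<^bsub>matrix_monoid ?R\<^esub> $ i $ j" for i j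
    proof -
      have "[(?r A ** ?r B) $ i $ j = (A ** B) $ i $ j] (mod int m)"
        by (simp add: matrix_matrix_mult_def sum_3 cong_add cong_mult)
      then have "(?r A ** ?r B) $ i $ j mod int m = (A ** B) $ i $ j mod int m"
        by (simp only: cong_def)
      also have "\<dots> = mat 1 $ i $ j" using that[of i j] m by (simp add: cong_def mat_def split: if_splits)
      finally show ?thesis using residue_matrix_mult[of "int m" "?r A" "?r B" i j] m residue_matrix_one by simp
    qed
    then show ?thesis by (simp add: vec_eq_iff)
  qed
  then show ?thesis unfolding GL_def Units_def using TS ST closed by blast
qed

text \<open>The p^r-th powers of a, b, c are killed by p^t, so the right-hand sides depend on the
  entries only modulo p^t. This extends the isomorphism to all representatives of one
  matrix.\<close>

lemma (in group) pE_relations_hold_cong: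
  assumes abc: "a \<in> carrier G" "b \<in> carrier G" "c \<in> carrier G"
    and rel: "pE_relations_hold p r t T a b c"
    and cong: "\<And>i j. [T' $ i $ j = T $ i $ j] (mod int (p ^ t))"
  shows "pE_relations_hold p r t T' a b c"
proof -
  let ?t = "tri (a [^] (p ^ r)) (b [^] (p ^ r)) (c [^] (p ^ r))" and ?m = "int (p ^ t)"
  have tmod: "?t (i mod ?m) (j mod ?m) (k mod ?m) = ?t i j k" for i j k
    using rel abc unfolding pE_relations_hold_def
    by (intro tri_mod) (simp_all add: nat_pow_pow power_add)
  have "?t (T' $ i $ 1) (T' $ i $ 2) (T' $ i $ 3) = ?t (T $ i $ 1) (T $ i $ 2) (T $ i $ 3)" for i
    using cong[of i 1] cong[of i 2] cong[of i 3]
      tmod[of "T $ i $ 1" "T $ i $ 2" "T $ i $ 3"] tmod[of "T' $ i $ 1" "T' $ i $ 2" "T' $ i $ 3"]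
    unfolding cong_def by simp
  then show ?thesis
    using rel unfolding pE_relations_hold_def tri_pow_arg[OF abc, symmetric] by simp
qed

text \<open>The inequality t <= r is a consequence: [x,y]^(p^r) = [x^(p^r), y] is trivial because
  x^(p^r) lies in the central subgroup G'. For p = 2 the hypothesis sharpens it to t < r, as the
  power map requires.\<close>

lemma pE_class2_of_pE_group:
  fixes G (structure)
  assumes p: "Factorial_Ring.prime p" and pE: "pE_group p G" and nc: "\<not> comm_group G"
    and abc: "a \<in> carrier G" "b \<in> carrier G" "c \<in> carrier G" and gen: "generate G {a, b, c} = carrier G"
    and r: "group_exponent (G Mod derived_subgroup G) = p ^ r"
    and t: "group_exponent (G\<lparr>carrier := derived_subgroup G\<rparr>) = p ^ t"
    and pt: "p > 2 \<or> p = 2 \<and> t \<noteq> r"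
  shows "pE_class2 G p r t"
proof -
  have grp: "group G" and fin: "finite (carrier G)" and ord: "\<exists>N. order G = p ^ N" and Engel: "two_Engel G"
    using pE by (auto simp: pE_group_def finite_p_group_def)
  interpret group G by (rule grp)
  interpret two_engel_group G by unfold_locales (rule Engel)
  have p1: "p > 1" using p prime_gt_1_nat by blast
  \<comment> \<open>The exponent provided by the definition of a pE-group has to be matched with the
    given r; p > 1 makes it unique.\<close>
  obtain r' where "group_exponent (G Mod derived_subgroup G) = p ^ r'" "Omega p r' G \<subseteq> group_center G"
    using pE by (auto simp: pE_group_def)
  then have Om: "Omega p r G \<subseteq> group_center G" using r p1 by simp
  have tors: "x \<in> group_center G" if "x \<in> carrier G" "x [^] (p ^ r) = \<one>\<^bsub>G\<^esub>" for x
    using Om that unfolding Omega_def by (blast intro: generate.incl)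
  interpret Q: group "G Mod derived_subgroup G" by (rule derived_quot_is_group)
  have finQ: "finite (carrier (G Mod derived_subgroup G))"
    unfolding carrier_FactGroup using fin by simp
  have pd: "x [^] (p ^ r) \<in> derived_subgroup G" if "x \<in> carrier G" for x
    using Q.group_exponent_facts(2)[OF finQ] derived_quotient_pow_eq_one[of "p ^ r"] that unfolding r by blast
  interpret class2_group G
    by unfold_locales (rule three_generated_class_le_2[OF gen abc pd tors])
  have gt: "generating_triple a b c" using abc gen by (simp add: generating_triple_def)
  let ?D = "G\<lparr>carrier := derived_subgroup G\<rparr>"
  interpret D: group ?D by (rule subgroup_imp_group[OF subgroup_derived])
  have finD: "finite (carrier ?D)" using fin derived_in_carrier[of "carrier G"] by (auto intro: finite_subset)
  have powD: "x [^]\<^bsub>?D\<^esub> (m::nat) = x [^]\<^bsub>G\<^esub> m" for x m by (simp add: nat_pow_def)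
  have de: "x [^] (p ^ t) = \<one>" if "x \<in> derived_subgroup G" for x
    using D.group_exponent_facts(2)[OF finD, of x] that unfolding t powD by simp
  have min: "p ^ t \<le> m" if "m > 0" "\<And>x. x \<in> derived_subgroup G \<Longrightarrow> x [^] m = \<one>" for m
    using D.group_exponent_facts(3)[OF finD that(1)] that(2) unfolding t powD by simp
  have t1: "1 \<le> t"
  proof (rule ccontr)
    assume "\<not> 1 \<le> t"
    then have "t = 0" by simp
    then have "x = \<one>" if "x \<in> derived_subgroup G" for x
      using de[OF that] derived_closed[OF that] by simp
    then have "x \<otimes> y = y \<otimes> x" if "x \<in> carrier G" "y \<in> carrier G" for x y
      using commutator_in_derived[OF that] commutator_eq_one_iff[OF that] by blast
    then show False using nc group_comm_groupI by blast
  qed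
  have sharp: "\<exists>x\<in>derived_subgroup G. x [^] (p ^ (t - 1)) \<noteq> \<one>"
  proof (rule ccontr)
    assume "\<not> ?thesis"
    then have "p ^ t \<le> p ^ (t - 1)" using p1 by (intro min) auto
    then show False using p1 t1 by (simp add: power_increasing_iff)
  qed
  have "p ^ t \<le> p ^ r"
  proof (rule min)
    show "p ^ r > 0" using p1 by simp
    fix d assume "d \<in> derived_subgroup G"
    then obtain i j k where d: "d = tri (commutator G a b) (commutator G a c) (commutator G b c) i j k"
      by (rule derived_decomposition[OF gt])
    have c1: "commutator G x y [^] (p ^ r) = \<one>" if "x \<in> carrier G" "y \<in> carrier G" for x y
      using that commutator_nat_pow_left[of x y "p ^ r"] commutator_center_left derived_central pd by simp
    have Z: "commutator G a b \<in> group_center G" "commutator G a c \<in> group_center G"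
      "commutator G b c \<in> group_center G" using abc commutator_center by auto
    have "d [^] int (p ^ r) = \<one>"
      unfolding d tri_central_pow[OF Z]
      using c1 abc int_pow_eq_one[of _ "p ^ r"] by (simp add: tri_def)
    then show "d [^] (p ^ r) = \<one>" by (simp only: int_pow_int)
  qed
  then have tr: "t \<le> r" using p1 by simp
  show ?thesis
    using p fin ord t1 tr pt de sharp pd tors by unfold_locales auto
qed

theorem theorem2p2:
  fixes G :: "('a, 'b) monoid_scheme" and p r t :: nat
  shows
    "(Factorial_Ring.prime p \<and> pE_group p G \<and> \<not> comm_group G \<and>
      (\<exists>a\<in>carrier G. \<exists>b\<in>carrier G. \<exists>c\<in>carrier G. generate G {a, b, c} = carrier G) \<and>
      group_exponent (G Mod derived_subgroup G) = p ^ r \<and>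
      group_exponent (G\<lparr>carrier := derived_subgroup G\<rparr>) = p ^ t \<and>
      (p > 2 \<or> p = 2 \<and> group_exponent (G\<lparr>carrier := derived_subgroup G\<rparr>) \<noteq> 2 ^ r)
      \<longrightarrow>
      1 \<le> t \<and> t \<le> r \<and> order G = p ^ (3 * (r + t)) \<and>
      (\<exists>M \<in> (GL (residue_ring (int (p ^ t))) :: (int ^ 3 ^ 3) set).
         \<forall>T. represents T (p ^ t) M \<longrightarrow> G \<cong> presented_group (pE_relations p r t T)))
     \<and>
     (\<forall>(q::nat) (s::nat) (u::nat).
        Factorial_Ring.prime q \<and> 1 \<le> u \<and> u \<le> s \<and> (q > 2 \<or> q = 2 \<and> u \<noteq> s) \<longrightarrow>
        (\<forall>M \<in> (GL (residue_ring (int (q ^ u))) :: (int ^ 3 ^ 3) set).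
           \<forall>T. represents T (q ^ u) M \<longrightarrow>
             pE_group q (presented_group (pE_relations q s u T))))"
proof (intro conjI impI allI ballI)
  assume H: "Factorial_Ring.prime p \<and> pE_group p G \<and> \<not> comm_group G \<and>
      (\<exists>a\<in>carrier G. \<exists>b\<in>carrier G. \<exists>c\<in>carrier G. generate G {a, b, c} = carrier G) \<and>
      group_exponent (G Mod derived_subgroup G) = p ^ r \<and>
      group_exponent (G\<lparr>carrier := derived_subgroup G\<rparr>) = p ^ t \<and>
      (p > 2 \<or> p = 2 \<and> group_exponent (G\<lparr>carrier := derived_subgroup G\<rparr>) \<noteq> 2 ^ r)"
  then obtain a b c where abc: "a \<in> carrier G" "b \<in> carrier G" "c \<in> carrier G"
    and gen: "generate G {a, b, c} = carrier G" by blast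
  have pt: "p > 2 \<or> p = 2 \<and> t \<noteq> r" using H by auto
  interpret pE_class2 G p r t
    by (rule pE_class2_of_pE_group[OF _ _ _ abc gen _ _ pt]) (use H in auto)
  have gt: "generating_triple a b c" using abc gen by (simp add: generating_triple_def)
  show "1 \<le> t" "t \<le> r" by (rule t_pos, rule t_le)
  show ord: "order G = p ^ (3 * (r + t))" by (rule order_eq[OF gt])
  obtain T0 S where rel: "pE_relations_hold p r t T0 a b c"
    and TS: "\<And>i j. [(T0 ** S) $ i $ j = mat 1 $ i $ j] (mod int (p ^ t))"
    and ST: "\<And>i j. [(S ** T0) $ i $ j = mat 1 $ i $ j] (mod int (p ^ t))"
    using relation_matrix[OF gt] by blast
  \<comment> \<open>The carrier of \<open>residue_ring\<close> consists of least residues, so the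
    integer matrix must be reduced before it can lie in \<open>GL\<close>.\<close>
  let ?M = "\<chi> i j. T0 $ i $ j mod int (p ^ t)"
  have pt1: "p ^ t > 1" using p_gt_1 t_pos one_less_power[of p t] by simp
  have "G \<cong> presented_group (pE_relations p r t T)" if T: "represents T (p ^ t) ?M" for T
  proof -
    let ?P = "presented_group (pE_relations p r t T)"
    have "pE_relations_hold p r t T a b c"
      by (rule pE_relations_hold_cong[OF abc rel])
        (use T in \<open>simp add: represents_def cong_def\<close>)
    then obtain g where g: "group_hom ?P G g" "g ` carrier ?P = carrier G"
      using pE_von_Dyck[OF is_group abc gen] by blast
    interpret P: pE_presented ?P p r t T "pE_gen p r t T Gx" "pE_gen p r t T Gy" "pE_gen p r t T Gz"
      by (rule pE_presented_presented_group[OF prime t_pos t_le t_less])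
    \<comment> \<open>Von Dyck's theorem provides only a surjection onto G; the equality of the two
      orders makes it injective.\<close>
    have "card (carrier ?P) = card (carrier G)"
      using order_presented_group[OF prime t_pos t_le t_less] ord by (simp add: order_def)
    then have "inj_on g (carrier ?P)"
      using g(2) P.finite_carrier by (simp add: eq_card_imp_inj_on)
    then have "g \<in> iso ?P G"
      using g by (auto simp: iso_def bij_betw_def group_hom_def group_hom_axioms_def)
    then show ?thesis using P.iso_sym is_isoI by blast
  qed
  then show "\<exists>M \<in> (GL (residue_ring (int (p ^ t))) :: (int ^ 3 ^ 3) set).
         \<forall>T. represents T (p ^ t) M \<longrightarrow> G \<cong> presented_group (pE_relations p r t T)"
    using GL_of_inverse[OF pt1 TS ST] by blast
next
  fix q s u :: nat and M :: "int ^ 3 ^ 3" and T :: "int ^ 3 ^ 3"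
  assume H: "Factorial_Ring.prime q \<and> 1 \<le> u \<and> u \<le> s \<and> (q > 2 \<or> q = 2 \<and> u \<noteq> s)"
    and M: "M \<in> GL (residue_ring (int (q ^ u)))" and T: "represents T (q ^ u) M"
  have q: "Factorial_Ring.prime q" "1 \<le> u" "u \<le> s" "q = 2 \<Longrightarrow> u < s" using H by auto
  have "q ^ u > 1" using prime_gt_1_nat[OF q(1)] q(2) one_less_power[of q u] by simp
  then obtain S where S: "\<And>i j. [(S ** T) $ i $ j = mat 1 $ i $ j] (mod int (q ^ u))"
    using GL_representative_inverse[OF _ M T] by blast
  interpret P: pE_presented "presented_group (pE_relations q s u T)" q s u T
      "pE_gen q s u T Gx" "pE_gen q s u T Gy" "pE_gen q s u T Gz"
    by (rule pE_presented_presented_group[OF q])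
  show "pE_group q (presented_group (pE_relations q s u T))"
    by (rule P.pE_group[OF order_presented_group[OF q] S])
qed

end
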